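(* For the problem of maximizing a non-negative submodular function $f:2^E\to\mathbb{R}_{\ge0}$ subject to the cardinality constraint $|X|\le k$ in the random-order streaming model, there is an algorithm using a buffer of size $\widetilde{O}(k^2)$ that achieves a $1/2$-approximation for general (non-monotone) non-negative submodular functions and a $0.5029$-approximation for non-negative symmetric submodular functions.
   Context: A function $f:2^E\to\mathbb{R}_{\ge0}$ is submodular if for all $S\subseteq T\subseteq E$ and $i\in E\setminus T$, $f(S\cup\{i\})-f(S)\ge f(T\cup\{i\})-f(T)$; it is symmetric if $f(S)=f(E\setminus S)$ for all $S\subseteq E$. Random-order streaming model: the elements of the ground set $E$ arrive one by one in a uniformly random order, each seen once. The algorithm maintains a memory buffer whose cost at any time is (number of stored elements) + (number of bits of other stored information). When an element arrives the algorithm may store it and/or discard stored elements and information. At any time it may make any number of value-oracle queries, but only on subsets of elements currently stored; results of queries may be written to memory as information. At the end it outputs a subset of at most $k$ of the stored elements. An $\alpha$-approximation means the output's (expected) value is at least $\alpha\max_{|Y|\le k}f(Y)$. The buffer size is the maximum memory cost. *)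

theory Defs
  imports "HOL-Probability.Probability" "HOL-Combinatorics.Multiset_Permutations"
    "HOL-Library.Landau_Symbols"
begin

definition nonneg_on :: "'a set \<Rightarrow> ('a set \<Rightarrow> real) \<Rightarrow> bool" where
  "nonneg_on E f \<longleftrightarrow> (\<forall>S\<subseteq>E. 0 \<le> f S)"

definition submodular_on :: "'a set \<Rightarrow> ('a set \<Rightarrow> real) \<Rightarrow> bool" where
  "submodular_on E f \<longleftrightarrow>
     (\<forall>S T i. S \<subseteq> T \<longrightarrow> T \<subseteq> E \<longrightarrow> i \<in> E - T \<longrightarrow>
        f (S \<union> {i}) - f S \<ge> f (T \<union> {i}) - f T)"

definition symmetric_on :: "'a set \<Rightarrow> ('a set \<Rightarrow> real) \<Rightarrow> bool" where
  "symmetric_on E f \<longleftrightarrow> (\<forall>S\<subseteq>E. f S = f (E - S))"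

text \<open>
  The functions in soft-O of \<open>g\<close>: bounded by \<open>g\<close> up to factors polylogarithmic in \<open>g\<close>.
\<close>

definition soft_bigo :: "(nat \<Rightarrow> real) \<Rightarrow> (nat \<Rightarrow> real) set" where
  "soft_bigo g = {h. \<exists>c::nat. h \<in> O(\<lambda>x. g x * ln (g x) ^ c)}"

text \<open>
  The memory holds the set of stored elements and the remaining information as a bit string.
  This is all that survives from one arrival to the next: transitions get no clock and no record
  of earlier queries or coin flips other than what the bit string holds.
  The oracle argument of \<open>arrive\<close> and \<open>finish\<close> is always the objective function restricted to
  sets of currently stored elements (see \<open>memory_after\<close> and \<open>alg_output\<close>); computation on it is
  unbounded.  An arriving element counts as stored while it is being processed.
\<close>

type_synonym 'a memory = "'a set \<times> bool list"

record 'a streaming_alg =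
  start :: "bool list pmf"
  arrive :: "'a \<Rightarrow> ('a set \<Rightarrow> real) \<Rightarrow> 'a memory \<Rightarrow> 'a memory pmf"
  finish :: "('a set \<Rightarrow> real) \<Rightarrow> 'a memory \<Rightarrow> 'a set pmf"

text \<open>Only stored elements can be kept, and at most \<open>k\<close> of them are output.\<close>

definition valid_alg :: "nat \<Rightarrow> 'a streaming_alg \<Rightarrow> bool" where
  "valid_alg k A \<longleftrightarrow>
     (\<forall>e q M w. \<forall>(M', w') \<in> set_pmf (arrive A e q (M, w)). M' \<subseteq> insert e M) \<and>
     (\<forall>q M w. \<forall>X \<in> set_pmf (finish A q (M, w)). X \<subseteq> M \<and> card X \<le> k)"

definition memory_after ::
    "'a streaming_alg \<Rightarrow> ('a set \<Rightarrow> real) \<Rightarrow> 'a list \<Rightarrow> 'a memory pmf" where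
  "memory_after A f xs =
     foldl (\<lambda>p e. bind_pmf p (\<lambda>(M, w). arrive A e (restrict f (Pow (insert e M))) (M, w)))
       (map_pmf (\<lambda>w. ({}, w)) (start A)) xs"

definition alg_output ::
    "'a streaming_alg \<Rightarrow> ('a set \<Rightarrow> real) \<Rightarrow> 'a list \<Rightarrow> 'a set pmf" where
  "alg_output A f xs =
     bind_pmf (memory_after A f xs) (\<lambda>(M, w). finish A (restrict f (Pow M)) (M, w))"

text \<open>
  The memory cost never exceeds \<open>b\<close> on the stream \<open>xs\<close>, whatever the coin flips.  It is
  measured just after each arrival, when the new element occupies memory too, and at the end.
\<close>

definition buffer_within ::
    "'a streaming_alg \<Rightarrow> ('a set \<Rightarrow> real) \<Rightarrow> 'a list \<Rightarrow> nat \<Rightarrow> bool" where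
  "buffer_within A f xs b \<longleftrightarrow>
     (\<forall>i\<le>length xs. \<forall>(M, w) \<in> set_pmf (memory_after A f (take i xs)).
        card (if i < length xs then insert (xs ! i) M else M) + length w \<le> b)"

definition random_order_output ::
    "'a streaming_alg \<Rightarrow> 'a set \<Rightarrow> ('a set \<Rightarrow> real) \<Rightarrow> 'a set pmf" where
  "random_order_output A E f = bind_pmf (pmf_of_set (permutations_of_set E)) (alg_output A f)"

definition approximates ::
    "real \<Rightarrow> nat \<Rightarrow> 'a streaming_alg \<Rightarrow> 'a set \<Rightarrow> ('a set \<Rightarrow> real) \<Rightarrow> bool" where
  "approximates \<alpha> k A E f \<longleftrightarrow>
     measure_pmf.expectation (random_order_output A E f) f
       \<ge> \<alpha> * Max (f ` {Y. Y \<subseteq> E \<and> card Y \<le> k})"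

end

(* Buffering with random ticks. Every arrival is a tick with probability c/n, so a tick counter with
   few bits splits the random stream into windows, and c of order k^2 log k makes the first k windows
   fill only a negligible fraction of it. From window j the algorithm keeps the element with the largest
   marginal value over the earlier picks. Later on, an element is saved if at some level (a prefix of
   this chain) it beats one of the picks made up to there; since the order is random, only about c
   later elements can beat a window, so only about c elements are saved per level.

   An element of the optimum which is not saved has, at the last level, at most the smallest increment
   of the chain as marginal value. Hence V >= k/(2k-1) OPT, up to an error of order 1/k, with
   a small constant, which is absorbed by k/(2k-1) - 1/2; for k <= 85 this already exceeds 0.5029.

   For symmetric f and k >= 86, let V < 0.50295 OPT. Then the chain increments are nearly constant, so
   that few elements of the optimum are saved, and some level is so low that the saved set T carries
   about 0.41 OPT on top of any set disjoint from the optimum, by posimodularity. So the best m saved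
   elements of a block of constant length have a value which is a constant fraction of OPT, while they
   hardly spoil the optimum. A second chain built on top of them, with one more level of saving, gains
   enough over OPT/2. *)

theory Submission
  imports Defs "HOL-Library.Log_Nat"
begin

section \<open>Marginal values, subsets of proportional value, Lovasz extension bounds\<close>

section \<open>Submodular functions\<close>


text \<open>The buffer may depend on k alone while n is arbitrary, so not even an exact position in
  the stream can be kept: log n bits are too many. Hence windows measured in random ticks, and bits
  that name elements only relative to the stored set. For non-monotone \<open>f\<close> the picks
  may damage the optimum, and their correlation with the order is out of control. All that is used
  is that they come from a short random stretch, so that each element is among them with small
  probability; a Lovasz extension bound turns this into a small loss. The slack that pays for all
  errors comes from measuring unsaved elements against the chain without its last pick: k - 1 picks
  and k elements of the optimum make 2k - 1. This slack fades as k grows, so symmetric functions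
  need another source. There posimodularity limits by f(A - X) what adding A can take away from f X.
  The gain beyond 1/2 has two origins: the core adds more than it spoils, and elements of the
  optimum that went by unsaved in the block are no longer among the opponents of the second
  chain.\<close>

locale submod =
  fixes E :: "'a set" and f :: "'a set \<Rightarrow> real"
  assumes fin: "finite E" and nn: "nonneg_on E f" and sm: "submodular_on E f"
begin

lemma f_nonneg: "S \<subseteq> E \<Longrightarrow> 0 \<le> f S"
  using nn by (auto simp: nonneg_on_def)

lemma marginal_antimono:
  assumes "S \<subseteq> T" "T \<subseteq> E" "i \<in> E" "i \<notin> T"
  shows "f (insert i T) - f T \<le> f (insert i S) - f S"
  using sm assms unfolding submodular_on_def by (auto dest!: spec[of _ S] spec[of _ T])

lemma marginal_set_antimono:
  assumes "S \<subseteq> T" "T \<subseteq> E" "X \<subseteq> E" "X \<inter> T = {}"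
  shows "f (T \<union> X) - f T \<le> f (S \<union> X) - f S"
proof -
  have "finite X" using assms fin finite_subset by blast
  then show ?thesis using assms(3,4)
  proof (induction X)
    case empty then show ?case by simp
  next
    case (insert x X)
    have "f (insert x (T \<union> X)) - f (T \<union> X) \<le> f (insert x (S \<union> X)) - f (S \<union> X)"
      by (rule marginal_antimono) (use insert assms in auto)
    then show ?case using insert by auto
  qed
qed

lemma submod_Un_Int:
  assumes "A \<subseteq> E" "B \<subseteq> E"
  shows "f (A \<union> B) + f (A \<inter> B) \<le> f A + f B"
proof -
  have "f (B \<union> (A - B)) - f B \<le> f (A \<inter> B \<union> (A - B)) - f (A \<inter> B)"
    by (rule marginal_set_antimono) (use assms in auto)
  moreover have "B \<union> (A - B) = A \<union> B" "A \<inter> B \<union> (A - B) = A" by auto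
  ultimately show ?thesis by simp
qed

lemma subadditive:
  assumes "A \<subseteq> E" "B \<subseteq> E"
  shows "f (A \<union> B) \<le> f A + f B"
  using submod_Un_Int[OF assms] f_nonneg[of "A \<inter> B"] assms by fastforce

lemma f_Un_le_card:
  fixes c :: real
  assumes "A \<subseteq> E" "X \<subseteq> E" "0 \<le> c"
    and "\<And>x. x \<in> X \<Longrightarrow> x \<notin> A \<Longrightarrow> f (insert x A) - f A \<le> c"
  shows "f (A \<union> X) \<le> f A + card X * c"
proof -
  have "finite X" using assms fin finite_subset by blast
  then show ?thesis using assms(2,4)
  proof (induction X)
    case empty then show ?case by simp
  next
    case (insert x X)
    have "f (insert x (A \<union> X)) - f (A \<union> X) \<le> c"
    proof (cases "x \<in> A \<union> X")
      case True then show ?thesis using assms(3) by (simp add: insert_absorb)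
    next
      case False
      then have "f (insert x (A \<union> X)) - f (A \<union> X) \<le> f (insert x A) - f A"
        using insert assms(1) by (intro marginal_antimono) auto
      also have "\<dots> \<le> c" using insert False by auto
      finally show ?thesis .
    qed
    moreover have "f (A \<union> X) \<le> f A + card X * c" using insert by auto
    ultimately show ?case using insert by (simp add: algebra_simps)
  qed
qed

text \<open>Repeatedly deleting the element of least marginal value loses at most the proportional share.\<close>

lemma exists_proportional_subset:
  assumes "A \<subseteq> E" "Z \<subseteq> E" "A \<inter> Z = {}" "j \<le> card Z"
  shows "\<exists>Y\<subseteq>Z. card Y = j \<and> real j * (f (A \<union> Z) - f A) \<le> card Z * (f (A \<union> Y) - f A)"
  using assms(2-)
proof (induction "card Z" arbitrary: Z)
  case 0 then show ?case by auto
next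
  case (Suc z)
  have finZ: "finite Z" using Suc.prems(1) fin finite_subset by blast
  show ?case
  proof (cases "j = Suc z")
    case True then show ?thesis using Suc by (intro exI[of _ Z]) auto
  next
    case False
    \<comment> \<open>The marginal values at the full set, summed over any part X of Z, are at most
      the increments from adding X one by one to A. For X = Z this shows that some element of Z has
      at most the average share; that one is deleted.\<close>
    have tele: "(\<Sum>x\<in>X. f (A \<union> Z) - f (A \<union> (Z - {x}))) \<le> f (A \<union> X) - f A" if "X \<subseteq> Z" for X
    proof -
      have "finite X" using that finZ finite_subset by blast
      then show ?thesis using that
      proof (induction X)
        case empty then show ?case by simp
      next
        case (insert x X)
        have "f (insert x (A \<union> (Z - {x}))) - f (A \<union> (Z - {x})) \<le> f (insert x (A \<union> X)) - f (A \<union> X)"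
          by (rule marginal_antimono) (use insert assms(1) Suc.prems in auto)
        moreover have "insert x (A \<union> (Z - {x})) = A \<union> Z" using insert by auto
        ultimately show ?case using insert by auto
      qed
    qed
    have "\<exists>x\<in>Z. (f (A \<union> Z) - f (A \<union> (Z - {x}))) * card Z \<le> f (A \<union> Z) - f A"
    proof (rule ccontr)
      assume "\<not> ?thesis"
      then have "\<And>x. x \<in> Z \<Longrightarrow> (f (A \<union> Z) - f A) / card Z < f (A \<union> Z) - f (A \<union> (Z - {x}))"
        using Suc.hyps by (simp add: not_le divide_less_eq)
      moreover have "Z \<noteq> {}" using Suc.hyps by auto
      ultimately have "(\<Sum>x\<in>Z. (f (A \<union> Z) - f A) / card Z) < (\<Sum>x\<in>Z. f (A \<union> Z) - f (A \<union> (Z - {x})))"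
        using finZ by (intro sum_strict_mono) auto
      then show False using tele[of Z] Suc.hyps by simp
    qed
    then obtain x where x: "x \<in> Z" "(f (A \<union> Z) - f (A \<union> (Z - {x}))) * card Z \<le> f (A \<union> Z) - f A" by auto
    have cz: "card (Z - {x}) = z" using x Suc.hyps finZ by simp
    have "\<exists>Y\<subseteq>Z - {x}. card Y = j \<and>
        real j * (f (A \<union> (Z - {x})) - f A) \<le> card (Z - {x}) * (f (A \<union> Y) - f A)"
      by (rule Suc.hyps(1)) (use cz Suc.prems False Suc.hyps in auto)
    then obtain Y where Y: "Y \<subseteq> Z - {x}" "card Y = j"
      "real j * (f (A \<union> (Z - {x})) - f A) \<le> z * (f (A \<union> Y) - f A)" using cz by auto
    have "real z * (f (A \<union> Z) - f A) \<le> Suc z * (f (A \<union> (Z - {x})) - f A)"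
      using x(2) Suc.hyps(2)[symmetric] by (simp add: algebra_simps)
    then have "real j * (real z * (f (A \<union> Z) - f A)) \<le> real j * (Suc z * (f (A \<union> (Z - {x})) - f A))"
      by (intro mult_left_mono) auto
    also have "\<dots> = Suc z * (real j * (f (A \<union> (Z - {x})) - f A))" by simp
    also have "\<dots> \<le> Suc z * (z * (f (A \<union> Y) - f A))" using Y by (intro mult_left_mono) auto
    finally have *: "real z * (real j * (f (A \<union> Z) - f A)) \<le> real z * (Suc z * (f (A \<union> Y) - f A))"
      by (simp add: algebra_simps)
    show ?thesis
    proof (cases "z = 0")
      case True
      then have "j = 0" using False Suc.prems Suc.hyps by auto
      then show ?thesis by (intro exI[of _ "{}"]) auto
    next
      case False
      then have "real j * (f (A \<union> Z) - f A) \<le> Suc z * (f (A \<union> Y) - f A)"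
        using * by (simp add: mult_le_cancel_left_pos)
      then show ?thesis using Y Suc.hyps(2) by (intro exI[of _ Y]) auto
    qed
  qed
qed

text \<open>\<open>exists_proportional_subset\<close> read backwards: if \<open>Z - A\<close> gained
  more than its share, some j of its elements would gain more than x. If \<open>Z - A\<close> has at
  most j elements it is itself a candidate, and \<open>j \<le> z\<close> makes up for the
  difference.\<close>

lemma f_Un_le_proportional:
  fixes x :: real
  assumes "A \<subseteq> E" "Z \<subseteq> E" "0 < j" "0 \<le> x"
    and small: "\<And>Y. Y \<subseteq> Z - A \<Longrightarrow> card Y \<le> j \<Longrightarrow> f (A \<union> Y) - f A \<le> x"
    and "card (Z - A) \<le> z" "j \<le> z"
  shows "real j * (f (A \<union> Z) - f A) \<le> z * x"
proof -
  have un: "A \<union> (Z - A) = A \<union> Z" by auto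
  show ?thesis
  proof (cases "card (Z - A) \<le> j")
    case True
    have "f (A \<union> Z) - f A \<le> x" using small[OF order_refl True] unfolding un .
    then have "real j * (f (A \<union> Z) - f A) \<le> real j * x" by (intro mult_left_mono) auto
    also have "\<dots> \<le> z * x" using assms(4,7) by (intro mult_right_mono) auto
    finally show ?thesis .
  next
    case False
    obtain Y where Y: "Y \<subseteq> Z - A" "card Y = j"
       "real j * (f (A \<union> (Z - A)) - f A) \<le> card (Z - A) * (f (A \<union> Y) - f A)"
    proof -
      have "\<exists>Y\<subseteq>Z - A. card Y = j \<and>
          real j * (f (A \<union> (Z - A)) - f A) \<le> card (Z - A) * (f (A \<union> Y) - f A)"
        by (rule exists_proportional_subset) (use assms(1,2) False in auto)
      then show ?thesis using that by blast
    qed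
    have "real (card (Z - A)) * (f (A \<union> Y) - f A) \<le> card (Z - A) * x"
      using small[OF Y(1)] Y(2) by (intro mult_left_mono) auto
    also have "\<dots> \<le> z * x" using assms(4,6) by (intro mult_right_mono) auto
    finally show ?thesis using Y(3) unfolding un by linarith
  qed
qed

text \<open>Inserting the elements of \<open>D i\<close> in the order of \<open>us\<close>, each
  contributes at least the increment of the full initial segment of \<open>us\<close>, because less
  has been inserted before it. Averaging over i turns these contributions into probabilities. The
  order is arbitrary; the sorted one gives the Lovasz extension.\<close>

lemma sum_f_ge_lovasz:
  assumes "distinct us" "set us \<inter> C = {}" "set us \<subseteq> E" "C \<subseteq> E" "finite I"
    and w: "\<And>i. i \<in> I \<Longrightarrow> 0 \<le> w i" "sum w I = 1"
    and D: "\<And>i. i \<in> I \<Longrightarrow> D i \<subseteq> set us"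
  shows "f C + (\<Sum>k<length us. (\<Sum>i | i \<in> I \<and> us ! k \<in> D i. w i) *
            (f (C \<union> set (take (Suc k) us)) - f (C \<union> set (take k us))))
         \<le> (\<Sum>i\<in>I. w i * f (C \<union> D i))"
proof -
  define d where "d k = f (C \<union> set (take (Suc k) us)) - f (C \<union> set (take k us))" for k
  have one: "f C + (\<Sum>k<l. if us ! k \<in> X then d k else 0) \<le> f (C \<union> (X \<inter> set (take l us)))"
    if "l \<le> length us" for X l
    using that
  proof (induction l)
    case 0 then show ?case by simp
  next
    case (Suc l)
    have tk: "set (take (Suc l) us) = insert (us ! l) (set (take l us))"
      using Suc.prems by (simp add: take_Suc_conv_app_nth)
    have nin: "us ! l \<notin> set (take l us)"
      using Suc.prems assms(1) by (auto simp: in_set_conv_nth nth_eq_iff_index_eq)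
    have "us ! l \<in> set us" using Suc.prems by simp
    show ?case
    proof (cases "us ! l \<in> X")
      case False
      then show ?thesis using Suc tk by (simp add: Int_insert_right)
    next
      case True
      have "f (insert (us ! l) (C \<union> set (take l us))) - f (C \<union> set (take l us))
          \<le> f (insert (us ! l) (C \<union> (X \<inter> set (take l us)))) - f (C \<union> (X \<inter> set (take l us)))"
        by (rule marginal_antimono)
          (use assms nin \<open>us ! l \<in> set us\<close> set_take_subset[of l us] in auto)
      moreover have "C \<union> (X \<inter> set (take (Suc l) us)) = insert (us ! l) (C \<union> (X \<inter> set (take l us)))"
        using True tk by auto
      moreover have "d l = f (insert (us ! l) (C \<union> set (take l us))) - f (C \<union> set (take l us))"
        unfolding d_def tk by simp
      ultimately show ?thesis using Suc True by simp
    qed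
  qed
  have "f C + (\<Sum>k<length us. (\<Sum>i | i \<in> I \<and> us ! k \<in> D i. w i) * d k)
      = (\<Sum>i\<in>I. w i * f C) + (\<Sum>i\<in>I. w i * (\<Sum>k<length us. if us ! k \<in> D i then d k else 0))"
  proof -
    have "(\<Sum>i | i \<in> I \<and> us ! k \<in> D i. w i) * d k = (\<Sum>i\<in>I. w i * (if us ! k \<in> D i then d k else 0))" for k
    proof -
      have "(\<Sum>i | i \<in> I \<and> us ! k \<in> D i. w i) * d k = (\<Sum>i\<in>I. if us ! k \<in> D i then w i else 0) * d k"
        using assms(5) by (simp add: sum.inter_filter)
      also have "\<dots> = (\<Sum>i\<in>I. (if us ! k \<in> D i then w i else 0) * d k)" by (rule sum_distrib_right)
      finally show ?thesis by (simp add: if_distrib if_distribR cong: if_cong)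
    qed
    then have "(\<Sum>k<length us. (\<Sum>i | i \<in> I \<and> us ! k \<in> D i. w i) * d k)
      = (\<Sum>i\<in>I. \<Sum>k<length us. w i * (if us ! k \<in> D i then d k else 0))"
      by (simp add: sum.swap[of _ I "{..<length us}"])
    moreover have "(\<Sum>i\<in>I. w i * f C) = f C" using w(2) by (simp flip: sum_distrib_right)
    ultimately show ?thesis by (simp add: sum_distrib_left)
  qed
  also have "\<dots> = (\<Sum>i\<in>I. w i * (f C + (\<Sum>k<length us. if us ! k \<in> D i then d k else 0)))"
    by (simp add: sum.distrib algebra_simps)
  also have "\<dots> \<le> (\<Sum>i\<in>I. w i * f (C \<union> D i))"
  proof (rule sum_mono)
    fix i assume i: "i \<in> I"
    have "D i \<inter> set us = D i" using D[OF i] by auto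
    then show "w i * (f C + (\<Sum>k<length us. if us ! k \<in> D i then d k else 0)) \<le> w i * f (C \<union> D i)"
      using one[of "length us" "D i"] w(1)[OF i] by (intro mult_left_mono) auto
  qed
  finally show ?thesis unfolding d_def .
qed

text \<open>The expectation of a submodular function on a random set dominates its Lovasz extension at the
  vector of marginal probabilities, whatever the correlations; here the marginals lie in
  \<open>[q, p]\<close>.\<close>

lemma sum_f_random_ge:
  assumes U: "U \<inter> C = {}" "U \<subseteq> E" "C \<subseteq> E" and "finite I"
    and w: "\<And>i. i \<in> I \<Longrightarrow> 0 \<le> w i" "sum w I = 1"
    and D: "\<And>i. i \<in> I \<Longrightarrow> D i \<subseteq> U"
    and pq: "\<And>u. u \<in> U \<Longrightarrow> (\<Sum>i | i \<in> I \<and> u \<in> D i. w i) \<le> p"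
      "\<And>u. u \<in> U \<Longrightarrow> q \<le> (\<Sum>i | i \<in> I \<and> u \<in> D i. w i)" "0 \<le> q" "q \<le> p"
  shows "(1 - p) * f C + q * f (C \<union> U) \<le> (\<Sum>i\<in>I. w i * f (C \<union> D i))"
proof -
  define P where "P u = (\<Sum>i | i \<in> I \<and> u \<in> D i. w i)" for u
  have "finite U" using U fin finite_subset by blast
  then obtain us0 where us0: "set us0 = U" "distinct us0" using finite_distinct_list by blast
  \<comment> \<open>In order of decreasing probability the coefficients after summation by parts are
    nonnegative, so nonnegativity of \<open>f\<close> allows all intermediate prefixes to be
    discarded.\<close>
  define us where "us = sort_key (\<lambda>u. - P u) us0"
  have us: "set us = U" "distinct us" "sorted (map (\<lambda>u. - P u) us)"
    using us0 by (auto simp: us_def)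
  have mono: "P (us ! j) \<le> P (us ! i)" if "i \<le> j" "j < length us" for i j
    using us(3) that by (auto simp: sorted_iff_nth_mono)
  define d where "d k = f (C \<union> set (take (Suc k) us)) - f (C \<union> set (take k us))" for k
  \<comment> \<open>Summation by parts as an induction on the prefix length. The empty prefix has no
    last probability; q and the correction term are put there to make both sides equal.\<close>
  have "- p * f C + (if l = 0 then q else P (us ! (l - 1))) * f (C \<union> set (take l us))
          \<le> (\<Sum>k<l. P (us ! k) * d k) + (q - p) * f C * of_bool (l = 0)" if "l \<le> length us" for l
    using that
  proof (induction l)
    case 0 then show ?case by (simp add: algebra_simps)
  next
    case (Suc l)
    have sub: "C \<union> set (take l us) \<subseteq> E" "C \<union> set (take (Suc l) us) \<subseteq> E"
      using U us(1) set_take_subset[of l us] set_take_subset[of "Suc l" us] by blast+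
    have in_U: "us ! l \<in> U" using Suc.prems us(1) nth_mem by fastforce
    show ?case
    proof (cases "l = 0")
      case True
      have "P (us ! 0) * f C \<le> p * f C"
        using pq(1)[OF in_U] True U(3) f_nonneg by (intro mult_right_mono) (auto simp: P_def)
      then show ?thesis using True by (simp add: d_def algebra_simps)
    next
      case False
      have "P (us ! l) * f (C \<union> set (take l us)) \<le> P (us ! (l - 1)) * f (C \<union> set (take l us))"
        using mono[of "l - 1" l] Suc.prems f_nonneg[OF sub(1)] by (intro mult_right_mono) auto
      then show ?thesis using Suc False by (simp add: d_def algebra_simps)
    qed
  qed
  from this[of "length us"]
  have last: "- p * f C + (if length us = 0 then q else P (us ! (length us - 1))) * f (C \<union> set us)
      \<le> (\<Sum>k<length us. P (us ! k) * d k) + (q - p) * f C * of_bool (length us = 0)" by simp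
  have main: "(1 - p) * f C + q * f (C \<union> U) \<le> f C + (\<Sum>k<length us. P (us ! k) * d k)"
  proof (cases "length us = 0")
    case True then show ?thesis using us(1) pq U(3) f_nonneg[of C]
      by (auto simp: algebra_simps intro: mult_right_mono)
  next
    case False
    then have "us ! (length us - 1) \<in> U" using us(1) by (metis diff_less length_0_conv less_numeral_extra(1) nth_mem length_greater_0_conv)
    then have "q * f (C \<union> U) \<le> P (us ! (length us - 1)) * f (C \<union> U)"
      using pq(2) f_nonneg U unfolding P_def by (intro mult_right_mono) auto
    then show ?thesis using last False us(1) by (simp add: algebra_simps)
  qed
  also have "\<dots> \<le> (\<Sum>i\<in>I. w i * f (C \<union> D i))"
    unfolding P_def d_def by (rule sum_f_ge_lovasz) (use U us(1,2) w D assms(4) in auto)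
  finally show ?thesis .
qed

text \<open>On subsets Y of U, the function sending Y to f (X - Y) is again nonnegative and
  submodular, so the bound for random additions covers random deletions.\<close>

lemma sum_f_remove_ge:
  assumes U: "U \<subseteq> X" "X \<subseteq> E" and "finite I"
    and w: "\<And>i. i \<in> I \<Longrightarrow> 0 \<le> w i" "sum w I = 1"
    and pq: "\<And>u. u \<in> U \<Longrightarrow> (\<Sum>i | i \<in> I \<and> u \<in> D i. w i) \<le> p"
      "\<And>u. u \<in> U \<Longrightarrow> q \<le> (\<Sum>i | i \<in> I \<and> u \<in> D i. w i)" "0 \<le> q" "q \<le> p"
  shows "(1 - p) * f X + q * f (X - U) \<le> (\<Sum>i\<in>I. w i * f (X - (U \<inter> D i)))"
proof -
  interpret g: submod "U" "\<lambda>Y. f (X - Y)"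
  proof
    show "finite U" using U fin by (meson finite_subset)
    show "nonneg_on U (\<lambda>Y. f (X - Y))" using U by (auto simp: nonneg_on_def intro!: f_nonneg)
    show "submodular_on U (\<lambda>Y. f (X - Y))" unfolding submodular_on_def
    proof (intro allI impI)
      fix S T i assume *: "S \<subseteq> T" "T \<subseteq> U" "i \<in> U - T"
      have "f (insert i (X - (S \<union> {i}))) - f (X - (S \<union> {i})) \<le> f (insert i (X - (T \<union> {i}))) - f (X - (T \<union> {i}))"
        by (rule marginal_antimono) (use * U in auto)
      moreover have "insert i (X - (S \<union> {i})) = X - S" "insert i (X - (T \<union> {i})) = X - T"
        using * U by auto
      ultimately show "f (X - (T \<union> {i})) - f (X - T) \<le> f (X - (S \<union> {i})) - f (X - S)" by simp
    qed
  qed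
  have "(1 - p) * f (X - {}) + q * f (X - ({} \<union> U)) \<le> (\<Sum>i\<in>I. w i * f (X - ({} \<union> (U \<inter> D i))))"
  proof (rule g.sum_f_random_ge)
    fix u assume u: "u \<in> U"
    then have "{i \<in> I. u \<in> U \<inter> D i} = {i \<in> I. u \<in> D i}" by blast
    then show "(\<Sum>i | i \<in> I \<and> u \<in> U \<inter> D i. w i) \<le> p" "q \<le> (\<Sum>i | i \<in> I \<and> u \<in> U \<inter> D i. w i)"
      using pq(1,2)[OF u] by simp_all
  qed (fact | simp)+
  then show ?thesis by simp
qed

end

section \<open>Symmetric functions and posimodularity\<close>

locale sym_submod = submod +
  assumes sym: "symmetric_on E f"
begin

text \<open>Submodularity for X and the complement of Y: the intersection is X - Y, and the union
  has the complement Y - X.\<close>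

lemma posimodular:
  assumes "X \<subseteq> E" "Y \<subseteq> E"
  shows "f (X - Y) + f (Y - X) \<le> f X + f Y"
proof -
  have c: "f S = f (E - S)" if "S \<subseteq> E" for S using sym that unfolding symmetric_on_def by blast
  have 1: "f (X \<union> (E - Y)) + f (X \<inter> (E - Y)) \<le> f X + f (E - Y)"
    using assms by (intro submod_Un_Int) auto
  have "X \<union> (E - Y) \<subseteq> E" using assms by auto
  from c[OF this] have 2: "f (X \<union> (E - Y)) = f (E - (X \<union> (E - Y)))" .
  have e: "X \<inter> (E - Y) = X - Y" "E - (X \<union> (E - Y)) = Y - X" using assms by auto
  show ?thesis using 1 2 c[OF assms(2)] unfolding e by linarith
qed

text \<open>Posimodularity for \<open>X \<union> Y\<close> and \<open>Y - X\<close>, whose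
  differences are X and the empty set.\<close>

lemma f_Un_ge_diff:
  assumes "X \<subseteq> E" "Y \<subseteq> E"
  shows "f (X \<union> Y) \<ge> f X - f (Y - X)"
proof -
  have "X \<union> Y \<subseteq> E" "Y - X \<subseteq> E" using assms by auto
  from posimodular[OF this]
  have 1: "f ((X \<union> Y) - (Y - X)) + f ((Y - X) - (X \<union> Y)) \<le> f (X \<union> Y) + f (Y - X)" .
  have e: "(X \<union> Y) - (Y - X) = X" "(Y - X) - (X \<union> Y) = {}" by auto
  have "0 \<le> f {}" by (rule f_nonneg) simp
  then show ?thesis using 1 unfolding e by linarith
qed

end

section \<open>Uniformly random orders: conditioning, symmetries, negative correlation\<close>

section \<open>Averages over random orders\<close>


text \<open>The expectation over a uniformly random order of R, as a finite sum, so that linearity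
  and conditioning need no integrability. \<open>expectation_alg\<close> is the bridge from the
  probability mass functions.\<close>

definition perm_avg :: "'a set \<Rightarrow> ('a list \<Rightarrow> real) \<Rightarrow> real" where
  "perm_avg R G = (\<Sum>xs\<in>permutations_of_set R. G xs) / fact (card R)"

lemma card_perms: "finite R \<Longrightarrow> card (permutations_of_set R) = fact (card R)"
  by simp

lemma perm_avg_const [simp]: "finite R \<Longrightarrow> perm_avg R (\<lambda>_. c) = c"
  by (simp add: perm_avg_def)

lemma perm_avg_add: "perm_avg R (\<lambda>xs. G xs + H xs) = perm_avg R G + perm_avg R H"
  by (simp add: perm_avg_def sum.distrib add_divide_distrib)

lemma perm_avg_diff: "perm_avg R (\<lambda>xs. G xs - H xs) = perm_avg R G - perm_avg R H"
  by (simp add: perm_avg_def sum_subtractf diff_divide_distrib)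

lemma perm_avg_cmult: "perm_avg R (\<lambda>xs. c * G xs) = c * perm_avg R G"
  by (simp add: perm_avg_def flip: sum_distrib_left)

lemma perm_avg_sum: "perm_avg R (\<lambda>xs. \<Sum>i\<in>I. G i xs) = (\<Sum>i\<in>I. perm_avg R (G i))"
  by (simp add: perm_avg_def sum.swap[of _ I] flip: sum_divide_distrib)

lemma perm_avg_mono:
  "(\<And>xs. xs \<in> permutations_of_set R \<Longrightarrow> G xs \<le> H xs) \<Longrightarrow> perm_avg R G \<le> perm_avg R H"
  by (auto simp: perm_avg_def intro!: divide_right_mono sum_mono)

lemma perm_avg_cong:
  "(\<And>xs. xs \<in> permutations_of_set R \<Longrightarrow> G xs = H xs) \<Longrightarrow> perm_avg R G = perm_avg R H"
  by (auto simp: perm_avg_def intro!: arg_cong2[of _ _ _ _ "(/)"] sum.cong)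

lemma perm_avg_ge_const:
  "finite R \<Longrightarrow> (\<And>xs. xs \<in> permutations_of_set R \<Longrightarrow> c \<le> G xs) \<Longrightarrow> c \<le> perm_avg R G"
  using perm_avg_mono[of R "\<lambda>_. c" G] by simp

lemma perm_avg_le_const:
  "finite R \<Longrightarrow> (\<And>xs. xs \<in> permutations_of_set R \<Longrightarrow> G xs \<le> c) \<Longrightarrow> perm_avg R G \<le> c"
  using perm_avg_mono[of R G "\<lambda>_. c"] by simp

lemma perm_avg_Cons:
  assumes "finite R" "R \<noteq> {}"
  shows "perm_avg R G = (\<Sum>x\<in>R. perm_avg (R - {x}) (\<lambda>ys. G (x # ys))) / card R"
proof -
  have "(\<Sum>xs\<in>permutations_of_set R. G xs) = (\<Sum>x\<in>R. \<Sum>ys\<in>permutations_of_set (R - {x}). G (x # ys))"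
    unfolding permutations_of_set_nonempty[OF assms(2)]
    by (subst sum.UNION_disjoint) (auto simp: assms sum.reindex)
  moreover have "fact (card R) = real (card R) * fact (card R - 1)"
    using assms by (metis card_gt_0_iff fact_reduce of_nat_fact of_nat_mult)
  moreover have "perm_avg (R - {x}) H = (\<Sum>ys\<in>permutations_of_set (R - {x}). H ys) / fact (card R - 1)"
    if "x \<in> R" for x H using that assms by (simp add: perm_avg_def)
  ultimately show ?thesis by (simp add: perm_avg_def flip: sum_divide_distrib)
qed

text \<open>Given its first i elements, a random order continues with a uniformly random order of
  what is left; proved by peeling off the head.\<close>

lemma perm_avg_tower:
  assumes "finite R" "i \<le> card R"
  shows "perm_avg R G
    = perm_avg R (\<lambda>xs. perm_avg (R - set (take i xs)) (\<lambda>ys. G (take i xs @ ys)))"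
  using assms
proof (induction i arbitrary: R G)
  case 0 then show ?case by simp
next
  case (Suc i)
  then have ne: "R \<noteq> {}" by auto
  have *: "perm_avg (R - {x}) (\<lambda>ys. G (x # ys)) = perm_avg (R - {x})
      (\<lambda>xs. perm_avg (R - set (take (Suc i) (x # xs))) (\<lambda>ys. G (take (Suc i) (x # xs) @ ys)))"
    if "x \<in> R" for x
  proof -
    have "i \<le> card (R - {x})" using Suc.prems that by simp
    then have "perm_avg (R - {x}) (\<lambda>ys. G (x # ys)) = perm_avg (R - {x})
      (\<lambda>xs. perm_avg (R - {x} - set (take i xs)) (\<lambda>ys. G (x # take i xs @ ys)))"
      using Suc.IH[of "R - {x}" "\<lambda>ys. G (x # ys)"] Suc.prems(1) by simp
    moreover have "R - {x} - set (take i xs) = R - set (take (Suc i) (x # xs))" for xs by auto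
    ultimately show ?thesis by simp
  qed
  show ?case
    unfolding perm_avg_Cons[OF Suc.prems(1) ne, of G] 
      perm_avg_Cons[OF Suc.prems(1) ne, of "\<lambda>xs. perm_avg (R - set (take (Suc i) xs)) (\<lambda>ys. G (take (Suc i) xs @ ys))"]
    using * by (simp cong: sum.cong)
qed

lemma perm_avg_reindex:
  assumes "bij_betw h (permutations_of_set R) (permutations_of_set R)"
  shows "perm_avg R (\<lambda>xs. G (h xs)) = perm_avg R G"
  unfolding perm_avg_def using sum.reindex_bij_betw[OF assms, of G] by simp

lemma perm_avg_rotate: "perm_avg R (\<lambda>xs. G (rotate i xs)) = perm_avg R G"
proof (rule perm_avg_reindex)
  have "inj_on (rotate i) (permutations_of_set R)"
    by (rule inj_onI) (metis inj_rotate1 rotate_def inj_fn injD)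
  moreover have "rotate i ` permutations_of_set R \<subseteq> permutations_of_set R"
    by (auto simp: permutations_of_set_def)
  ultimately show "bij_betw (rotate i) (permutations_of_set R) (permutations_of_set R)"
    by (simp add: bij_betw_def endo_inj_surj)
qed

lemma perm_avg_map:
  assumes "bij_betw s R R"
  shows "perm_avg R (\<lambda>xs. G (map s xs)) = perm_avg R G"
proof (rule perm_avg_reindex)
  have inj: "inj_on s R" and im: "s ` R = R" using assms by (auto simp: bij_betw_def)
  have "inj_on (map s) (permutations_of_set R)"
    by (rule inj_onI) (use inj in \<open>auto simp: permutations_of_set_def intro: map_inj_on\<close>)
  moreover have "map s ` permutations_of_set R \<subseteq> permutations_of_set R"
    using inj im by (auto simp: permutations_of_set_def distinct_map)
  ultimately show "bij_betw (map s) (permutations_of_set R) (permutations_of_set R)"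
    by (simp add: bij_betw_def endo_inj_surj)
qed

text \<open>The heads z other than x, each followed by an order avoiding both, range over the orders
  of \<open>R - {x}\<close>. The inductions on prefixes below regroup in this way the case that the
  stream does not start with x.\<close>

lemma perm_avg_swap_Cons:
  assumes "finite R" "x \<in> R"
  shows "(\<Sum>z\<in>R - {x}. perm_avg (R - {z} - {x}) (\<lambda>ys. G (z # ys))) = (card R - 1) * perm_avg (R - {x}) G"
proof (cases "R - {x} = {}")
  case True
  then have "R = {x}" using assms by auto
  then show ?thesis by simp
next
  case False
  have "perm_avg (R - {x}) G = (\<Sum>z\<in>R - {x}. perm_avg (R - {x} - {z}) (\<lambda>ys. G (z # ys))) / card (R - {x})"
    by (rule perm_avg_Cons) (use assms False in auto)
  moreover have "R - {x} - {z} = R - {z} - {x}" for z by auto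
  moreover have c: "card (R - {x}) = card R - 1" using assms by simp
  moreover have "card (R - {x}) \<noteq> 0" using False assms(1) by (metis card_eq_0_iff finite_Diff)
  ultimately show ?thesis by (simp add: field_simps)
qed

text \<open>Given that x is among the first l elements, the other l - 1 are distributed as the
  prefix of a random order of \<open>R - {x}\<close>. At l = 0 the factor l hides the truncated
  \<open>l - 1\<close>.\<close>

lemma perm_avg_mem_prefix:
  assumes "finite R" "x \<in> R" "l \<le> card R"
  shows "perm_avg R (\<lambda>xs. of_bool (x \<in> set (take l xs)) * H (set (take l xs) - {x}))
       = l / card R * perm_avg (R - {x}) (\<lambda>ys. H (set (take (l - 1) ys)))"
  using assms
proof (induction l arbitrary: R H)
  case 0 then show ?case by simp
next
  case (Suc l)
  have ne: "R \<noteq> {}" and c0: "card R \<noteq> 0" using Suc by auto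
  let ?G = "\<lambda>xs. of_bool (x \<in> set (take (Suc l) xs)) * H (set (take (Suc l) xs) - {x})"
  have x1: "perm_avg (R - {x}) (\<lambda>ys. ?G (x # ys)) = perm_avg (R - {x}) (\<lambda>ys. H (set (take l ys)))"
  proof (rule perm_avg_cong)
    fix ys assume "ys \<in> permutations_of_set (R - {x})"
    then have "x \<notin> set (take l ys)" using set_take_subset[of l ys] by (auto simp: permutations_of_set_def)
    then show "?G (x # ys) = H (set (take l ys))" by simp
  qed
  have z1: "perm_avg (R - {z}) (\<lambda>ys. ?G (z # ys))
      = l / (card R - 1) * perm_avg (R - {z} - {x}) (\<lambda>ys. H (insert z (set (take (l - 1) ys))))"
    if "z \<in> R - {x}" for z
  proof -
    have "perm_avg (R - {z}) (\<lambda>ys. ?G (z # ys)) = perm_avg (R - {z}) (\<lambda>ys.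
        of_bool (x \<in> set (take l ys)) * H (insert z (set (take l ys) - {x})))"
      using that by (intro perm_avg_cong) (auto simp: insert_Diff_if)
    also have "\<dots> = l / card (R - {z}) * perm_avg (R - {z} - {x}) (\<lambda>ys. H (insert z (set (take (l - 1) ys))))"
      by (rule Suc.IH) (use Suc.prems that in auto)
    finally show ?thesis using that Suc.prems by simp
  qed
  have "perm_avg R ?G = (\<Sum>z\<in>R. perm_avg (R - {z}) (\<lambda>ys. ?G (z # ys))) / card R"
    by (rule perm_avg_Cons) (use Suc ne in auto)
  also have "(\<Sum>z\<in>R. perm_avg (R - {z}) (\<lambda>ys. ?G (z # ys))) =
     perm_avg (R - {x}) (\<lambda>ys. ?G (x # ys)) + (\<Sum>z\<in>R - {x}. perm_avg (R - {z}) (\<lambda>ys. ?G (z # ys)))"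
    by (rule sum.remove) (use Suc in auto)
  also have "(\<Sum>z\<in>R - {x}. perm_avg (R - {z}) (\<lambda>ys. ?G (z # ys)))
     = l / (card R - 1) * (\<Sum>z\<in>R - {x}. perm_avg (R - {z} - {x}) (\<lambda>ys. H (insert z (set (take (l - 1) ys)))))"
    by (simp only: z1 sum_distrib_left cong: sum.cong)
  also have "\<dots> = l * perm_avg (R - {x}) (\<lambda>ys. H (set (take l ys)))"
  proof (cases "l = 0")
    case False
    have "(\<Sum>z\<in>R - {x}. perm_avg (R - {z} - {x}) (\<lambda>ys. H (insert z (set (take (l - 1) ys)))))
        = (\<Sum>z\<in>R - {x}. perm_avg (R - {z} - {x}) (\<lambda>ys. H (set (take l (z # ys)))))"
      using False by (simp add: take_Cons')
    also have "\<dots> = (card R - 1) * perm_avg (R - {x}) (\<lambda>ys. H (set (take l ys)))"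
      by (rule perm_avg_swap_Cons) (use Suc in auto)
    finally show ?thesis using False Suc.prems by simp
  qed simp
  finally show ?case unfolding x1 using c0 by (simp add: field_simps)
qed

lemma perm_avg_not_mem_prefix:
  assumes "finite R" "x \<in> R" "l \<le> card R"
  shows "perm_avg R (\<lambda>xs. of_bool (x \<notin> set (take l xs)) * H (set (take l xs)))
       = (1 - l / card R) * perm_avg (R - {x}) (\<lambda>ys. H (set (take l ys)))"
  using assms
proof (induction l arbitrary: R H)
  case 0 then show ?case by simp
next
  case (Suc l)
  have ne: "R \<noteq> {}" and c0: "card R \<noteq> 0" using Suc by auto
  let ?G = "\<lambda>xs. of_bool (x \<notin> set (take (Suc l) xs)) * H (set (take (Suc l) xs))"
  have z1: "perm_avg (R - {z}) (\<lambda>ys. ?G (z # ys))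
      = (1 - l / (card R - 1)) * perm_avg (R - {z} - {x}) (\<lambda>ys. H (set (take (Suc l) (z # ys))))"
    if "z \<in> R - {x}" for z
  proof -
    have "perm_avg (R - {z}) (\<lambda>ys. ?G (z # ys)) = perm_avg (R - {z}) (\<lambda>ys.
        of_bool (x \<notin> set (take l ys)) * H (insert z (set (take l ys))))"
      using that by (intro perm_avg_cong) auto
    also have "\<dots> = (1 - l / card (R - {z})) * perm_avg (R - {z} - {x}) (\<lambda>ys. H (insert z (set (take l ys))))"
      by (rule Suc.IH) (use Suc.prems that in auto)
    finally show ?thesis using that Suc.prems by simp
  qed
  have "perm_avg R ?G = (\<Sum>z\<in>R. perm_avg (R - {z}) (\<lambda>ys. ?G (z # ys))) / card R"
    by (rule perm_avg_Cons) (use Suc ne in auto)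
  also have "(\<Sum>z\<in>R. perm_avg (R - {z}) (\<lambda>ys. ?G (z # ys))) =
     perm_avg (R - {x}) (\<lambda>ys. ?G (x # ys)) + (\<Sum>z\<in>R - {x}. perm_avg (R - {z}) (\<lambda>ys. ?G (z # ys)))"
    by (rule sum.remove) (use Suc in auto)
  also have "perm_avg (R - {x}) (\<lambda>ys. ?G (x # ys)) = 0" using Suc.prems by simp
  also have "(\<Sum>z\<in>R - {x}. perm_avg (R - {z}) (\<lambda>ys. ?G (z # ys)))
     = (1 - l / (card R - 1)) * (\<Sum>z\<in>R - {x}. perm_avg (R - {z} - {x}) (\<lambda>ys. H (set (take (Suc l) (z # ys)))))"
    by (simp only: z1 sum_distrib_left cong: sum.cong)
  also have "(\<Sum>z\<in>R - {x}. perm_avg (R - {z} - {x}) (\<lambda>ys. H (set (take (Suc l) (z # ys)))))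
        = (card R - 1) * perm_avg (R - {x}) (\<lambda>ys. H (set (take (Suc l) ys)))"
      by (rule perm_avg_swap_Cons) (use Suc in auto)
  also have "(1 - l / (card R - 1)) * ((card R - 1) * perm_avg (R - {x}) (\<lambda>ys. H (set (take (Suc l) ys))))
    = (real (card R) - Suc l) * perm_avg (R - {x}) (\<lambda>ys. H (set (take (Suc l) ys)))"
  proof (cases "card R = 1")
    case True then show ?thesis using Suc.prems by simp
  next
    case False
    then have "card R \<ge> 2" using c0 by auto
    then show ?thesis by (simp add: field_simps of_nat_diff)
  qed
  finally show ?case using c0 by (simp add: field_simps)
qed

lemma perm_avg_mem_prefix_prob:
  assumes "finite R" "x \<in> R" "l \<le> card R"
  shows "perm_avg R (\<lambda>xs. of_bool (x \<in> set (take l xs))) = l / card R"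
  using perm_avg_mem_prefix[OF assms, of "\<lambda>_. 1"] assms by simp

text \<open>Membership of \<open>x\<close> in a random prefix is negatively correlated with every monotone function of the
  rest of the prefix.\<close>

lemma perm_avg_neg_assoc:
  assumes "finite R" "x \<in> R" "l \<le> card R"
    and mono: "\<And>X Y. X \<subseteq> Y \<Longrightarrow> Y \<subseteq> R \<Longrightarrow> H X \<le> H Y" and ind: "\<And>X. X \<subseteq> R \<Longrightarrow> H (X - {x}) = H X"
  shows "perm_avg R (\<lambda>xs. of_bool (x \<in> set (take l xs)) * H (set (take l xs)))
      \<le> l / card R * perm_avg R (\<lambda>xs. H (set (take l xs)))"
proof -
  have sub: "set (take l xs) \<subseteq> R" if "xs \<in> permutations_of_set R" for xs
    using that set_take_subset[of l xs] by (auto simp: permutations_of_set_def)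
  \<comment> \<open>\<open>a\<close> and \<open>b\<close> are the conditional means given that x is
    in the prefix or is not. In the first case one element less is seen besides x, so
    \<open>a \<le> b\<close>, and the overall mean lies between them.\<close>
  define a where "a = perm_avg (R - {x}) (\<lambda>ys. H (set (take (l - 1) ys)))"
  define b where "b = perm_avg (R - {x}) (\<lambda>ys. H (set (take l ys)))"
  have 1: "perm_avg R (\<lambda>xs. of_bool (x \<in> set (take l xs)) * H (set (take l xs))) = l / card R * a"
    unfolding a_def perm_avg_mem_prefix[OF assms(1-3), symmetric]
    by (rule perm_avg_cong) (simp add: ind sub)
  have 2: "perm_avg R (\<lambda>xs. of_bool (x \<notin> set (take l xs)) * H (set (take l xs))) = (1 - l / card R) * b"
    unfolding b_def by (rule perm_avg_not_mem_prefix[OF assms(1-3)])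
  have "perm_avg R (\<lambda>xs. H (set (take l xs))) = l / card R * a + (1 - l / card R) * b"
    unfolding 1[symmetric] 2[symmetric] perm_avg_add[symmetric] by (rule perm_avg_cong) auto
  moreover have "a \<le> b" unfolding a_def b_def
  proof (rule perm_avg_mono)
    fix ys assume "ys \<in> permutations_of_set (R - {x})"
    then have "set (take l ys) \<subseteq> R" using set_take_subset[of l ys] by (auto simp: permutations_of_set_def)
    then show "H (set (take (l - 1) ys)) \<le> H (set (take l ys))"
      by (intro mono set_take_subset_set_take) auto
  qed
  moreover have "real l \<le> card R" using assms by simp
  then have "0 \<le> real l / card R" "real l / card R \<le> 1" by (auto simp: divide_le_eq_1)
  then have "(1 - l / card R) * a \<le> (1 - l / card R) * b" using \<open>a \<le> b\<close> by (intro mult_left_mono) auto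
  ultimately have "a \<le> perm_avg R (\<lambda>xs. H (set (take l xs)))" by (simp add: algebra_simps)
  then show ?thesis unfolding 1 by (intro mult_left_mono) auto
qed

text \<open>While D has been avoided it still lies entirely in the remaining set, so each draw
  misses it with probability at most 1 - |D| / N. Keeping N fixed makes this factor the same
  throughout the induction.\<close>

lemma perm_avg_prefix_avoids:
  assumes "finite R" "D \<subseteq> R" "l \<le> card R" "card R \<le> N" "0 < N"
  shows "perm_avg R (\<lambda>xs. of_bool (set (take l xs) \<inter> D = {})) \<le> (1 - card D / N) ^ l"
  using assms
proof (induction l arbitrary: R)
  case 0 then show ?case by simp
next
  case (Suc l)
  have ne: "R \<noteq> {}" and c0: "card R \<noteq> 0" using Suc by auto
  have dR: "card D \<le> card R" using Suc.prems by (simp add: card_mono)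
  have "perm_avg R (\<lambda>xs. of_bool (set (take (Suc l) xs) \<inter> D = {}))
    = (\<Sum>z\<in>R. perm_avg (R - {z}) (\<lambda>ys. of_bool (set (take (Suc l) (z # ys)) \<inter> D = {}))) / card R"
    by (rule perm_avg_Cons) (use Suc ne in auto)
  also have "\<dots> \<le> (\<Sum>z\<in>R. of_bool (z \<notin> D) * (1 - card D / N) ^ l) / card R"
  proof (intro divide_right_mono sum_mono)
    fix z assume z: "z \<in> R"
    show "perm_avg (R - {z}) (\<lambda>ys. of_bool (set (take (Suc l) (z # ys)) \<inter> D = {}))
      \<le> of_bool (z \<notin> D) * (1 - card D / N) ^ l"
    proof (cases "z \<in> D")
      case True then show ?thesis using Suc.prems by simp
    next
      case False
      then have "perm_avg (R - {z}) (\<lambda>ys. of_bool (set (take l ys) \<inter> D = {})) \<le> (1 - card D / N) ^ l"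
        using Suc.prems z by (intro Suc.IH) auto
      then show ?thesis using False by simp
    qed
  qed auto
  also have "\<dots> = (1 - card D / card R) * (1 - card D / N) ^ l"
  proof -
    have "(\<Sum>z\<in>R. of_bool (z \<notin> D) :: real) = card (R - D)" using Suc.prems
      by (simp add: Diff_eq Collect_neg_eq Int_def) 
    moreover have "real (card (R - D)) = real (card R) - card D"
      using Suc.prems dR by (simp add: card_Diff_subset finite_subset of_nat_diff)
    ultimately have *: "(\<Sum>z\<in>R. of_bool (z \<notin> D) :: real) = real (card R) - card D" by simp
    show ?thesis unfolding sum_distrib_right[symmetric] * using c0 by (simp add: field_simps)
  qed
  also have "\<dots> \<le> (1 - card D / N) * (1 - card D / N) ^ l"
  proof (rule mult_right_mono)
    have "real (card D) / N \<le> card D / card R" using Suc.prems c0 by (intro divide_left_mono) auto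
    then show "1 - real (card D) / card R \<le> 1 - real (card D) / N" by simp
    have "card D \<le> N" using dR Suc.prems by linarith
    then show "0 \<le> (1 - real (card D) / N) ^ l" using Suc.prems by (intro zero_le_power) (simp add: divide_le_eq_1)
  qed
  finally show ?case by simp
qed


text \<open>Rotating the order by i * l brings block i to the front, and rotations permute the
  orders.\<close>

lemma perm_avg_block:
  assumes "Suc i * l \<le> card R"
  shows "perm_avg R (\<lambda>xs. g (set (take l (drop (i * l) xs)))) = perm_avg R (\<lambda>xs. g (set (take l xs)))"
proof -
  have "take l (rotate (i * l) xs) = take l (drop (i * l) xs)" if "xs \<in> permutations_of_set R" for xs
  proof (cases "l = 0")
    case False
    have len: "length xs = card R" using that by (rule length_finite_permutations_of_set)
    then have "i * l mod length xs = i * l" using assms False by simp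
    then show ?thesis using len assms by (simp add: rotate_drop_take)
  qed simp
  then have "perm_avg R (\<lambda>xs. g (set (take l (drop (i * l) xs)))) = perm_avg R (\<lambda>xs. g (set (take l (rotate (i * l) xs))))"
    by (intro perm_avg_cong) simp
  also have "\<dots> = perm_avg R (\<lambda>xs. g (set (take l xs)))" by (rule perm_avg_rotate)
  finally show ?thesis .
qed

text \<open>The cyclic shifts of \<open>T\<close> act on the permutations; averaging over them makes the part of the prefix
  in \<open>T\<close> uniform without touching the rest of the prefix.\<close>

lemma cyclic_shifts_exist:
  assumes "finite T" "T \<noteq> {}"
  obtains s :: "nat \<Rightarrow> 'a \<Rightarrow> 'a" where
    "\<And>i. bij_betw (s i) T T" "\<And>i x. x \<notin> T \<Longrightarrow> s i x = x"
    "\<And>C u. C \<subseteq> T \<Longrightarrow> u \<in> T \<Longrightarrow> card {i. i < card T \<and> u \<in> s i ` C} = card C"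
proof -
  define N where "N = card T"
  have N0: "N > 0" using assms by (simp add: N_def card_gt_0_iff)
  obtain h where h: "bij_betw h {0..<N} T" unfolding N_def using assms(1) ex_bij_betw_nat_finite by blast
  define g where "g = inv_into {0..<N} h"
  have g: "bij_betw g T {0..<N}" unfolding g_def using h by (rule bij_betw_inv_into)
  have gN: "g x < N" if "x \<in> T" for x using g that by (auto simp: bij_betw_def)
  have hg: "h (g x) = x" if "x \<in> T" for x using h that by (simp add: g_def bij_betw_inv_into_right)
  have gh: "g (h j) = j" if "j < N" for j using h that by (simp add: g_def bij_betw_inv_into_left)
  have hT: "h j \<in> T" if "j < N" for j using h that by (auto simp: bij_betw_def)
  define s where "s i x = (if x \<in> T then h ((g x + i) mod N) else x)" for i x
  have sT: "s i x \<in> T" if "x \<in> T" for i x using that N0 by (simp add: s_def hT)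
  have modeq: "a = b" if "(a + i) mod N = (b + i) mod N" "a < N" "b < N" for a b i
  proof -
    have "a mod N = b mod N" using that(1) by (simp add: nat_mod_eq_iff)
    then show ?thesis using that by simp
  qed
  have inj: "inj_on (s i) T" for i
  proof (rule inj_onI)
    fix x y assume "x \<in> T" "y \<in> T" "s i x = s i y"
    then have "(g x + i) mod N = (g y + i) mod N" using N0 by (metis s_def gh mod_less_divisor)
    then show "x = y" using modeq gN hg \<open>x \<in> T\<close> \<open>y \<in> T\<close> by metis
  qed
  have bij: "bij_betw (s i) T T" for i
  proof -
    have "s i ` T \<subseteq> T" using sT by blast
    then show ?thesis using inj[of i] endo_inj_surj[OF assms(1)] by (simp add: bij_betw_def)
  qed
  have "card {i. i < card T \<and> u \<in> s i ` C} = card C" if C: "C \<subseteq> T" and u: "u \<in> T" for C u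
  proof -
    \<comment> \<open>The shift that carries x to u. Different x need different shifts, so the
      shifts that put u into the image of C are counted by C.\<close>
    define r where "r x = (g u + N - g x) mod N" for x
    have r: "(g x + r x) mod N = g u" if "x \<in> T" for x
    proof -
      have "(g x + r x) mod N = (g x + (g u + N - g x)) mod N" by (simp add: r_def mod_add_right_eq)
      also have "g x + (g u + N - g x) = g u + N" using gN[OF that] by simp
      finally show ?thesis using gN[OF u] by simp
    qed
    have "{i. i < card T \<and> u \<in> s i ` C} = r ` C"
    proof (intro equalityI subsetI)
      fix i assume "i \<in> {i. i < card T \<and> u \<in> s i ` C}"
      then obtain x where x: "i < N" "x \<in> C" "u = s i x" by (auto simp: N_def)
      then have xT: "x \<in> T" using C by auto
      then have "g u = (g x + i) mod N" using x N0 by (simp add: s_def gh)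
      then have "(i + g x) mod N = (r x + g x) mod N" using r[OF xT] by (simp add: add.commute)
      then have "i = r x" using modeq[of i "g x" "r x"] x N0 by (simp add: r_def)
      then show "i \<in> r ` C" using x by simp
    next
      fix i assume "i \<in> r ` C"
      then obtain x where x: "x \<in> C" "i = r x" by auto
      then have xT: "x \<in> T" using C by auto
      then have "s i x = u" using x r[OF xT] hg[OF u] by (simp add: s_def)
      moreover have "i < N" using x N0 by (simp add: r_def)
      ultimately show "i \<in> {i. i < card T \<and> u \<in> s i ` C}" using x by (auto simp: N_def)
    qed
    moreover have "inj_on r C"
    proof (rule inj_onI)
      fix x y assume *: "x \<in> C" "y \<in> C" "r x = r y"
      then have "x \<in> T" "y \<in> T" using C by auto
      then have "(g x + r x) mod N = (g y + r x) mod N" using r * by metis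
      then show "x = y" using modeq gN hg \<open>x \<in> T\<close> \<open>y \<in> T\<close> by metis
    qed
    ultimately show ?thesis by (simp add: card_image)
  qed
  then show thesis using that[of s] bij by (simp add: s_def)
qed

section \<open>Submodular values of sets that depend on the random order\<close>

context submod
begin

lemma perm_avg_f_random_ge:
  assumes "U \<inter> C = {}" "U \<subseteq> E" "C \<subseteq> E" "finite R"
    and D: "\<And>xs. xs \<in> permutations_of_set R \<Longrightarrow> D xs \<subseteq> U"
    and pq: "\<And>u. u \<in> U \<Longrightarrow> perm_avg R (\<lambda>xs. of_bool (u \<in> D xs)) \<le> p"
      "\<And>u. u \<in> U \<Longrightarrow> q \<le> perm_avg R (\<lambda>xs. of_bool (u \<in> D xs))" "0 \<le> q" "q \<le> p"
  shows "(1 - p) * f C + q * f (C \<union> U) \<le> perm_avg R (\<lambda>xs. f (C \<union> D xs))"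
proof -
  let ?w = "\<lambda>_. 1 / fact (card R) :: real"
  have P: "perm_avg R (\<lambda>xs. of_bool (u \<in> D xs)) = (\<Sum>xs | xs \<in> permutations_of_set R \<and> u \<in> D xs. ?w xs)" for u
    by (simp add: perm_avg_def Int_def)
  have "(1 - p) * f C + q * f (C \<union> U) \<le> (\<Sum>xs\<in>permutations_of_set R. ?w xs * f (C \<union> D xs))"
  proof (rule sum_f_random_ge)
    show "sum ?w (permutations_of_set R) = 1" using assms(4) by simp
    show "\<And>u. u \<in> U \<Longrightarrow> (\<Sum>xs | xs \<in> permutations_of_set R \<and> u \<in> D xs. ?w xs) \<le> p"
      "\<And>u. u \<in> U \<Longrightarrow> q \<le> (\<Sum>xs | xs \<in> permutations_of_set R \<and> u \<in> D xs. ?w xs)"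
      using pq(1,2) by (simp_all add: P)
  qed (fact | simp)+
  then show ?thesis by (simp add: perm_avg_def sum_divide_distrib)
qed

lemma perm_avg_f_remove_ge:
  assumes "U \<subseteq> X" "X \<subseteq> E" "finite R"
    and pq: "\<And>u. u \<in> U \<Longrightarrow> perm_avg R (\<lambda>xs. of_bool (u \<in> D xs)) \<le> p"
      "\<And>u. u \<in> U \<Longrightarrow> q \<le> perm_avg R (\<lambda>xs. of_bool (u \<in> D xs))" "0 \<le> q" "q \<le> p"
  shows "(1 - p) * f X + q * f (X - U) \<le> perm_avg R (\<lambda>xs. f (X - (U \<inter> D xs)))"
proof -
  let ?w = "\<lambda>_. 1 / fact (card R) :: real"
  have P: "perm_avg R (\<lambda>xs. of_bool (u \<in> D xs)) = (\<Sum>xs | xs \<in> permutations_of_set R \<and> u \<in> D xs. ?w xs)" for u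
    by (simp add: perm_avg_def Int_def)
  have "(1 - p) * f X + q * f (X - U) \<le> (\<Sum>xs\<in>permutations_of_set R. ?w xs * f (X - (U \<inter> D xs)))"
  proof (rule sum_f_remove_ge)
    show "sum ?w (permutations_of_set R) = 1" using assms(3) by simp
    show "\<And>u. u \<in> U \<Longrightarrow> (\<Sum>xs | xs \<in> permutations_of_set R \<and> u \<in> D xs. ?w xs) \<le> p"
      "\<And>u. u \<in> U \<Longrightarrow> q \<le> (\<Sum>xs | xs \<in> permutations_of_set R \<and> u \<in> D xs. ?w xs)"
      using pq(1,2) by (simp_all add: P)
  qed (fact | simp)+
  then show ?thesis by (simp add: perm_avg_def sum_divide_distrib)
qed

text \<open>The worst way to spoil \<open>X\<close> after the elements in \<open>P\<close> are gone: the deletable elements of \<open>X\<close> lying in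
  \<open>P\<close> are lost, and any part of \<open>P\<close> may have been added.\<close>

definition worst :: "'a set \<Rightarrow> 'a set \<Rightarrow> 'a set \<Rightarrow> real" where
  "worst X D P = Min ((\<lambda>Z. f (Z \<union> (X - (D \<inter> P)))) ` Pow P)"

lemma worst_le: "finite P \<Longrightarrow> Z \<subseteq> P \<Longrightarrow> worst X D P \<le> f (Z \<union> (X - (D \<inter> P)))"
  unfolding worst_def by (rule Min_le) auto

lemma worst_attained:
  assumes "finite P" obtains Z where "Z \<subseteq> P" "worst X D P = f (Z \<union> (X - (D \<inter> P)))"
proof -
  have "worst X D P \<in> (\<lambda>Z. f (Z \<union> (X - (D \<inter> P)))) ` Pow P"
    unfolding worst_def using assms by (intro Min_in) auto
  then show thesis using that by auto
qed

text \<open>The worst Z is chosen for each prefix separately, but every element belongs to it with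
  probability at most l / |R|. Submodularity for the spoilt set and X separates additions from
  deletions; each kind costs at most that fraction of f X, hence the factor 2.\<close>

lemma perm_avg_worst_ge:
  assumes R: "R \<subseteq> E" and X: "X \<subseteq> E" "D \<subseteq> X" and l: "l \<le> card R"
  shows "(1 - 2 * (l / card R)) * f X \<le> perm_avg R (\<lambda>xs. worst X D (set (take l xs)))"
proof -
  have finR: "finite R" using R fin by (meson finite_subset)
  define Zs where "Zs P = (SOME Z. Z \<subseteq> P \<and> worst X D P = f (Z \<union> (X - (D \<inter> P))))" for P
  have Zs: "Zs P \<subseteq> P \<and> worst X D P = f (Zs P \<union> (X - (D \<inter> P)))" if "P \<subseteq> R" for P
  proof -
    have "finite P" using that finR by (meson finite_subset)
    then have "\<exists>Z. Z \<subseteq> P \<and> worst X D P = f (Z \<union> (X - (D \<inter> P)))" by (meson worst_attained)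
    then show ?thesis unfolding Zs_def by (rule someI_ex)
  qed
  define P where "P xs = set (take l xs)" for xs :: "'a list"
  have PR: "P xs \<subseteq> R" if "xs \<in> permutations_of_set R" for xs
    using that set_take_subset[of l xs] by (auto simp: P_def permutations_of_set_def)
  let ?r = "real l / card R"
  have prob: "perm_avg R (\<lambda>xs. of_bool (u \<in> Y xs)) \<le> ?r" "0 \<le> perm_avg R (\<lambda>xs. of_bool (u \<in> Y xs))"
    if "\<And>xs. xs \<in> permutations_of_set R \<Longrightarrow> Y xs \<subseteq> P xs" for u Y
  proof -
    show "0 \<le> perm_avg R (\<lambda>xs. of_bool (u \<in> Y xs))" using finR by (intro perm_avg_ge_const) auto
    show "perm_avg R (\<lambda>xs. of_bool (u \<in> Y xs)) \<le> ?r"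
    proof (cases "u \<in> R")
      case True
      have "perm_avg R (\<lambda>xs. of_bool (u \<in> Y xs)) \<le> perm_avg R (\<lambda>xs. of_bool (u \<in> set (take l xs)))"
        by (rule perm_avg_mono) (use that in \<open>auto simp: P_def\<close>)
      then show ?thesis using perm_avg_mem_prefix_prob[OF finR True l] by simp
    next
      case False
      then have "perm_avg R (\<lambda>xs. of_bool (u \<in> Y xs)) \<le> 0"
        using that PR finR by (intro perm_avg_le_const) fastforce+
      also have "0 \<le> ?r" by simp
      finally show ?thesis .
    qed
  qed
  have 1: "(1 - ?r) * f X + 0 * f (X \<union> (E - X)) \<le> perm_avg R (\<lambda>xs. f (X \<union> (Zs (P xs) - X)))"
  proof (rule perm_avg_f_random_ge)
    show "\<And>xs. xs \<in> permutations_of_set R \<Longrightarrow> Zs (P xs) - X \<subseteq> E - X" using Zs PR R by blast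
    fix u
    have "Zs (P xs) - X \<subseteq> P xs" if "xs \<in> permutations_of_set R" for xs using Zs[OF PR[OF that]] by blast
    then show "perm_avg R (\<lambda>xs. of_bool (u \<in> Zs (P xs) - X)) \<le> ?r"
      "0 \<le> perm_avg R (\<lambda>xs. of_bool (u \<in> Zs (P xs) - X))"
      using prob[of "\<lambda>xs. Zs (P xs) - X" u] by blast+
  qed (use X finR in auto)
  have 2: "(1 - ?r) * f X + 0 * f (X - D) \<le> perm_avg R (\<lambda>xs. f (X - (D \<inter> (P xs - Zs (P xs)))))"
  proof (rule perm_avg_f_remove_ge)
    fix u
    show "perm_avg R (\<lambda>xs. of_bool (u \<in> P xs - Zs (P xs))) \<le> ?r"
      "0 \<le> perm_avg R (\<lambda>xs. of_bool (u \<in> P xs - Zs (P xs)))"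
      using prob[of "\<lambda>xs. P xs - Zs (P xs)" u] by blast+
  qed (use X finR in auto)
  have "perm_avg R (\<lambda>xs. f (X \<union> (Zs (P xs) - X)) + f (X - (D \<inter> (P xs - Zs (P xs)))) - f X)
       \<le> perm_avg R (\<lambda>xs. worst X D (P xs))"
  proof (rule perm_avg_mono)
    fix xs assume xs: "xs \<in> permutations_of_set R"
    let ?Z = "Zs (P xs)" and ?Y = "Zs (P xs) \<union> (X - (D \<inter> P xs))"
    have "f (?Y \<union> X) + f (?Y \<inter> X) \<le> f ?Y + f X"
      using Zs[OF PR[OF xs]] PR[OF xs] R X by (intro submod_Un_Int) auto
    moreover have "?Y \<union> X = X \<union> (?Z - X)" "?Y \<inter> X = X - (D \<inter> (P xs - ?Z))" using X by auto
    ultimately show "f (X \<union> (?Z - X)) + f (X - (D \<inter> (P xs - ?Z))) - f X \<le> worst X D (P xs)"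
      using Zs[OF PR[OF xs]] by simp
  qed
  then have "perm_avg R (\<lambda>xs. f (X \<union> (Zs (P xs) - X))) + perm_avg R (\<lambda>xs. f (X - (D \<inter> (P xs - Zs (P xs))))) - f X
      \<le> perm_avg R (\<lambda>xs. worst X D (P xs))" using finR by (simp only: perm_avg_add perm_avg_diff perm_avg_const)
  moreover have "(1 - 2 * ?r) * f X = (1 - ?r) * f X + (1 - ?r) * f X - f X" by algebra
  ultimately show ?thesis using 1 2 unfolding P_def by linarith
qed

text \<open>Under the cyclic shifts of T the prefix outside T and the number of its elements in T
  stay fixed, while each element of T occurs equally often, so the Lovasz bound applies with p = q.
  K stands for any choice made outside T, and w for a weight depending on the number.\<close>

lemma perm_avg_uniform_part_ge:
  assumes R: "R \<subseteq> E" and T: "T \<subseteq> R" "T \<noteq> {}"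
    and K: "\<And>X. X \<subseteq> R - T \<Longrightarrow> K X \<subseteq> E - T" and w: "\<And>c. 0 \<le> w c"
  shows "perm_avg R (\<lambda>xs. w (card (set (take l xs) \<inter> T)) *
            ((1 - card (set (take l xs) \<inter> T) / card T) * f (K (set (take l xs) - T))
             + card (set (take l xs) \<inter> T) / card T * f (K (set (take l xs) - T) \<union> T)))
     \<le> perm_avg R (\<lambda>xs. w (card (set (take l xs) \<inter> T)) *
          f (K (set (take l xs) - T) \<union> (set (take l xs) \<inter> T)))"
    (is "perm_avg R ?L \<le> perm_avg R ?G")
proof -
  have finR: "finite R" using R fin by (meson finite_subset)
  then have finT: "finite T" using T by (meson finite_subset)
  obtain s where bij: "\<And>i. bij_betw (s i) T T" and fix_s: "\<And>i x. x \<notin> T \<Longrightarrow> s i x = x"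
    and marg: "\<And>C u. C \<subseteq> T \<Longrightarrow> u \<in> T \<Longrightarrow> card {i. i < card T \<and> u \<in> s i ` C} = card C"
    using cyclic_shifts_exist[OF finT T(2)] by metis
  have c0: "card T > 0" using finT T by (simp add: card_gt_0_iff)
  have bijR: "bij_betw (s i) R R" for i
  proof -
    have "bij_betw (s i) (R - T) (R - T) \<longleftrightarrow> bij_betw (\<lambda>x. x) (R - T) (R - T)"
      by (rule bij_betw_cong) (simp add: fix_s)
    then have "bij_betw (s i) (R - T) (R - T)" by (simp add: bij_betw_def)
    from bij_betw_combine[OF bij[of i] this] have "bij_betw (s i) (T \<union> (R - T)) (T \<union> (R - T))" by auto
    then show ?thesis using T by (simp add: Un_absorb1)
  qed
  have "perm_avg R ?L \<le> perm_avg R (\<lambda>xs. (\<Sum>i<card T. ?G (map (s i) xs)) / card T)"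
  proof (rule perm_avg_mono)
    fix xs assume xs: "xs \<in> permutations_of_set R"
    define B where "B = set (take l xs)"
    have BR: "B \<subseteq> R" using xs set_take_subset[of l xs] by (auto simp: B_def permutations_of_set_def)
    have inT: "s i x \<in> T \<longleftrightarrow> x \<in> T" for i x
      using bij[of i] fix_s[of x i] by (cases "x \<in> T") (auto simp: bij_betw_def)
    have B1: "s i ` B - T = B - T" for i
    proof -
      have "s i ` B - T = s i ` (B - T)" using inT[of i] by blast
      also have "\<dots> = id ` (B - T)" by (rule image_cong) (simp_all add: fix_s)
      finally show ?thesis by simp
    qed
    have B2: "s i ` B \<inter> T = s i ` (B \<inter> T)" for i using inT[of i] by blast
    have B3: "card (s i ` (B \<inter> T)) = card (B \<inter> T)" for i
      using bij[of i] by (intro card_image) (auto simp: bij_betw_def intro: inj_on_subset)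
    let ?K = "K (B - T)" and ?c = "real (card (B \<inter> T)) / card T"
    have KE: "?K \<subseteq> E - T" using K[of "B - T"] BR by auto
    have "(1 - ?c) * f ?K + ?c * f (?K \<union> T) \<le> (\<Sum>i<card T. 1 / card T * f (?K \<union> s i ` (B \<inter> T)))"
    proof (rule sum_f_random_ge)
      show "(\<Sum>i<card T. 1 / real (card T)) = 1" using c0 by simp
      show "\<And>i. s i ` (B \<inter> T) \<subseteq> T" using bij by (auto simp: bij_betw_def)
      fix u assume u: "u \<in> T"
      have "{i \<in> {..<card T}. u \<in> s i ` (B \<inter> T)} = {i. i < card T \<and> u \<in> s i ` (B \<inter> T)}" by auto
      then show "(\<Sum>i | i \<in> {..<card T} \<and> u \<in> s i ` (B \<inter> T). 1 / real (card T)) \<le> ?c"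
        "?c \<le> (\<Sum>i | i \<in> {..<card T} \<and> u \<in> s i ` (B \<inter> T). 1 / real (card T))"
        using marg[of "B \<inter> T" u] u by simp_all
    qed (use KE T R in auto)
    then have "w (card (B \<inter> T)) * ((1 - ?c) * f ?K + ?c * f (?K \<union> T))
      \<le> w (card (B \<inter> T)) * (\<Sum>i<card T. 1 / card T * f (?K \<union> s i ` (B \<inter> T)))"
      using w by (intro mult_left_mono) auto
    also have "\<dots> = (\<Sum>i<card T. w (card (s i ` B \<inter> T)) * f (K (s i ` B - T) \<union> (s i ` B \<inter> T))) / card T"
      unfolding B1 unfolding B2 B3 by (simp add: sum_distrib_left sum_divide_distrib)
    finally show "?L xs \<le> (\<Sum>i<card T. ?G (map (s i) xs)) / card T"
      unfolding take_map set_map B_def[symmetric] .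
  qed
  also have "\<dots> = (\<Sum>i<card T. perm_avg R (\<lambda>xs. ?G (map (s i) xs))) / card T"
    using perm_avg_cmult[of R "1 / card T" "\<lambda>xs. \<Sum>i<card T. ?G (map (s i) xs)"]
    by (simp add: perm_avg_sum)
  also have "\<dots> = (\<Sum>i<card T. perm_avg R ?G) / card T"
    using perm_avg_map[OF bijR, of ?G] by simp
  also have "\<dots> = perm_avg R ?G" using c0 by simp
  finally show ?thesis .
qed

end

section \<open>Greedy chains and the value of unsaved elements\<close>

section \<open>Greedy chains\<close>


definition gain :: "('a set \<Rightarrow> real) \<Rightarrow> 'a set \<Rightarrow> 'a list \<Rightarrow> nat \<Rightarrow> real" where
  "gain f C p i = f (C \<union> set (take (Suc i) p)) - f (C \<union> set (take i p))"

text \<open>An element passes if, at one of the levels in \<open>G\<close>, it beats one of the picks made up to there.\<close>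

definition passes :: "('a set \<Rightarrow> real) \<Rightarrow> nat set \<Rightarrow> 'a set \<Rightarrow> 'a list \<Rightarrow> 'a \<Rightarrow> bool" where
  "passes f G C p e \<longleftrightarrow> (\<exists>g\<in>G. \<exists>i\<le>g.
     gain f C p i < f (insert e (C \<union> set (take g p))) - f (C \<union> set (take g p)))"

lemma sum_gain: "sum (gain f C p) {..<j} = f (C \<union> set (take j p)) - f C"
  unfolding gain_def by (subst sum_lessThan_telescope) simp

context submod
begin

text \<open>Unsaved elements add at most c = (V - f A) / j each, and V bounds proportionally what
  chain and saved elements reach together. S omits the last pick, which lowers the count on the
  right from j + l to j + l - 1. The first chain uses this with A empty, the second one with A the
  core.\<close>

lemma run_bound:
  assumes A: "A \<subseteq> E" "A \<subseteq> M" and p: "set p \<subseteq> E" "set p \<subseteq> M" "length p = j" "0 < j"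
    and Q: "Q \<subseteq> E" "Q \<subseteq> M" and U: "U \<subseteq> E"
    and np: "\<And>u. u \<in> U \<Longrightarrow> \<not> passes f {j - 1} A p u"
    and V: "\<And>X. X \<subseteq> M \<Longrightarrow> X \<subseteq> E \<Longrightarrow> card X \<le> K \<Longrightarrow> f X \<le> V" and K: "card A + j \<le> K"
    and l: "card ((Q \<union> U) - A) \<le> l" "0 < l"
  shows "real j * (f (A \<union> set (take (j - 1) p) \<union> Q \<union> U) - f A) \<le> (real j + l - 1) * (V - f A)"
proof -
  define S where "S = set (take (j - 1) p)"
  have SE: "S \<subseteq> E" "S \<subseteq> M" using p set_take_subset[of "j - 1" p] by (auto simp: S_def)
  have cS: "card S \<le> j - 1" unfolding S_def by (rule order_trans[OF card_length]) simp
  have finE: "finite X" if "X \<subseteq> E" for X using that fin by (meson finite_subset)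
  have pS: "set p = S \<union> {p ! (j - 1)}"
  proof -
    have "take (Suc (j - 1)) p = take (j - 1) p @ [p ! (j - 1)]"
      using p(3,4) by (intro take_Suc_conv_app_nth) simp
    then have "set (take (Suc (j - 1)) p) = S \<union> {p ! (j - 1)}" by (simp add: S_def)
    then show ?thesis using p(3,4) by simp
  qed
  have VA: "f A \<le> V" using V A K by simp
  have cardp: "card (set p) \<le> j" using card_length[of p] p(3) by simp
  have VAp: "f (A \<union> set p) \<le> V"
    by (rule V) (use A p cardp card_Un_le[of A "set p"] K in auto)
  have VAS: "f (A \<union> S) \<le> V"
    by (rule V) (use A SE cS card_Un_le[of A S] K in auto)
  define c where "c = (V - f A) / j"
  have c0: "0 \<le> c" using VA by (simp add: c_def)
  have cj: "real j * c = V - f A" using p by (simp add: c_def)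
  \<comment> \<open>An unsaved u is below every increment, hence below their average c. It is also
    below the last increment, which cannot lift the value of \<open>A \<union> S\<close> above
    V.\<close>
  have marg: "f (insert u (A \<union> S)) - f (A \<union> S) \<le> min c (V - f (A \<union> S))" if "u \<in> U" for u
  proof -
    define d where "d = f (insert u (A \<union> S)) - f (A \<union> S)"
    have d: "d \<le> gain f A p i" if "i < j" for i
    proof -
      have "i \<le> j - 1" using that by simp
      then show ?thesis using np[OF \<open>u \<in> U\<close>] by (auto simp: passes_def S_def d_def not_less)
    qed
    have "real j * d \<le> sum (gain f A p) {..<j}" using sum_mono[of "{..<j}" "\<lambda>_. d" "gain f A p"] d by simp
    also have "\<dots> = f (A \<union> set p) - f A" using p(3) by (simp add: sum_gain)
    also have "\<dots> \<le> real j * c" using VAp cj by simp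
    finally have "d \<le> c" using p(4) by (simp add: mult_le_cancel_left_pos)
    moreover have "gain f A p (j - 1) = f (A \<union> set p) - f (A \<union> S)" using p(3,4) by (simp add: gain_def S_def)
    then have "d \<le> V - f (A \<union> S)" using d[of "j - 1"] p(4) VAp by simp
    ultimately show ?thesis unfolding d_def by simp
  qed
  define U' where "U' = U - (A \<union> S \<union> Q)"
  define d where "d = card (Q - (A \<union> S))"
  have U'E: "U' \<subseteq> E" using U by (auto simp: U'_def)
  have dl: "d + card U' \<le> l"
  proof -
    have "d + card U' = card ((Q - (A \<union> S)) \<union> U')" unfolding d_def
      by (rule card_Un_disjoint[symmetric]) (use Q U'E finE in \<open>auto simp: U'_def\<close>)
    also have "\<dots> \<le> card ((Q \<union> U) - A)" by (rule card_mono) (use Q U finE in \<open>auto simp: U'_def\<close>)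
    finally show ?thesis using l by simp
  qed
  have un: "A \<union> S \<union> Q \<union> U = (A \<union> S \<union> Q) \<union> U'" by (auto simp: U'_def)
  have fU: "f (A \<union> S \<union> Q \<union> U) \<le> f (A \<union> S \<union> Q) + card U' * x" if x: "0 \<le> x" "min c (V - f (A \<union> S)) \<le> x" for x :: real
    unfolding un
  proof (rule f_Un_le_card)
    fix u assume u: "u \<in> U'" "u \<notin> A \<union> S \<union> Q"
    have "f (insert u (A \<union> S \<union> Q)) - f (A \<union> S \<union> Q) \<le> f (insert u (A \<union> S)) - f (A \<union> S)"
      by (rule marginal_antimono) (use u U'E A SE Q in auto)
    also have "\<dots> \<le> x" using marg[of u] u x by (auto simp: U'_def)
    finally show "f (insert u (A \<union> S \<union> Q)) - f (A \<union> S \<union> Q) \<le> x" .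
  qed (use A SE Q U'E x in auto)
  \<comment> \<open>If Q brings d > 0 new elements, \<open>S \<union> Q\<close> has at most j - 1 +
    d \<ge> j elements outside A and the proportional bound applies. If d = 0 it does not; there one
    unsaved element lifts the value from f(A \<union> S) to at most V, and the others add c
    each.\<close>
  have "real j * (f (A \<union> S \<union> Q \<union> U) - f A) \<le> (real j + l - 1) * (V - f A)"
  proof (cases "d = 0")
    case True
    then have "Q \<subseteq> A \<union> S" using Q finE by (auto simp: d_def)
    then have Qe: "A \<union> S \<union> Q = A \<union> S" by auto
    have "f (A \<union> S \<union> Q \<union> U) \<le> V + (l - 1) * c"
    proof (cases "card U' = 0")
      case True
      have "0 \<le> real (l - 1) * c" using c0 by simp
      moreover have "f (A \<union> S \<union> Q \<union> U) \<le> f (A \<union> S \<union> Q)" using fU[where x=c] c0 True by simp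
      ultimately show ?thesis using VAS unfolding Qe by linarith
    next
      case False
      have "f (A \<union> S \<union> Q \<union> U) \<le> f (A \<union> S) + card U' * min c (V - f (A \<union> S))"
        using fU[where x="min c (V - f (A \<union> S))"] c0 VAS Qe by simp
      also have "card U' * min c (V - f (A \<union> S)) = min c (V - f (A \<union> S)) + (card U' - 1) * min c (V - f (A \<union> S))"
        using False by (simp add: algebra_simps of_nat_diff)
      also have "(card U' - 1) * min c (V - f (A \<union> S)) \<le> (card U' - 1) * c"
        using False by (intro mult_left_mono) auto
      also have "\<dots> \<le> (l - 1) * c" using dl True c0 False by (intro mult_right_mono) auto
      finally show ?thesis by simp
    qed
    then have "real j * (f (A \<union> S \<union> Q \<union> U) - f A) \<le> real j * (V - f A + (real l - 1) * c)"
      using l by (intro mult_left_mono) auto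
    also have "\<dots> = real j * (V - f A) + (real l - 1) * (real j * c)" by algebra
    also have "\<dots> = (real j + l - 1) * (V - f A)" unfolding cj by algebra
    finally show ?thesis .
  next
    case False
    have "real j * (f (A \<union> (S \<union> Q)) - f A) \<le> (j - 1 + d) * (V - f A)"
    proof (rule f_Un_le_proportional)
      fix Y assume Y: "Y \<subseteq> (S \<union> Q) - A" "card Y \<le> j"
      have "f (A \<union> Y) \<le> V"
        by (rule V) (use A SE Q Y card_Un_le[of A Y] K in auto)
      then show "f (A \<union> Y) - f A \<le> V - f A" by simp
    next
      have "card ((S \<union> Q) - A) \<le> card (S \<union> (Q - (A \<union> S)))"
        by (rule card_mono) (use SE Q finE in auto)
      also have "\<dots> \<le> card S + d" unfolding d_def by (rule card_Un_le)
      finally show "card ((S \<union> Q) - A) \<le> j - 1 + d" using cS by simp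
    qed (use A SE Q p VA False in auto)
    moreover have "real j * f (A \<union> S \<union> Q \<union> U) \<le> real j * (f (A \<union> S \<union> Q) + card U' * c)"
      using fU[where x=c] c0 by (intro mult_left_mono) auto
    then have "real j * f (A \<union> S \<union> Q \<union> U) \<le> real j * f (A \<union> S \<union> Q) + card U' * (V - f A)"
      unfolding cj[symmetric] by (simp add: algebra_simps)
    moreover have "real (j - 1 + d) * (V - f A) + card U' * (V - f A) \<le> (real j + l - 1) * (V - f A)"
    proof -
      have "real (j - 1 + d) + card U' \<le> real j + l - 1" using dl p(4) by simp
      then show ?thesis unfolding distrib_right[symmetric] using VA by (intro mult_right_mono) auto
    qed
    ultimately show ?thesis by (simp add: Un_assoc algebra_simps)
  qed
  then show ?thesis unfolding S_def .
qed

end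

text \<open>Multiples of h come close to any desired level, k - 1 is the level of the general bound,
  and powers of 2 offer a level of the right magnitude when nearly k elements of the optimum are
  saved and only very short prefixes of the chain fit beside them.\<close>

definition levels :: "nat \<Rightarrow> nat \<Rightarrow> nat set" where
  "levels h k = {g. g < k \<and> (h dvd g \<or> g = k - 1 \<or> (\<exists>a. g = 2 ^ a))}"

section \<open>Numerical analysis of tight chains\<close>

lemma sum_shift_le:
  fixes s nu :: "nat \<Rightarrow> real"
  assumes "\<And>i. i < k \<Longrightarrow> nu i \<le> s (Suc i) - s i" "i \<le> j" "j \<le> k"
  shows "s i + sum nu {i..<j} \<le> s j"
  using assms(2,3)
proof (induction j rule: dec_induct)
  case base then show ?case by simp
next
  case (step n) then show ?case using assms(1)[of n] by simp
qed

lemma sum_ge_const_mult: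
  fixes nu :: "nat \<Rightarrow> real"
  assumes "\<And>l. i \<le> l \<Longrightarrow> l < j \<Longrightarrow> c \<le> nu l"
  shows "real (j - i) * c \<le> sum nu {i..<j}"
  using sum_mono[of "{i..<j}" "\<lambda>_. c" nu] assms by simp

lemma pow2_between:
  assumes "0 < (x::nat)" obtains a where "x \<le> 2 ^ a" "2 ^ a < 2 * x"
proof -
  have "\<exists>a. x \<le> 2 ^ a" using less_exp[of x] less_imp_le by blast
  define a where "a = (LEAST a. x \<le> 2 ^ a)"
  have a: "x \<le> 2 ^ a" unfolding a_def by (rule LeastI_ex) fact
  have "2 ^ a < 2 * x"
  proof (cases a)
    case 0 then show ?thesis using assms by simp
  next
    case (Suc b)
    then have "\<not> x \<le> 2 ^ b" using not_less_Least[of b "\<lambda>a. x \<le> 2 ^ a"] by (simp add: a_def)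
    then show ?thesis using Suc by simp
  qed
  then show thesis using a that by blast
qed

text \<open>In the tight case, the increments \<open>nu\<close> of the chain are nearly constant. Consequently few elements of
  the optimum are saved (\<open>q\<close> of them), and some level is so low that the unsaved ones, of which there
  are \<open>u\<close>, together with the chain up to there account for little more than half of the optimum.\<close>

lemma tight_chain:
  fixes s nu :: "nat \<Rightarrow> real" and k h q u :: nat
  assumes k: "86 \<le> k" and h: "0 < h" "100000 * (h - 1) \<le> k"
    and anti: "\<And>i j. i \<le> j \<Longrightarrow> j < k \<Longrightarrow> nu j \<le> nu i"
    and inc: "\<And>i. i < k \<Longrightarrow> nu i \<le> s (Suc i) - s i" and s0: "\<And>j. 0 \<le> s j"
    and sV: "\<And>j. j \<le> k \<Longrightarrow> s j \<le> V" and V: "V < 0.50295" and uq: "u + q \<le> k"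
    and lev: "\<And>g. g \<in> levels h k \<Longrightarrow> 1 \<le> V * max 1 (real (g + q) / k) + u * max 0 (nu g)"
  shows "real q \<le> 0.0119 * k \<and> (\<exists>g\<in>levels h k. s g + u * max 0 (nu g) \<le> 0.5866 - 3 * (q / k))"
proof -
  have V0: "0 \<le> V" using s0[of k] sV[of k] by simp
  have kpos: "real k > 0" using k by simp
  define jt where "jt = k - q"
  have ujt: "u \<le> jt" using uq by (simp add: jt_def)
  have jt_k: "real jt = real k - q" using uq by (simp add: jt_def of_nat_diff)
  define e where "e = real (h - 1)"
  have e: "0 \<le> e" "100000 * e \<le> k" using h(2) by (simp_all add: e_def)
  \<comment> \<open>\<open>jt\<close> is the room beside the q saved elements. The level chosen is
    the highest one, up to the spacing h, at which chain and saved elements still fit into k places;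
    there V bounds their joint value without an excess factor.\<close>
  obtain g where g: "g \<in> levels h k" "g + q \<le> k" "real jt - e \<le> real (Suc g)" if "0 < jt"
  proof (cases "q = 0")
    case True
    then show ?thesis using that[of "k - 1"] k e by (simp add: levels_def jt_def)
  next
    case False
    define g where "g = h * (jt div h)"
    have gm: "g + jt mod h = jt" and mh: "jt mod h < h" using h by (simp_all add: g_def)
    have "jt < k" if "0 < jt" using False that by (simp add: jt_def)
    then have *: "g \<le> jt" "jt < Suc g + (h - 1) + 1" "0 < jt \<Longrightarrow> g < k" using gm mh h(1) by linarith+
    show ?thesis
    proof (rule that)
      assume "0 < jt"
      then show "g \<in> levels h k" using * by (simp add: levels_def g_def)
      show "g + q \<le> k" using * uq by (simp add: jt_def)
      show "real jt - e \<le> real (Suc g)" using *(2) by (simp add: e_def)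
    qed
  qed
  have levjt: "1 - V * max 1 (real (g + q) / k) \<le> jt * max 0 (nu g)" if "g \<in> levels h k" for g
  proof -
    have "u * max 0 (nu g) \<le> jt * max 0 (nu g)" using ujt by (intro mult_right_mono) auto
    then show ?thesis using lev[OF that] by simp
  qed
  have jt0: "0 < jt"
  proof (rule ccontr)
    assume "\<not> 0 < jt"
    then have "jt = 0" "q = k" using uq by (auto simp: jt_def)
    moreover have "0 \<in> levels h k" using k by (simp add: levels_def)
    ultimately show False using levjt[of 0] V k by simp
  qed
  note g = g[OF jt0]
  have gk: "g < k" using g(1) by (simp add: levels_def)
  define p where "p = nu g"
  have "real (g + q) / k \<le> 1" using g(2) kpos by (simp add: divide_le_eq_1)
  then have jp: "1 - V \<le> jt * max 0 p" using levjt[OF g(1)] V0 by (simp add: p_def)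
  have p0: "0 < p"
  proof (rule ccontr)
    assume "\<not> 0 < p" then have "max 0 p = 0" by simp
    then show False using jp V by simp
  qed
  then have jp: "1 - V \<le> jt * p" using jp by simp
  define b where "b = nu (k - 1)"
  have sums: "s 0 + sum nu {0..<Suc g} + sum nu {Suc g..<k} \<le> s k"
  proof -
    have "sum nu {0..<Suc g} + sum nu {Suc g..<k} = sum nu {0..<k}"
      using gk by (intro sum.atLeastLessThan_concat) auto
    then show ?thesis using sum_shift_le[of k nu s 0 k, OF inc] by (simp del: sum.op_ivl_Suc)
  qed
  have sum_b: "real (k - Suc g) * b \<le> sum nu {Suc g..<k}"
    by (rule sum_ge_const_mult) (use anti in \<open>auto simp: b_def\<close>)
  have sum_p: "real (Suc g) * p \<le> sum nu {0..<Suc g}"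
    using sum_ge_const_mult[of 0 "Suc g" p nu] anti gk by (auto simp: p_def)
  define t where "t = real q / k"
  have t: "0 \<le> t" "real q = t * k" using kpos by (auto simp: t_def)
  have jtt: "real jt = (1 - t) * k" using jt_k t by (simp add: algebra_simps)
  have t1: "t < 1"
  proof (rule ccontr)
    assume "\<not> t < 1"
    then have "(1 - t) * k \<le> 0" using kpos by (intro mult_nonpos_nonneg) auto
    then show False using jt0 jtt by simp
  qed
  \<comment> \<open>Excludes the second root of the quadratic inequality for t below. If t were that
    large, a power of 2 between 2 jt and 4 jt would be a level where the count exceeds k by a factor
    of at most 1.06, so jt times the increment there would be at least 0.46; the chain up to it
    would be worth 0.92, more than V.\<close>
  have t98: "t < 0.98"
  proof (rule ccontr)
    assume "\<not> t < 0.98"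
    then have "(1 - t) * k \<le> 0.02 * k" by (intro mult_right_mono) auto
    then have jt_small: "50 * real jt \<le> k" unfolding jtt by simp
    obtain a where a: "2 * jt \<le> 2 ^ a" "2 ^ a < 2 * (2 * jt)" using pow2_between[of "2 * jt"] jt0 by auto
    have "real (2 ^ a) \<le> 4 * real jt" using a(2) by linarith
    then have "real (2 ^ a) < real k" using kpos jt_small by linarith
    then have "2 ^ a < k" by linarith
    then have gl: "2 ^ a \<in> levels h k" by (auto simp: levels_def)
    have "real (2 ^ a) \<le> 4 * real jt" using a(2) by linarith
    then have "real (2 ^ a + q) \<le> 1.06 * k" using jt_small jt_k by simp
    then have "real (2 ^ a + q) / k \<le> 1.06" using kpos by (simp add: divide_le_eq)
    then have "max 1 (real (2 ^ a + q) / k) \<le> 1.06" unfolding max.bounded_iff by simp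
    then have "V * max 1 (real (2 ^ a + q) / k) \<le> 0.50295 * 1.06" using V V0 by (intro mult_mono) auto
    then have n1: "0.46 \<le> jt * max 0 (nu (2 ^ a))" using levjt[OF gl] by simp
    have pos: "0 < nu (2 ^ a)"
    proof (rule ccontr)
      assume "\<not> 0 < nu (2 ^ a)"
      then have "max 0 (nu (2 ^ a)) = 0" by simp
      then show False using n1 by simp
    qed
    then have n2: "0.46 \<le> jt * nu (2 ^ a)" using n1 by (simp add: max_def)
    have "real (2 ^ a) * nu (2 ^ a) \<le> sum nu {0..<2 ^ a}"
      using sum_ge_const_mult[of 0 "2 ^ a" "nu (2 ^ a)" nu] anti \<open>2 ^ a < k\<close> by auto
    also have "\<dots> \<le> s (2 ^ a)" using sum_shift_le[of k nu s 0 "2 ^ a"] inc s0[of 0] \<open>2 ^ a < k\<close> by simp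
    also have "\<dots> < 0.51" using sV[of "2 ^ a"] V \<open>2 ^ a < k\<close> by simp
    finally have "real (2 ^ a) * nu (2 ^ a) < 0.51" .
    moreover have "real (2 * jt) * nu (2 ^ a) \<le> real (2 ^ a) * nu (2 ^ a)"
      using a(1) pos by (intro mult_right_mono of_nat_mono) auto
    ultimately have "real (2 * jt) * nu (2 ^ a) < 0.51" by (rule le_less_trans[rotated])
    then show False using n2 by simp
  qed
  have kb: "k - 1 \<in> levels h k" using k by (simp add: levels_def)
  have "real (k - 1 + q) / k \<le> 1 + t" using kpos t k by (simp add: divide_le_eq of_nat_diff algebra_simps)
  then have "V * max 1 (real (k - 1 + q) / k) \<le> V * (1 + t)" using V0 t by (intro mult_left_mono) auto
  then have jb: "1 - V * (1 + t) \<le> jt * max 0 b" using levjt[OF kb] by (simp add: b_def)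
  have Vt: "V * (1 + t) \<le> 0.50295 * 1.98" using V V0 t t98 by (intro mult_mono) auto
  have b0: "0 < b"
  proof (rule ccontr)
    assume "\<not> 0 < b" then have "max 0 b = 0" by simp
    then show False using jb Vt by simp
  qed
  then have jb: "1 - V * (1 + t) \<le> jt * b" using jb by simp
  have kb0: "0 \<le> real (k - Suc g) * b" using b0 by simp
  have e': "e \<le> 0.00001 * k" using e(2) by simp
  have kg: "real (k - Suc g) = real k - Suc g" using gk by (simp add: of_nat_diff)
  have kgq: "real (k - Suc g) \<le> (t + 0.00001) * k"
    using g(3) e' jtt unfolding kg by (simp add: algebra_simps)
  \<comment> \<open>The total excess of the first g + 1 increments over the smallest of them, p. The
    tight case makes it small: this is how nearly constant increments are measured.\<close>
  define X where "X = sum nu {0..<Suc g} - Suc g * p"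
  have X0: "0 \<le> X" using sum_p by (simp add: X_def)
  have Xle: "X + Suc g * p + (k - Suc g) * b \<le> V"
    using sums sum_b s0[of 0] sV[of k] by (simp add: X_def)
  \<comment> \<open>The lower bounds 1 - V on jt * p and 1 - V (1 + t) on jt * b are inserted into X
    + (g + 1) p + (k - g - 1) b \<le> V, which says that the whole chain is worth at most V.\<close>
  have main: "(1 - t) * X \<le> (1 - t) * V - (1 - V) + V * t * (t + 0.00001)"
  proof -
    have "real (Suc g) * (1 - V) + real (k - Suc g) * (1 - V * (1 + t)) \<le> Suc g * (jt * p) + (k - Suc g) * (jt * b)"
      using jp jb by (intro add_mono mult_left_mono) auto
    also have "\<dots> = jt * (Suc g * p + (k - Suc g) * b)" by (simp add: algebra_simps)
    also have "\<dots> \<le> jt * (V - X)" using Xle by (intro mult_left_mono) auto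
    finally have "k * (1 - V) - real (k - Suc g) * (V * t) \<le> jt * (V - X)"
      unfolding kg by (simp add: algebra_simps)
    moreover have "real (k - Suc g) * (V * t) \<le> (t + 0.00001) * k * (V * t)"
      using kgq V0 t by (intro mult_right_mono) auto
    ultimately have "k * ((1 - t) * X) \<le> k * ((1 - t) * V - (1 - V) + V * t * (t + 0.00001))"
      unfolding jtt by (simp add: algebra_simps)
    then show ?thesis using kpos by (simp add: mult_le_cancel_left_pos)
  qed
  have tt: "0 \<le> t * (1 - t - 0.00001)" using t t98 by simp
  have "0 \<le> (1 - t) * X" using X0 t1 by simp
  then have m1: "1 + V * (t * (1 - t - 0.00001)) \<le> 2 * V" using main by (simp add: algebra_simps)
  have "0 \<le> V * (t * (1 - t - 0.00001))" using V0 tt by simp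
  then have V5: "0.5 \<le> V" using m1 by simp
  have "0.5 * (t * (1 - t - 0.00001)) \<le> V * (t * (1 - t - 0.00001))" using V5 tt by (rule mult_right_mono)
  \<comment> \<open>At V = 0.50295 the bound 2 - 1 / V is about 0.011731, so t is close to 0 or to
    1; the latter has been excluded.\<close>
  have "t * (1 - t - 0.00001) \<le> 0.011731"
  proof -
    have "V * (t * (1 - t - 0.00001)) \<le> V * (2 - 1 / V)" using m1 V5 by (simp add: right_diff_distrib)
    then have "t * (1 - t - 0.00001) \<le> 2 - 1 / V" using V5 by (simp add: mult_le_cancel_left_pos)
    also have "1 / V \<ge> 1 / 0.50295" using V V5 by (intro divide_left_mono) auto
    then have "2 - 1 / V \<le> 0.011731" by simp
    finally show ?thesis .
  qed
  have t_small: "t \<le> 0.0119"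
  proof (rule ccontr)
    assume *: "\<not> t \<le> 0.0119"
    have "0 \<le> (t - 119/10000) * (98/100 - t)" using * t98 by (intro mult_nonneg_nonneg) auto
    moreover have "(t - 119/10000) * (98/100 - t) = 9919/10000 * t - t * t - 11662/1000000"
      by (simp add: field_simps)
    ultimately have "t * t \<le> 9919/10000 * t - 11662/1000000" by linarith
    then show False using \<open>t * (1 - t - 0.00001) \<le> 0.011731\<close> * by (simp add: algebra_simps)
  qed
  have X_small: "X \<le> 0.0059 - 0.488 * t"
  proof -
    define Y where "Y = t * (1 - t - 0.00001)"
    have "988 / 1000 * t \<le> Y"
    proof -
      have "t * t \<le> 0.0119 * t" using t t_small by (intro mult_right_mono) auto
      then show ?thesis using t(1) by (simp add: Y_def algebra_simps)
    qed
    moreover have "(1 - t) * X \<le> 2 * V - 1 - V * Y" using main by (simp add: Y_def algebra_simps)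
    moreover have "1 / 2 * Y \<le> V * Y" using V5 tt unfolding Y_def by (intro mult_right_mono) auto
    moreover have "V < 50295 / 100000" using V by simp
    ultimately have "(1 - t) * X \<le> 59 / 10000 - 494 / 1000 * t" by linarith
    also have "\<dots> = 0.0059 - 0.494 * t" by simp
    also have "\<dots> \<le> (1 - t) * (0.0059 - 0.488 * t)" using t by (simp add: algebra_simps)
    finally show ?thesis using t1 by (simp add: mult_le_cancel_left_pos)
  qed
  \<comment> \<open>The levels h, 2h, ..., n h cover about 0.16 k. Over this range the excess
    averages to at most X / 0.16 after scaling by k, while the chain itself grows on average by
    about 0.08 k p; 0.16 balances the two.\<close>
  define n where "n = nat \<lceil>0.16 * real k / h\<rceil>"
  have hpos: "0 < real h" using h by simp
  have n: "0.16 * real k / h \<le> n" "n < 0.16 * real k / h + 1"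
  proof -
    have "0 \<le> 0.16 * real k / h" by simp
    then have "real n = of_int \<lceil>0.16 * real k / h\<rceil>" unfolding n_def by (intro of_nat_nat) linarith
    then show "0.16 * real k / h \<le> n" "n < 0.16 * real k / h + 1" by linarith+
  qed
  have nh: "0.16 * real k \<le> n * real h" "n * real h \<le> 0.16 * k + h" using n hpos by (simp_all add: field_simps)
  have npos: "0 < real n" using nh(1) kpos by (cases "n = 0") auto
  \<comment> \<open>h = 1 + e, where 1 \<le> k / 86 and e \<le> k / 100000.\<close>
  have hk: "real h \<le> 0.01164 * k"
  proof -
    have "real h = 1 + e" using h(1) by (simp add: e_def of_nat_diff)
    moreover have "86 \<le> real k" using k by simp
    ultimately show ?thesis using e' by simp
  qed
  have Sg: "0.988 * real k \<le> Suc g"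
  proof -
    have "0.9881 * real k \<le> (1 - t) * k" using t_small by (intro mult_right_mono) auto
    then show ?thesis using g(3) e' jtt by simp
  qed
  have nhg: "n * h \<le> g"
  proof -
    have "real (n * h) < real (Suc g)" using nh(2) hk Sg kpos by simp
    then have "n * h < Suc g" by (simp only: of_nat_less_iff)
    then show ?thesis by simp
  qed
  have pk: "p * k \<le> 0.5091"
  proof -
    have "Suc g * p \<le> V" using Xle X0 kb0 by linarith
    moreover have "0.988 * real k * p \<le> Suc g * p" using Sg p0 by (intro mult_right_mono) auto
    ultimately show ?thesis using V by (simp add: algebra_simps)
  qed
  define F where "F m = s (Suc m * h) + u * max 0 (nu (Suc m * h))" for m
  have lt: "Suc m * h \<le> g" if "m < n" for m
    using that nhg by (meson Suc_leI le_trans mult_le_mono1)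
  \<comment> \<open>The chain up to a level is worth at most V minus the later increments, each at
    least p up to g; the unsaved elements cost p each plus the excess of the increment at the level
    over p.\<close>
  have F: "F m \<le> V + Suc m * (h * p) + e * p + jt * (nu (Suc m * h) - p)" if m: "m < n" for m
  proof -
    let ?j = "Suc m * h"
    have j: "?j \<le> g" "?j < k" using lt[OF m] gk by simp_all
    have nup: "p \<le> nu ?j" using anti j gk by (simp add: p_def)
    have "s ?j + sum nu {?j..<Suc g} + sum nu {Suc g..<k} \<le> V"
    proof -
      have "sum nu {?j..<Suc g} + sum nu {Suc g..<k} = sum nu {?j..<k}"
        using gk j by (intro sum.atLeastLessThan_concat) auto
      then show ?thesis using sum_shift_le[of k nu s ?j k, OF inc] sV[of k] j by (simp del: sum.op_ivl_Suc)
    qed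
    moreover have "real (Suc g - ?j) * p \<le> sum nu {?j..<Suc g}"
      by (rule sum_ge_const_mult) (use anti gk in \<open>auto simp: p_def\<close>)
    moreover have "0 \<le> sum nu {Suc g..<k}" using sum_b kb0 by linarith
    ultimately have "s ?j \<le> V - (Suc g - real ?j) * p" using j by (simp add: of_nat_diff)
    moreover have "u * max 0 (nu ?j) \<le> jt * nu ?j" using nup p0 ujt by (simp add: max_def mult_right_mono)
    moreover have "(real jt - Suc g) * p \<le> e * p" using g(3) p0 by (intro mult_right_mono) auto
    ultimately show ?thesis unfolding F_def by (simp add: algebra_simps)
  qed
  \<comment> \<open>The increment at the right end of a group of h is at most each member of the
    group, so h times the excesses at the ends is dominated by the total excess.\<close>
  have sumx: "(\<Sum>m<n. nu (Suc m * h) - p) * h \<le> X"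
  proof -
    have "(\<Sum>m<n. nu (Suc m * h) - p) * h = (\<Sum>m<n. \<Sum>l\<in>{m * h..<m * h + h}. nu (Suc m * h) - p)"
      by (subst sum_distrib_right) (simp add: mult.commute)
    also have "\<dots> \<le> (\<Sum>m<n. \<Sum>l\<in>{m * h..<m * h + h}. nu l - p)"
      using lt gk by (intro sum_mono diff_right_mono anti) fastforce+
    also have "\<dots> = (\<Sum>l<n * h. nu l - p)" by (rule sum.nat_group)
    also have "\<dots> \<le> (\<Sum>l<Suc g. nu l - p)"
      by (rule sum_mono2) (use nhg anti gk in \<open>auto simp: p_def\<close>)
    also have "\<dots> = X" by (simp add: X_def sum_subtractf lessThan_atLeast0)
    finally show ?thesis .
  qed
  have "(\<Sum>m<n. F m) \<le> (\<Sum>m<n. V + Suc m * (h * p) + e * p + jt * (nu (Suc m * h) - p))"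
    using F by (intro sum_mono) simp
  also have "\<dots> = n * V + h * p * (\<Sum>m<n. real (Suc m)) + n * (e * p) + jt * (\<Sum>m<n. nu (Suc m * h) - p)"
  proof -
    have "(\<Sum>m<n. real (Suc m) * (h * p)) = h * p * (\<Sum>m<n. real (Suc m))"
      unfolding sum_distrib_left by (simp add: mult.commute)
    moreover have "(\<Sum>m<n. jt * (nu (Suc m * h) - p)) = jt * (\<Sum>m<n. nu (Suc m * h) - p)"
      by (simp only: sum_distrib_left)
    ultimately show ?thesis by (simp only: sum.distrib sum_constant card_lessThan)
  qed
  also have "(\<Sum>m<n. real (Suc m)) = n * (n + 1) / 2" by (induction n) (simp_all add: field_simps)
  also have "jt * (\<Sum>m<n. nu (Suc m * h) - p) \<le> n * (X / 0.16)"
  proof -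
    have "(\<Sum>m<n. nu (Suc m * h) - p) \<le> X / h" using sumx hpos by (simp add: field_simps)
    then have "jt * (\<Sum>m<n. nu (Suc m * h) - p) \<le> jt * (X / h)" by (intro mult_left_mono) auto
    also have "\<dots> \<le> k * (X / h)" using X0 jt_k by (intro mult_right_mono) auto
    also have "\<dots> \<le> n * (X / 0.16)" 
    proof -
      have "0.16 * real k * X \<le> n * real h * X" using nh X0 by (intro mult_right_mono) auto
      then show ?thesis using hpos by (simp add: field_simps)
    qed
    finally show ?thesis .
  qed
  finally have "(\<Sum>m<n. F m) \<le> n * (V + h * p * (n + 1) / 2 + e * p + X / 0.16)"
    by (simp add: algebra_simps)
  \<comment> \<open>The three main terms are 0.50295, about 0.0467 for the growth of the chain, and
    0.0059 / 0.16. The slope 3 in t comes from 0.488 / 0.16.\<close>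
  moreover have "V + h * p * (n + 1) / 2 + e * p + X / 0.16 \<le> 0.5866 - 3 * t"
  proof -
    have "real h * (real n + 1) \<le> (0.16 + 0.02328) * k" using nh(2) hk by (simp add: algebra_simps)
    then have 1: "p * (h * (real n + 1)) \<le> p * ((0.16 + 0.02328) * k)" using p0 by (intro mult_left_mono) auto
    have 2: "e * p \<le> 0.00001 * k * p" using e' p0 by (intro mult_right_mono) auto
    define y1 where "y1 = p * (h * (real n + 1))"
    define y2 where "y2 = p * k"
    define y3 where "y3 = e * p"
    have "y1 \<le> 18328 / 100000 * y2" using 1 by (simp add: y1_def y2_def)
    moreover have "y3 \<le> 1 / 100000 * y2" using 2 by (simp add: y2_def y3_def mult.commute)
    moreover have "y2 \<le> 5091 / 10000" "V < 50295 / 100000" "X \<le> 59 / 10000 - 488 / 1000 * t"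
      using pk V X_small by (simp_all add: y2_def)
    ultimately have "V + y1 / 2 + y3 + X * 100 / 16 \<le> 5866 / 10000 - 3 * t" using t(1) by linarith
    moreover have "V + h * p * (n + 1) / 2 + e * p + X / 0.16 = V + y1 / 2 + y3 + X * 100 / 16"
      by (simp add: y1_def y3_def algebra_simps)
    ultimately show ?thesis by simp
  qed
  then have "n * (V + h * p * (n + 1) / 2 + e * p + X / 0.16) \<le> n * (0.5866 - 3 * t)"
    by (intro mult_left_mono) auto
  ultimately have "(\<Sum>m<n. F m) \<le> n * (0.5866 - 3 * t)" by linarith
  then have "\<exists>m<n. F m \<le> 0.5866 - 3 * t"
  proof (rule contrapos_pp)
    assume "\<not> (\<exists>m<n. F m \<le> 0.5866 - 3 * t)"
    then have "(\<Sum>m<n. 0.5866 - 3 * t) < (\<Sum>m<n. F m)" using npos by (intro sum_strict_mono) (auto simp: not_le lessThan_empty_iff)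
    then show "\<not> (\<Sum>m<n. F m) \<le> n * (0.5866 - 3 * t)" by simp
  qed
  then obtain m where m: "m < n" "F m \<le> 0.5866 - 3 * t" by auto
  have "Suc m * h \<in> levels h k" using lt[OF m(1)] gk by (auto simp: levels_def)
  then show ?thesis using m(2) t_small t kpos unfolding F_def t_def[symmetric] by auto
qed

section \<open>The best saved elements of a random block, and how little they spoil the
  optimum\<close>

section \<open>The block\<close>


text \<open>The choice depends only on the values of \<open>f\<close> on subsets of X. Hence the
  machine with its restricted oracle and the analysis refer to the same set.\<close>

definition pick_best :: "('a set \<Rightarrow> real) \<Rightarrow> nat \<Rightarrow> 'a set \<Rightarrow> 'a set" where
  "pick_best f m X = (SOME A. A \<subseteq> X \<and> card A \<le> m \<and> (\<forall>B. B \<subseteq> X \<longrightarrow> card B \<le> m \<longrightarrow> f B \<le> f A))"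

lemma pick_best:
  assumes "finite X"
  shows "pick_best f m X \<subseteq> X" "card (pick_best f m X) \<le> m"
    "\<And>B. B \<subseteq> X \<Longrightarrow> card B \<le> m \<Longrightarrow> f B \<le> f (pick_best f m X)"
proof -
  let ?S = "{A. A \<subseteq> X \<and> card A \<le> m}"
  have "finite ?S" using assms by simp
  moreover have "{} \<in> ?S" by simp
  then have "?S \<noteq> {}" by blast
  ultimately have "Max (f ` ?S) \<in> f ` ?S" by (intro Max_in) auto
  then obtain A where A: "A \<in> ?S" "f A = Max (f ` ?S)" by auto
  have "f B \<le> f A" if "B \<in> ?S" for B
    unfolding A(2) by (rule Max_ge) (use that \<open>finite ?S\<close> in auto)
  with A(1) have "\<exists>A. A \<subseteq> X \<and> card A \<le> m \<and> (\<forall>B. B \<subseteq> X \<longrightarrow> card B \<le> m \<longrightarrow> f B \<le> f A)" by blast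
  from someI_ex[OF this] have *: "pick_best f m X \<subseteq> X \<and> card (pick_best f m X) \<le> m \<and>
      (\<forall>B. B \<subseteq> X \<longrightarrow> card B \<le> m \<longrightarrow> f B \<le> f (pick_best f m X))" unfolding pick_best_def .
  then show "pick_best f m X \<subseteq> X" "card (pick_best f m X) \<le> m"
    "\<And>B. B \<subseteq> X \<Longrightarrow> card B \<le> m \<Longrightarrow> f B \<le> f (pick_best f m X)" by blast+
qed

lemma pick_best_mono:
  assumes "finite Y" "X \<subseteq> Y"
  shows "f (pick_best f m X) \<le> f (pick_best f m Y)"
proof -
  have "finite X" using assms finite_subset by metis
  then have "pick_best f m X \<subseteq> Y" "card (pick_best f m X) \<le> m" using pick_best(1,2) assms(2) by (metis subset_trans)+
  then show ?thesis by (rule pick_best(3)[OF assms(1)])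
qed

text \<open>\<open>R\<close> is what arrives after the first chain, \<open>Z\<close> its saved part, \<open>S\<close> the chain up to the critical level,
  and \<open>l\<close> the length of the block from whose saved elements the best \<open>m\<close> are chosen.\<close>

locale block = sym_submod +
  fixes R Z Opt S :: "'a set" and l m :: nat and om ph c :: real
  assumes R: "R \<subseteq> E" and Z: "Z \<subseteq> R" and Opt: "Opt \<subseteq> R" and S: "S \<subseteq> E" "S \<inter> R = {}"
    and l: "l \<le> card R" and m: "0 < m"
    and om: "om \<le> f (S \<union> Opt)" and c0: "0 \<le> c"
    and c: "\<And>u. u \<in> Opt - Z \<Longrightarrow> f (insert u S) - f S \<le> c"
    and ph: "f S + card (Opt - Z) * c \<le> om - ph"
begin

abbreviation "T \<equiv> Z \<inter> Opt"
abbreviation "U \<equiv> Opt - Z"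
abbreviation "B xs \<equiv> set (take l xs)"
abbreviation "F X \<equiv> f (pick_best f m X)"
abbreviation "rho \<equiv> real l / card R"

lemma finR: "finite R" using R fin by (meson finite_subset)
lemma finZ: "finite Z" using Z finR by (meson finite_subset)
lemma finOpt: "finite Opt" using Opt finR by (meson finite_subset)
lemma finT: "finite T" using finZ by simp
lemma finU: "finite U" using finOpt by simp

lemma finZI: "finite (Z \<inter> X)" "finite (Z \<inter> X - Y)" using finZ by auto

lemma B_sub: "xs \<in> permutations_of_set R \<Longrightarrow> B xs \<subseteq> R"
  using set_take_subset[of l xs] by (auto simp: permutations_of_set_def)

lemma rho: "0 \<le> rho" "rho \<le> 1" using l by (auto simp: divide_le_eq_1)

lemma F_nonneg: "0 \<le> F (Z \<inter> X)"
  by (rule f_nonneg) (use pick_best(1)[OF finZI(1)] Z R in blast)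

text \<open>The marginal value of T over A is at least that over \<open>A \<union> S\<close>. Adding
  U there costs at most \<open>card U * c\<close> and leads to a superset of
  \<open>S \<union> Opt\<close>, from which A takes at most f A by posimodularity. The second f A
  comes from splitting f(A \<union> S).\<close>

lemma special_mass:
  assumes A: "A \<subseteq> R - Opt"
  shows "ph - 2 * f A \<le> f (A \<union> T) - f A"
proof -
  have sub: "A \<subseteq> E" "Opt \<subseteq> E" "T \<subseteq> E" using A R Opt by auto
  have "f (A \<union> S \<union> T) - f (A \<union> S) \<le> f (A \<union> T) - f A"
    by (rule marginal_set_antimono) (use A S sub Opt in auto)
  moreover have "f (A \<union> S \<union> T \<union> U) \<le> f (A \<union> S \<union> T) + card U * c"
  proof (rule f_Un_le_card)
    fix u assume u: "u \<in> U" "u \<notin> A \<union> S \<union> T"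
    have "f (insert u (A \<union> S \<union> T)) - f (A \<union> S \<union> T) \<le> f (insert u S) - f S"
      by (rule marginal_antimono) (use u sub S in auto)
    then show "f (insert u (A \<union> S \<union> T)) - f (A \<union> S \<union> T) \<le> c" using c u by fastforce
  qed (use sub S c0 in auto)
  moreover have "f (S \<union> Opt) - f (A - (S \<union> Opt)) \<le> f (S \<union> Opt \<union> A)"
    by (rule f_Un_ge_diff) (use sub S in auto)
  moreover have "A - (S \<union> Opt) = A" "S \<union> Opt \<union> A = A \<union> S \<union> T \<union> U" using A S by auto
  moreover have "f (A \<union> S) \<le> f A + f S" by (rule subadditive) (use sub S in auto)
  ultimately show ?thesis using om ph by auto
qed

lemma f_T_ge: "ph \<le> f T"
proof -
  have sub: "Opt \<subseteq> E" "T \<subseteq> E" using R Opt by auto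
  have "f (S \<union> T \<union> U) \<le> f (S \<union> T) + card U * c"
  proof (rule f_Un_le_card)
    fix u assume u: "u \<in> U" "u \<notin> S \<union> T"
    have "f (insert u (S \<union> T)) - f (S \<union> T) \<le> f (insert u S) - f S"
      by (rule marginal_antimono) (use u sub S in auto)
    then show "f (insert u (S \<union> T)) - f (S \<union> T) \<le> c" using c u by fastforce
  qed (use sub S c0 in auto)
  moreover have "S \<union> T \<union> U = S \<union> Opt" by auto
  moreover have "f (S \<union> T) \<le> f S + f T" by (rule subadditive) (use sub S in auto)
  ultimately show ?thesis using om ph by auto
qed

definition a :: "'a list \<Rightarrow> real" where "a xs = F (Z \<inter> B xs)"
definition y :: "'a list \<Rightarrow> real" where "y xs = F (Z \<inter> (B xs - T))"
definition cT :: "'a list \<Rightarrow> nat" where "cT xs = card (B xs \<inter> T)"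

lemma y_le_a: "y xs \<le> a xs"
  unfolding y_def a_def by (rule pick_best_mono) (use finZI in auto)

lemma y_nonneg: "0 \<le> y xs" unfolding y_def by (rule F_nonneg)

text \<open>Let c elements of T lie in the block. If c \<le> m they displace c of the m places, and
  by proportionality the best choice without T loses at most c / m of y. If c > m, a proportional
  m-subset of them alone is worth m / c of their joint marginal value, by subadditivity. For c = 0,
  division by zero gives w = 0 and the claim is \<open>y \<le> a\<close>.\<close>

lemma a_ge:
  assumes xs: "xs \<in> permutations_of_set R"
  defines "w \<equiv> (\<lambda>c. real (min c m) / c)"
  shows "(1 - min (cT xs) m / m) * y xs - w (cT xs) * y xs
      + w (cT xs) * f (pick_best f m (Z \<inter> (B xs - T)) \<union> (B xs \<inter> T)) \<le> a xs"
proof (cases "cT xs = 0")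
  case True then show ?thesis using y_le_a by (simp add: w_def)
next
  case False
  define AY where "AY = pick_best f m (Z \<inter> (B xs - T))"
  have AY: "AY \<subseteq> Z \<inter> (B xs - T)" "card AY \<le> m" "f AY = y xs"
    unfolding AY_def y_def using pick_best[OF finZI(1)] by blast+
  define Te where "Te = B xs \<inter> T"
  have cTe: "card Te = cT xs" by (simp add: Te_def cT_def)
  have sub: "AY \<subseteq> E" "Te \<subseteq> E" using AY Z R by (auto simp: Te_def)
  have disj: "AY \<inter> Te = {}" using AY by (auto simp: Te_def)
  have fins: "finite AY" "finite Te" using sub fin by (meson finite_subset)+
  have amax: "f X \<le> a xs" if "X \<subseteq> AY \<union> Te" "card X \<le> m" for X
    unfolding a_def by (rule pick_best(3)[OF finZI(1)]) (use that AY in \<open>auto simp: Te_def\<close>)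
  show ?thesis
  proof (cases "cT xs \<le> m")
    case True
    have "\<exists>Y\<subseteq>AY. card Y = min (m - cT xs) (card AY) \<and>
       real (min (m - cT xs) (card AY)) * (f (Te \<union> AY) - f Te) \<le> card AY * (f (Te \<union> Y) - f Te)"
      by (rule exists_proportional_subset) (use sub disj in auto)
    then obtain Y where Y: "Y \<subseteq> AY" "card Y = min (m - cT xs) (card AY)"
       "real (min (m - cT xs) (card AY)) * (f (Te \<union> AY) - f Te) \<le> card AY * (f (Te \<union> Y) - f Te)" by blast
    define h where "h = f (Te \<union> AY) - f Te"
    have hy: "h \<le> y xs"
      using marginal_set_antimono[of "{}" Te AY] sub disj AY(3) f_nonneg[of "{}"] unfolding h_def by (simp add: Int_commute)
    have main: "f (Te \<union> AY) - cT xs / m * y xs \<le> a xs"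
    proof (cases "h \<le> 0")
      case True
      have "f Te \<le> a xs" using amax[of Te] \<open>cT xs \<le> m\<close> cTe by simp
      moreover have "0 \<le> real (cT xs) / m * y xs" using y_nonneg by simp
      ultimately show ?thesis using True by (simp add: h_def)
    next
      case False
      have cY: "card (Te \<union> Y) \<le> m" using card_Un_le[of Te Y] Y(2) cTe \<open>cT xs \<le> m\<close> by simp
      have fa: "f (Te \<union> Y) \<le> a xs" by (rule amax) (use Y cY in auto)
      have "real (m - cT xs) * h \<le> m * (f (Te \<union> Y) - f Te)"
      proof (cases "card AY \<le> m - cT xs")
        case True
        then have "Y = AY" using Y fins by (intro card_subset_eq) auto
        then show ?thesis using False by (auto simp: h_def intro!: mult_right_mono)
      next
        case ca: False
        then have r: "real (m - cT xs) * h \<le> card AY * (f (Te \<union> Y) - f Te)" using Y(3) by (simp add: h_def min_def)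
        have "0 < card AY" using ca by simp
        have "0 \<le> real (m - cT xs) * h" using False by simp
        then have "0 \<le> real (card AY) * (f (Te \<union> Y) - f Te)" using r by linarith
        then have "0 \<le> f (Te \<union> Y) - f Te" using \<open>0 < card AY\<close> by (simp add: zero_le_mult_iff)
        then have "card AY * (f (Te \<union> Y) - f Te) \<le> m * (f (Te \<union> Y) - f Te)" using AY(2) by (intro mult_right_mono) auto
        then show ?thesis using r by linarith
      qed
      then have "(real m - cT xs) * h \<le> m * (f (Te \<union> Y) - f Te)" using \<open>cT xs \<le> m\<close> by (simp add: of_nat_diff)
      then have "h - cT xs / m * h \<le> f (Te \<union> Y) - f Te" using m by (simp add: field_simps)
      moreover have "real (cT xs) / m * h \<le> cT xs / m * y xs" using hy by (intro mult_left_mono) auto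
      ultimately show ?thesis using fa by (simp add: h_def)
    qed
    have "w (cT xs) = 1" "min (cT xs) m = cT xs" using False True by (auto simp: w_def)
    then show ?thesis using main by (simp add: AY_def[symmetric] Te_def[symmetric] Un_commute algebra_simps)
  next
    case c: False
    have "\<exists>Y\<subseteq>Te. card Y = m \<and> real m * (f (AY \<union> Te) - f AY) \<le> card Te * (f (AY \<union> Y) - f AY)"
      by (rule exists_proportional_subset) (use sub disj c cTe in auto)
    then obtain Y where Y: "Y \<subseteq> Te" "card Y = m" "real m * (f (AY \<union> Te) - f AY) \<le> card Te * (f (AY \<union> Y) - f AY)"
      by blast
    have "f (AY \<union> Y) \<le> f AY + f Y" by (rule subadditive) (use sub Y in auto)
    moreover have "f Y \<le> a xs" by (rule amax) (use Y in auto)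
    ultimately have "f (AY \<union> Y) - f AY \<le> a xs" by simp
    then have "real (card Te) * (f (AY \<union> Y) - f AY) \<le> card Te * a xs" by (intro mult_left_mono) auto
    then have "real m * (f (AY \<union> Te) - y xs) \<le> cT xs * a xs" using Y(3) AY(3) cTe by simp
    then have "m / cT xs * (f (AY \<union> Te) - y xs) \<le> a xs" using False by (simp add: field_simps)
    moreover have "w (cT xs) = m / cT xs" "real (min (cT xs) m) / m = 1" using c m by (auto simp: w_def)
    ultimately show ?thesis by (simp add: AY_def[symmetric] Te_def[symmetric] right_diff_distrib)
  qed
qed

text \<open>\<open>y\<close> depends only on the block outside T and grows with it, so every member
  of T is negatively correlated with it.\<close>

lemma avg_cT_y: "perm_avg R (\<lambda>xs. cT xs * y xs) \<le> rho * card T * perm_avg R y"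
proof -
  have "perm_avg R (\<lambda>xs. cT xs * y xs) = perm_avg R (\<lambda>xs. \<Sum>x\<in>T. of_bool (x \<in> B xs) * F (Z \<inter> (B xs - T)))"
  proof (rule perm_avg_cong)
    fix xs
    have "B xs \<inter> T = {x \<in> T. x \<in> B xs}" by auto
    then have "real (cT xs) = (\<Sum>x\<in>T. of_bool (x \<in> B xs))" using finT by (simp add: cT_def Int_def)
    then show "cT xs * y xs = (\<Sum>x\<in>T. of_bool (x \<in> B xs) * F (Z \<inter> (B xs - T)))"
      by (simp add: y_def sum_distrib_right)
  qed
  also have "\<dots> = (\<Sum>x\<in>T. perm_avg R (\<lambda>xs. of_bool (x \<in> B xs) * F (Z \<inter> (B xs - T))))" by (rule perm_avg_sum)
  also have "\<dots> \<le> (\<Sum>x\<in>T. rho * perm_avg R (\<lambda>xs. F (Z \<inter> (B xs - T))))"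
  proof (rule sum_mono)
    fix x assume x: "x \<in> T"
    show "perm_avg R (\<lambda>xs. of_bool (x \<in> B xs) * F (Z \<inter> (B xs - T))) \<le> rho * perm_avg R (\<lambda>xs. F (Z \<inter> (B xs - T)))"
    proof (rule perm_avg_neg_assoc[OF finR _ l, of x "\<lambda>X. F (Z \<inter> (X - T))"])
      show "x \<in> R" using x Z by auto
      show "F (Z \<inter> (X - T)) \<le> F (Z \<inter> (Y - T))" if "X \<subseteq> Y" for X Y
        by (rule pick_best_mono) (use finZI that in auto)
      have "X - {x} - T = X - T" for X using x by auto
      then show "F (Z \<inter> (X - {x} - T)) = F (Z \<inter> (X - T))" for X by simp
    qed
  qed
  also have "\<dots> = rho * card T * perm_avg R y" unfolding y_def[abs_def] by simp
  finally show ?thesis .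
qed

text \<open>Unsaved elements are no candidates for the core, so \<open>a\<close> ignores U and grows
  with the rest of the block: negative correlation again.\<close>

lemma avg_cU_a: "perm_avg R (\<lambda>xs. card (B xs \<inter> U) * a xs) \<le> rho * card U * perm_avg R a"
proof -
  have "perm_avg R (\<lambda>xs. card (B xs \<inter> U) * a xs) = perm_avg R (\<lambda>xs. \<Sum>x\<in>U. of_bool (x \<in> B xs) * F (Z \<inter> B xs))"
  proof (rule perm_avg_cong)
    fix xs
    have "B xs \<inter> U = {x \<in> U. x \<in> B xs}" by auto
    then have "real (card (B xs \<inter> U)) = (\<Sum>x\<in>U. of_bool (x \<in> B xs))" using finU by (simp add: Int_def)
    then show "card (B xs \<inter> U) * a xs = (\<Sum>x\<in>U. of_bool (x \<in> B xs) * F (Z \<inter> B xs))"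
      by (simp add: a_def sum_distrib_right)
  qed
  also have "\<dots> = (\<Sum>x\<in>U. perm_avg R (\<lambda>xs. of_bool (x \<in> B xs) * F (Z \<inter> B xs)))" by (rule perm_avg_sum)
  also have "\<dots> \<le> (\<Sum>x\<in>U. rho * perm_avg R (\<lambda>xs. F (Z \<inter> B xs)))"
  proof (rule sum_mono)
    fix x assume x: "x \<in> U"
    show "perm_avg R (\<lambda>xs. of_bool (x \<in> B xs) * F (Z \<inter> B xs)) \<le> rho * perm_avg R (\<lambda>xs. F (Z \<inter> B xs))"
    proof (rule perm_avg_neg_assoc[OF finR _ l, of x "\<lambda>X. F (Z \<inter> X)"])
      show "x \<in> R" using x Opt by auto
      show "F (Z \<inter> X) \<le> F (Z \<inter> Y)" if "X \<subseteq> Y" for X Y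
        by (rule pick_best_mono) (use finZI that in auto)
      have "Z \<inter> (X - {x}) = Z \<inter> X" for X using x by auto
      then show "F (Z \<inter> (X - {x})) = F (Z \<inter> X)" for X by simp
    qed
  qed
  also have "\<dots> = rho * card U * perm_avg R a" unfolding a_def[abs_def] by simp
  finally show ?thesis .
qed

lemma avg_cU: "perm_avg R (\<lambda>xs. real (card (B xs \<inter> U))) = rho * card U"
proof -
  have "real (card (B xs \<inter> U)) = (\<Sum>x\<in>U. of_bool (x \<in> B xs))" for xs
    using finU by (simp add: Int_def conj_commute)
  then have "perm_avg R (\<lambda>xs. real (card (B xs \<inter> U))) = (\<Sum>x\<in>U. perm_avg R (\<lambda>xs. of_bool (x \<in> B xs)))"
    by (simp add: perm_avg_sum)
  also have "\<dots> = (\<Sum>x\<in>U. rho)" using Opt by (intro sum.cong perm_avg_mem_prefix_prob finR l) auto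
  finally show ?thesis by simp
qed

text \<open>A Bonferroni bound: min c m \<ge> c - c (c - 1) / (2 m), and the mean of c (c - 1) is at
  most rho^2 |T|^2 because two memberships in the block are negatively correlated.\<close>

lemma avg_min_cT: "rho * card T - rho\<^sup>2 * (card T)\<^sup>2 / (2 * m) \<le> perm_avg R (\<lambda>xs. real (min (cT xs) m))"
proof -
  have cs: "real (cT xs) = (\<Sum>x\<in>T. of_bool (x \<in> B xs))" for xs
    using finT by (simp add: cT_def Int_def conj_commute)
  have TR: "T \<subseteq> R" using Z by auto
  have E1: "perm_avg R (\<lambda>xs. real (cT xs)) = rho * card T"
  proof -
    have "perm_avg R (\<lambda>xs. real (cT xs)) = (\<Sum>x\<in>T. perm_avg R (\<lambda>xs. of_bool (x \<in> B xs)))"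
      by (simp add: cs perm_avg_sum)
    also have "\<dots> = (\<Sum>x\<in>T. rho)" using TR by (intro sum.cong perm_avg_mem_prefix_prob finR l) auto
    finally show ?thesis by simp
  qed
  have pair: "perm_avg R (\<lambda>xs. of_bool (x \<in> B xs) * of_bool (z \<in> B xs)) \<le> rho * rho" if "x \<in> T" "z \<in> T" "z \<noteq> x" for x z
  proof -
    have "perm_avg R (\<lambda>xs. of_bool (x \<in> B xs) * of_bool (z \<in> B xs)) \<le> rho * perm_avg R (\<lambda>xs. of_bool (z \<in> B xs))"
      by (rule perm_avg_neg_assoc[OF finR _ l, of x "\<lambda>X. of_bool (z \<in> X)"]) (use that TR in auto)
    also have "perm_avg R (\<lambda>xs. of_bool (z \<in> B xs)) = rho" using that TR by (intro perm_avg_mem_prefix_prob finR l) auto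
    finally show ?thesis .
  qed
  have "perm_avg R (\<lambda>xs. real (cT xs) * (real (cT xs) - 1))
     = perm_avg R (\<lambda>xs. \<Sum>x\<in>T. \<Sum>z\<in>T - {x}. of_bool (x \<in> B xs) * of_bool (z \<in> B xs))"
  proof (rule perm_avg_cong)
    fix xs
    have "(\<Sum>x\<in>T. \<Sum>z\<in>T - {x}. of_bool (x \<in> B xs) * of_bool (z \<in> B xs) :: real)
      = (\<Sum>x\<in>T. of_bool (x \<in> B xs) * (real (cT xs) - 1))"
    proof (rule sum.cong)
      fix x assume x: "x \<in> T"
      have "real (cT xs) = of_bool (x \<in> B xs) + (\<Sum>z\<in>T - {x}. of_bool (z \<in> B xs))"
        unfolding cs using finT x by (rule sum.remove)
      then show "(\<Sum>z\<in>T - {x}. of_bool (x \<in> B xs) * of_bool (z \<in> B xs)) = of_bool (x \<in> B xs) * (real (cT xs) - 1)"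
        by (cases "x \<in> B xs") (simp_all flip: sum_distrib_left)
    qed simp
    then show "real (cT xs) * (real (cT xs) - 1) = (\<Sum>x\<in>T. \<Sum>z\<in>T - {x}. of_bool (x \<in> B xs) * of_bool (z \<in> B xs))"
      by (simp add: cs flip: sum_distrib_right)
  qed
  also have "\<dots> = (\<Sum>x\<in>T. \<Sum>z\<in>T - {x}. perm_avg R (\<lambda>xs. of_bool (x \<in> B xs) * of_bool (z \<in> B xs)))"
    by (simp only: perm_avg_sum)
  also have "\<dots> \<le> (\<Sum>x\<in>T. \<Sum>z\<in>T - {x}. rho * rho)" by (intro sum_mono pair) auto
  also have "\<dots> \<le> (\<Sum>x\<in>T. card T * (rho * rho))"
  proof (rule sum_mono)
    fix x
    have "card (T - {x}) \<le> card T" using finT by (intro card_mono) auto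
    then have "real (card (T - {x})) * (rho * rho) \<le> card T * (rho * rho)" by (intro mult_right_mono) auto
    then show "(\<Sum>z\<in>T - {x}. rho * rho) \<le> card T * (rho * rho)" by (simp only: sum_constant)
  qed
  finally have E2: "perm_avg R (\<lambda>xs. real (cT xs) * (real (cT xs) - 1)) \<le> (real (card T))\<^sup>2 * rho\<^sup>2"
    by (simp add: power2_eq_square)
  have pt: "real c - 1 / (2 * m) * (real c * (real c - 1)) \<le> real (min c m)" for c :: nat
  proof (cases "c \<le> m")
    case True
    have "0 \<le> real c * (real c - 1)" by (cases c) auto
    then show ?thesis using True by simp
  next
    case False
    define d where "d = real c - m"
    have d: "1 \<le> d" "real c = m + d" using False by (auto simp: d_def)
    have "1 \<le> real m" using m by simp
    then have "0 \<le> real m * (real m - 1)" "0 \<le> d * (d - 1)" using d by (intro mult_nonneg_nonneg; simp)+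
    then have "2 * real m * d \<le> (m + d) * (m + d - 1)" by (simp add: algebra_simps)
    then have "d \<le> 1 / (2 * m) * ((m + d) * (m + d - 1))" using m by (simp add: field_simps)
    then show ?thesis using d False by (simp add: min_def)
  qed
  have "rho * card T - 1 / (2 * m) * ((real (card T))\<^sup>2 * rho\<^sup>2)
    \<le> rho * card T - 1 / (2 * m) * perm_avg R (\<lambda>xs. real (cT xs) * (real (cT xs) - 1))"
    using E2 by (intro diff_left_mono mult_left_mono) auto
  also have "\<dots> = perm_avg R (\<lambda>xs. real (cT xs) - 1 / (2 * m) * (real (cT xs) * (real (cT xs) - 1)))"
    by (simp only: E1 perm_avg_diff perm_avg_cmult)
  also have "\<dots> \<le> perm_avg R (\<lambda>xs. real (min (cT xs) m))" by (rule perm_avg_mono) (rule pt)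
  finally show ?thesis by (simp add: mult.commute)
qed

text \<open>In the average of \<open>a_ge\<close>, the shifts of T make its part in the block
  uniform given its size, so this part carries its share of the marginal value of T, which is at
  least ph - 2 y by \<open>special_mass\<close>. Truncation at m costs the quadratic term; the
  losses proportional to y are controlled by \<open>avg_cT_y\<close>.\<close>

lemma avg_a_ge:
  assumes "0 \<le> ph"
  shows "perm_avg R y + ph * (rho - rho\<^sup>2 * card T / (2 * m)) - rho * (2 + card T / m) * perm_avg R y
       \<le> perm_avg R a"
proof (cases "T = {}")
  case True
  \<comment> \<open>With T empty, \<open>special_mass\<close> at the empty set gives ph \<le> 2 f
    {}, and {} is a candidate for y. The main case divides by \<open>card T\<close>.\<close>
  have "ph \<le> 2 * y xs" for xs
  proof -
    have "ph - 2 * f {} \<le> 0" using special_mass[of "{}"] unfolding True by simp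
    moreover have "f {} \<le> y xs" unfolding y_def by (rule pick_best(3)) (use finZI in auto)
    ultimately show ?thesis by simp
  qed
  then have "ph \<le> perm_avg R (\<lambda>xs. 2 * y xs)" using finR by (intro perm_avg_ge_const)
  then have "ph \<le> 2 * perm_avg R y" by (simp add: perm_avg_cmult)
  then have "rho * ph \<le> rho * (2 * perm_avg R y)" using rho by (intro mult_left_mono) auto
  moreover have "perm_avg R y \<le> perm_avg R a" by (rule perm_avg_mono) (rule y_le_a)
  ultimately show ?thesis by (simp add: True algebra_simps)
next
  case False
  have cT0: "0 < card T" using finT False by (simp add: card_gt_0_iff)
  define K where "K X = pick_best f m (Z \<inter> X)" for X
  define w where "w c = real (min c m) / c" for c :: nat
  have w0: "0 \<le> w c" for c by (simp add: w_def)
  have wc: "w c * c = min c m" for c :: nat by (cases "c = 0") (auto simp: w_def)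
  have Ky: "f (K (B xs - T)) = y xs" for xs by (simp add: K_def y_def)
  have KR: "K X \<subseteq> R - Opt" if "X \<subseteq> R - T" for X
    using pick_best(1)[OF finZI(1), of f m X] that Z unfolding K_def by auto
  have KE: "K X \<subseteq> E - T" if "X \<subseteq> R - T" for X using KR[OF that] R by blast
  let ?g = "\<lambda>xs. w (cT xs) * ((1 - cT xs / card T) * f (K (B xs - T)) + cT xs / card T * f (K (B xs - T) \<union> T))"
  let ?r = "\<lambda>xs. (1 - min (cT xs) m / m) * y xs - w (cT xs) * y xs"
  have "perm_avg R (\<lambda>xs. ?r xs + ?g xs) \<le> perm_avg R (\<lambda>xs. ?r xs + w (cT xs) * f (K (B xs - T) \<union> (B xs \<inter> T)))"
    unfolding perm_avg_add cT_def
    by (intro add_left_mono perm_avg_uniform_part_ge) (use R Z False w0 KE in auto)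
  also have "\<dots> \<le> perm_avg R a"
    by (rule perm_avg_mono) (use a_ge in \<open>simp add: w_def K_def\<close>)
  finally have 1: "perm_avg R (\<lambda>xs. ?r xs + ?g xs) \<le> perm_avg R a" .
  have 2: "y xs + ph / card T * min (cT xs) m - (1 / m + 2 / card T) * (cT xs * y xs) \<le> ?r xs + ?g xs"
    if xs: "xs \<in> permutations_of_set R" for xs
  proof -
    let ?c = "real (min (cT xs) m)"
    have "?g xs = w (cT xs) * y xs + w (cT xs) * cT xs / card T * (f (K (B xs - T) \<union> T) - y xs)"
      unfolding Ky by (simp add: algebra_simps diff_divide_distrib add_divide_distrib)
    then have "?r xs + ?g xs = y xs - ?c / m * y xs + ?c / card T * (f (K (B xs - T) \<union> T) - y xs)"
      unfolding wc by (simp add: algebra_simps)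
    moreover have "?c / card T * (ph - 2 * y xs) \<le> ?c / card T * (f (K (B xs - T) \<union> T) - y xs)"
    proof (rule mult_left_mono)
      have "ph - 2 * f (K (B xs - T)) \<le> f (K (B xs - T) \<union> T) - f (K (B xs - T))"
        by (rule special_mass, rule KR) (use B_sub[OF xs] in auto)
      then show "ph - 2 * y xs \<le> f (K (B xs - T) \<union> T) - y xs" unfolding Ky .
    qed simp
    moreover have "?c * ((1 / m + 2 / card T) * y xs) \<le> cT xs * ((1 / m + 2 / card T) * y xs)"
      using y_nonneg by (intro mult_right_mono) auto
    ultimately show ?thesis by (simp add: algebra_simps add_divide_distrib diff_divide_distrib)
  qed
  have "perm_avg R y + ph / card T * (rho * card T - rho\<^sup>2 * (card T)\<^sup>2 / (2 * m)) - (1 / m + 2 / card T) * (rho * card T * perm_avg R y)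
     \<le> perm_avg R y + ph / card T * perm_avg R (\<lambda>xs. real (min (cT xs) m)) - (1 / m + 2 / card T) * perm_avg R (\<lambda>xs. cT xs * y xs)"
    using avg_min_cT avg_cT_y assms by (intro diff_mono add_left_mono mult_left_mono) auto
  also have "\<dots> = perm_avg R (\<lambda>xs. y xs + ph / card T * min (cT xs) m - (1 / m + 2 / card T) * (cT xs * y xs))"
    by (simp only: perm_avg_add perm_avg_diff perm_avg_cmult)
  also have "\<dots> \<le> perm_avg R (\<lambda>xs. ?r xs + ?g xs)" by (rule perm_avg_mono) (rule 2)
  also note 1
  finally have fin: "perm_avg R y + ph / card T * (rho * card T - rho\<^sup>2 * (card T)\<^sup>2 / (2 * m)) - (1 / m + 2 / card T) * (rho * card T * perm_avg R y)
     \<le> perm_avg R a" .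
  have e1: "p / n * (r * n - r\<^sup>2 * n\<^sup>2 / (2 * q)) = p * (r - r\<^sup>2 * n / (2 * q))"
    "(1 / q + 2 / n) * (r * n * z) = r * (2 + n / q) * z" if "0 < n" "0 < q" for p n r q z :: real
    using that by (simp_all add: field_simps power2_eq_square)
  show ?thesis using fin
    unfolding of_nat_mult of_nat_numeral of_nat_power
      e1[OF of_nat_0_less_iff[THEN iffD2, OF cT0] of_nat_0_less_iff[THEN iffD2, OF m]] .
qed

definition A :: "'a list \<Rightarrow> 'a set" where "A xs = pick_best f m (Z \<inter> B xs)"

lemma A_sub: "A xs \<subseteq> Z \<inter> B xs" "card (A xs) \<le> m" "f (A xs) = a xs"
  unfolding A_def a_def using pick_best[OF finZI(1)] by blast+

text \<open>The part of the core outside \<open>Opt\<close> is itself a candidate for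
  \<open>y\<close>, and by posimodularity its value bounds what the core takes from f Opt.\<close>

lemma avg_Opt_A_ge1: "f Opt - perm_avg R y \<le> perm_avg R (\<lambda>xs. f (A xs \<union> Opt))"
proof -
  have "perm_avg R (\<lambda>xs. f Opt - y xs) \<le> perm_avg R (\<lambda>xs. f (A xs \<union> Opt))"
  proof (rule perm_avg_mono)
    fix xs
    have "f Opt - f (A xs - Opt) \<le> f (Opt \<union> A xs)"
      by (rule f_Un_ge_diff) (use Opt R A_sub(1) Z in blast)+
    moreover have "f (A xs - Opt) \<le> y xs" unfolding y_def
    proof (rule pick_best(3)[OF finZI(1)])
      show "A xs - Opt \<subseteq> Z \<inter> (B xs - T)" using A_sub(1)[of xs] by auto
      have "finite (A xs)" using A_sub(1) finZI(1) by (meson finite_subset)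
      then show "card (A xs - Opt) \<le> m" using A_sub(2)[of xs] by (meson card_Diff_subset_Int card_mono Diff_subset le_trans)
    qed
    ultimately show "f Opt - y xs \<le> f (A xs \<union> Opt)" by (simp add: Un_commute)
  qed
  then show ?thesis using finR by (simp add: perm_avg_diff)
qed

text \<open>Disjoint blocks of the stream contribute equally, and together they spoil \<open>Opt\<close> by no more than
  the value of the union of their choices.\<close>

lemma avg_Opt_A_ge2:
  assumes M: "M * l \<le> card R" "M * m \<le> K" "0 < M" and V0: "\<And>X. X \<subseteq> Z \<Longrightarrow> card X \<le> K \<Longrightarrow> f X \<le> V0"
  shows "f Opt - V0 / M \<le> perm_avg R (\<lambda>xs. f (A xs \<union> Opt))"
proof -
  define A' where "A' X = pick_best f m (Z \<inter> X)" for X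
  define Bi where "Bi i xs = set (take l (drop (i * l) xs))" for i and xs :: "'a list"
  have A': "A' X \<subseteq> Z \<inter> X" "card (A' X) \<le> m" for X unfolding A'_def using pick_best[OF finZI(1)] by blast+
  have "M * f Opt - V0 \<le> perm_avg R (\<lambda>xs. \<Sum>i<M. f (Opt \<union> A' (Bi i xs)))"
  proof (rule perm_avg_ge_const[OF finR])
    fix xs assume xs: "xs \<in> permutations_of_set R"
    then have dist: "distinct xs" and len: "length xs = card R" 
      by (auto simp: permutations_of_set_def length_finite_permutations_of_set[OF xs])
    have disj: "Bi i xs \<inter> Bi j xs = {}" if "i < j" for i j
    proof -
      have "set (take l (drop (i * l) xs)) \<subseteq> set (take (j * l) xs)"
      proof -
        have "take l (drop (i * l) xs) = drop (i * l) (take (i * l + l) xs)" by (simp add: take_drop add.commute)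
        then have "set (take l (drop (i * l) xs)) \<subseteq> set (take (i * l + l) xs)" using set_drop_subset by metis
        also have "\<dots> \<subseteq> set (take (j * l) xs)"
          by (rule set_take_subset_set_take) (metis Suc_leI add.commute mult_Suc mult_le_mono1 that)
        finally show ?thesis .
      qed
      moreover have "set (take l (drop (j * l) xs)) \<subseteq> set (drop (j * l) xs)" by (rule set_take_subset)
      moreover have "set (take (j * l) xs) \<inter> set (drop (j * l) xs) = {}"
        using dist set_take_disj_set_drop_if_distinct by blast
      ultimately show ?thesis unfolding Bi_def by blast
    qed
    \<comment> \<open>The blocks are disjoint, so a new choice and the union of the earlier ones
      meet, each joined with \<open>Opt\<close>, exactly in \<open>Opt\<close>; submodularity then
      adds up the losses.\<close>
    have ind: "n * f Opt - (f Opt - f (Opt \<union> (\<Union>i<n. A' (Bi i xs)))) \<le> (\<Sum>i<n. f (Opt \<union> A' (Bi i xs)))" for n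
    proof (induction n)
      case 0 then show ?case by simp
    next
      case (Suc n)
      let ?X = "Opt \<union> (\<Union>i<n. A' (Bi i xs))" and ?Y = "Opt \<union> A' (Bi n xs)"
      have sub: "A' X \<subseteq> E" for X using A'(1)[of X] Z R by auto
      have OE: "Opt \<subseteq> E" using Opt R by auto
      have "f (?X \<union> ?Y) + f (?X \<inter> ?Y) \<le> f ?X + f ?Y"
        by (rule submod_Un_Int) (use sub OE in auto)
      moreover have "?X \<inter> ?Y = Opt"
      proof -
        have "A' (Bi i xs) \<inter> A' (Bi n xs) = {}" if "i < n" for i using disj[OF that] A'(1) by blast
        then show ?thesis by blast
      qed
      moreover have "?X \<union> ?Y = Opt \<union> (\<Union>i<Suc n. A' (Bi i xs))" by (auto simp: less_Suc_eq)
      ultimately show ?case using Suc by (simp add: algebra_simps)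
    qed
    let ?G = "\<Union>i<M. A' (Bi i xs)"
    have G: "?G \<subseteq> Z" using A'(1) by blast
    have "card ?G \<le> (\<Sum>i<M. card (A' (Bi i xs)))" by (rule card_UN_le) simp
    also have "\<dots> \<le> (\<Sum>i<M. m)" by (intro sum_mono A'(2))
    finally have "card ?G \<le> K" using M by simp
    moreover have "finite ?G" using G finZ by (meson finite_subset)
    then have "card (?G - Opt) \<le> card ?G" by (intro card_mono) auto
    ultimately have "f (?G - Opt) \<le> V0" using G by (intro V0) auto
    moreover have "f Opt - f (?G - Opt) \<le> f (Opt \<union> ?G)"
      by (rule f_Un_ge_diff) (use Opt R G Z in blast)+
    ultimately show "M * f Opt - V0 \<le> (\<Sum>i<M. f (Opt \<union> A' (Bi i xs)))" using ind[of M] by linarith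
  qed
  also have "\<dots> = (\<Sum>i<M. perm_avg R (\<lambda>xs. f (Opt \<union> A' (Bi i xs))))" by (rule perm_avg_sum)
  also have "\<dots> = (\<Sum>i<M. perm_avg R (\<lambda>xs. f (Opt \<union> A' (B xs))))"
  proof (rule sum.cong)
    fix i assume "i \<in> {..<M}"
    then have "Suc i * l \<le> M * l" by (intro mult_right_mono) auto
    then show "perm_avg R (\<lambda>xs. f (Opt \<union> A' (Bi i xs))) = perm_avg R (\<lambda>xs. f (Opt \<union> A' (B xs)))"
      unfolding Bi_def using M(1) by (intro perm_avg_block[of i l R "\<lambda>X. f (Opt \<union> A' X)"]) simp
  qed simp
  finally have "M * f Opt - V0 \<le> M * perm_avg R (\<lambda>xs. f (A xs \<union> Opt))" by (simp add: A_def A'_def Un_commute)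
  then show ?thesis using M(3) by (simp add: field_simps)
qed

text \<open>What the second chain is measured against: the core, the saved part of the optimum, and
  the unsaved part still to come. Unsaved elements inside the block are gone.\<close>

definition W :: "'a list \<Rightarrow> real" where "W xs = f (A xs \<union> T \<union> (U - B xs))"

text \<open>Submodularity for the set in \<open>W\<close> and \<open>Opt\<close>. The union is the
  core with \<open>Opt\<close>, which costs lam on average. The intersection is \<open>Opt\<close>
  with each element of U missing with probability exactly rho; if all were missing, T would remain,
  worth at least ph.\<close>

lemma avg_W_ge:
  assumes "om \<le> f Opt" and lam: "f Opt - lam \<le> perm_avg R (\<lambda>xs. f (A xs \<union> Opt))"
  shows "(1 - rho) * om + rho * ph - lam \<le> perm_avg R W"
proof -
  have OE: "Opt \<subseteq> E" "T \<subseteq> E" using Opt R by auto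
  have "(1 - rho) * f Opt + rho * f (Opt - U) \<le> perm_avg R (\<lambda>xs. f (Opt - (U \<inter> B xs)))"
  proof (rule perm_avg_f_remove_ge)
    fix u assume "u \<in> U"
    then have "perm_avg R (\<lambda>xs. of_bool (u \<in> B xs)) = rho"
      using Opt by (intro perm_avg_mem_prefix_prob finR l) auto
    then show "perm_avg R (\<lambda>xs. of_bool (u \<in> B xs)) \<le> rho" "rho \<le> perm_avg R (\<lambda>xs. of_bool (u \<in> B xs))" by simp_all
  qed (use OE finR rho in auto)
  moreover have "Opt - U = T" by auto
  ultimately have 1: "(1 - rho) * f Opt + rho * f T \<le> perm_avg R (\<lambda>xs. f (Opt - (U \<inter> B xs)))" by simp
  have "perm_avg R (\<lambda>xs. f (A xs \<union> Opt) + f (Opt - (U \<inter> B xs)) - f Opt) \<le> perm_avg R W"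
  proof (rule perm_avg_mono)
    fix xs
    let ?X = "A xs \<union> T \<union> (U - B xs)"
    have AZ: "A xs \<subseteq> Z" using A_sub(1) by blast
    have "f (?X \<union> Opt) + f (?X \<inter> Opt) \<le> f ?X + f Opt" by (rule submod_Un_Int) (use AZ Z R OE in auto)
    moreover have "?X \<union> Opt = A xs \<union> Opt" "?X \<inter> Opt = Opt - (U \<inter> B xs)" using AZ by auto
    ultimately show "f (A xs \<union> Opt) + f (Opt - (U \<inter> B xs)) - f Opt \<le> W xs" by (simp add: W_def)
  qed
  then have "perm_avg R (\<lambda>xs. f (A xs \<union> Opt)) + perm_avg R (\<lambda>xs. f (Opt - (U \<inter> B xs))) - f Opt \<le> perm_avg R W"
    using finR by (simp only: perm_avg_add perm_avg_diff perm_avg_const)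
  moreover have "(1 - rho) * om \<le> (1 - rho) * f Opt" using assms rho by (intro mult_left_mono) auto
  moreover have "rho * ph \<le> rho * f T" using f_T_ge rho by (intro mult_left_mono) auto
  ultimately show ?thesis using 1 lam by linarith
qed

end


text \<open>In units of the optimum: \<open>t = card T / k\<close>, \<open>tau = card T / m\<close>, \<open>b = m / k\<close>, \<open>r\<close> is the fraction of the
  stream in the block, and \<open>y\<close>, \<open>al\<close>, \<open>w\<close> are the averages of \<open>y\<close>, \<open>a\<close>, \<open>W\<close> in \<open>block\<close>. The loss \<open>lam\<close> is bounded
  by \<open>y\<close> and, spreading it over 14 blocks, by \<open>0.50295 / 14\<close>.\<close>

lemma symmetric_gain_numeric:
  fixes t b r y lam w al tau :: real
  assumes t: "0 \<le> t" "t \<le> 119 / 10000" and b: "0 \<le> b" "b \<le> 133 / 10000"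
    and r: "71 / 1000 \<le> r" "r \<le> 1 / 14" and tau: "0 \<le> tau" "tau \<le> 150 * t"
    and lam: "lam \<le> y" "lam \<le> 50295 / 1400000"
    and w: "(1 - r) + r * (4134 / 10000 + 3 * t) - lam \<le> w"
    and al: "y + (4134 / 10000 + 3 * t) * (r - r * r * tau / 2) - r * (2 + tau) * y \<le> al"
    and y: "0 \<le> y" and cap: "al \<le> 1 / 2"
  shows "50295 / 100000 * (2 - b) \<le> (1 - b) * (9999 / 10000 * w) + al + r * (1 - t) * (1 / 2 - al)"
proof -
  define l0 :: real where "l0 = 50295 / 1400000"
  define ph where "ph = 4134 / 10000 + 3 * t"
  have tau2: "tau \<le> 18 / 10" using tau t by simp
  have r0: "0 \<le> r" using r by simp
  define ka where "ka = 1 - r * (2 + tau)"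
  have "r * (2 + tau) \<le> 1 / 14 * (38 / 10)" using r tau tau2 by (intro mult_mono) auto
  then have ka0: "0 \<le> ka" unfolding ka_def by simp
  have "71 / 1000 * 2 \<le> r * (2 + tau)" using r tau by (intro mult_mono) auto
  then have ka1: "ka \<le> 858 / 1000" unfolding ka_def by simp
  define e where "e = 1 - r * (1 - t)"
  have "r * (1 - t) \<le> 1 / 14 * 1" using r t by (intro mult_mono) auto
  then have e0: "0 \<le> e" by (simp add: e_def)
  have "71 / 1000 * (1 - 119 / 10000) \<le> r * (1 - t)" using r t by (intro mult_mono) auto
  then have e1: "e \<le> 93 / 100" by (simp add: e_def)
  define A where "A = ph * (r - r * r * tau / 2)"
  have al': "ka * y + A \<le> al" using al by (simp add: ka_def A_def ph_def algebra_simps)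
  define W where "W = (1 - r) + r * ph"
  have w': "W - lam \<le> w" using w by (simp add: W_def ph_def)
  define g where "g = (1 - b) * (9999 / 10000)"
  have g: "98 / 100 \<le> g" "g \<le> 1" using b by (simp_all add: g_def)
  \<comment> \<open>In y the worst case is \<open>l0\<close>: below it the loss in w, of weight g,
    outweighs the gain in al, of weight e * ka; above it the loss no longer grows.\<close>
  have low: "g * (W - l0) + e * (ka * l0 + A) \<le> g * w + e * al"
  proof (cases "y \<le> l0")
    case True
    have "e * ka \<le> 93 / 100 * (858 / 1000)" using e0 e1 ka0 ka1 by (intro mult_mono) auto
    then have "e * ka \<le> g" using g by simp
    then have "e * ka * (l0 - y) \<le> g * (l0 - y)" using True by (intro mult_right_mono) auto
    moreover have "g * (W - y) \<le> g * w" using w' lam g by (intro mult_left_mono) auto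
    moreover have "e * (ka * y + A) \<le> e * al" using al' e0 by (intro mult_left_mono) auto
    ultimately show ?thesis by (simp add: algebra_simps)
  next
    case False
    have "g * (W - l0) \<le> g * w" using w' lam g by (intro mult_left_mono) (auto simp: l0_def)
    moreover have "ka * l0 + A \<le> al" using al' ka0 False mult_left_mono[of l0 y ka] by linarith
    then have "e * (ka * l0 + A) \<le> e * al" using e0 by (intro mult_left_mono) auto
    ultimately show ?thesis by simp
  qed
  have Wl: "922175 / 1000000 + 2 / 10 * t \<le> W - l0"
  proof -
    have "r * (1 - ph) \<le> 1 / 14 * (1 - ph)" using r t by (intro mult_right_mono) (auto simp: ph_def)
    then show ?thesis using t by (simp add: W_def l0_def ph_def algebra_simps)
  qed
  have Al: "60174 / 1000000 - 341 / 1000 * t \<le> ka * l0 + A"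
  proof -
    define q where "q = ph * (1 - r * tau / 2) - (2 + tau) * l0"
    have "r * tau \<le> 1 / 14 * (150 * t)" using r tau by (intro mult_mono) auto
    then have "1 - 75 / 14 * t \<le> 1 - r * tau / 2" by simp
    then have "ph * (1 - 75 / 14 * t) \<le> ph * (1 - r * tau / 2)" using t by (intro mult_left_mono) (auto simp: ph_def)
    moreover have "ph * (1 - 75 / 14 * t) = 4134 / 10000 + 3 * t - 75 / 14 * (4134 / 10000 * t) - 225 / 14 * (t * t)"
      by (simp add: ph_def field_simps)
    moreover have "t * t \<le> 119 / 10000 * t" using t by (intro mult_right_mono) auto
    moreover have "(2 + tau) * l0 \<le> (2 + 150 * t) * l0" using tau by (intro mult_right_mono) (auto simp: l0_def)
    moreover have "(2 + 150 * t) * l0 = 2 * (50295 / 1400000) + 150 * (50295 / 1400000) * t"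
      by (simp add: l0_def field_simps)
    ultimately have q: "34154 / 100000 - 48 / 10 * t \<le> q" using t(1) unfolding q_def by linarith
    moreover have "0 \<le> 34154 / 100000 - 48 / 10 * t" using t by simp
    ultimately have "71 / 1000 * (34154 / 100000 - 48 / 10 * t) \<le> r * q" using r by (intro mult_mono) auto
    moreover have "ka * l0 + A = l0 + r * q" by (simp add: ka_def A_def q_def algebra_simps)
    ultimately show ?thesis unfolding l0_def using t by simp
  qed
  define Am where "Am = 60174 / 1000000 - 341 / 1000 * t"
  have "g * (922175 / 1000000 + 2 / 10 * t) \<le> g * (W - l0)" using Wl g by (intro mult_left_mono) auto
  moreover have "e * Am \<le> e * (ka * l0 + A)" using Al e0 unfolding Am_def by (intro mult_left_mono) auto
  ultimately have low2: "g * (922175 / 1000000 + 2 / 10 * t) + e * Am \<le> g * w + e * al" using low by linarith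
  have eA: "Am + 70 / 1000 * (1 / 2 - Am) \<le> e * Am + r * (1 - t) / 2"
  proof -
    have "0 \<le> 1 / 2 - Am" using t by (simp add: Am_def)
    moreover have "70 / 1000 \<le> r * (1 - t)" using \<open>71 / 1000 * (1 - 119 / 10000) \<le> r * (1 - t)\<close> by simp
    ultimately have "70 / 1000 * (1 / 2 - Am) \<le> r * (1 - t) * (1 / 2 - Am)" by (intro mult_right_mono)
    then show ?thesis by (simp add: e_def algebra_simps)
  qed
  \<comment> \<open>The difference of both sides decreases in b, since w outweighs 0.50295, so b may
    be taken at its upper bound 0.0133.\<close>
  have "(98670 / 100000 * (9999 / 10000)) * (922175 / 1000000 + 2 / 10 * t) - 50295 / 100000 * (2 - 133 / 10000)
     \<le> g * (922175 / 1000000 + 2 / 10 * t) - 50295 / 100000 * (2 - b)"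
  proof -
    have "(133 / 10000 - b) * (50295 / 100000) \<le> (133 / 10000 - b) * (9999 / 10000 * (922175 / 1000000 + 2 / 10 * t))"
      using b t by (intro mult_left_mono) auto
    moreover have "g * z - c * (2 - b) - ((98670 / 100000 * (9999 / 10000)) * z - c * (2 - 133 / 10000))
      = (133 / 10000 - b) * (9999 / 10000 * z) - (133 / 10000 - b) * c" for z c
      by (simp add: g_def field_simps)
    ultimately show ?thesis by (metis diff_ge_0_iff_ge)
  qed
  moreover have "50295 / 100000 * (2 - 133 / 10000) \<le>
     (98670 / 100000 * (9999 / 10000)) * (922175 / 1000000 + 2 / 10 * t) + (Am + 70 / 1000 * (1 / 2 - Am))"
    using t unfolding Am_def by (simp add: field_simps)
  ultimately have "50295 / 100000 * (2 - b) \<le> g * w + e * al + r * (1 - t) / 2"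
    using low2 eA by linarith
  moreover have "(1 - b) * (9999 / 10000 * w) + al + r * (1 - t) * (1 / 2 - al) = g * w + e * al + r * (1 - t) / 2"
    by (simp add: g_def e_def algebra_simps)
  ultimately show ?thesis by simp
qed

context block
begin

text \<open>The averaged expression is the lower bound on (2k - m) V that the second chain will
  provide; the factor 9999/10000 pays for its windows. The only product of random quantities in it,
  of \<open>card (B xs \<inter> U)\<close> and \<open>a xs\<close>, is handled by
  \<open>avg_cU_a\<close>.\<close>

lemma block_gain:
  fixes k :: nat
  assumes k: "86 \<le> k" "k \<le> 150 * m" "10000 * m \<le> 133 * k" and Ok: "card Opt \<le> k"
    and om0: "0 < om" "om \<le> f Opt"
    and tk: "10000 * card T \<le> 119 * k" and phk: "ph = (4134 / 10000 + 3 * (card T / k)) * om"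
    and rk: "71 * card R \<le> 1000 * l" "14 * l \<le> card R" "0 < card R"
    and V0: "\<And>X. X \<subseteq> Z \<Longrightarrow> card X \<le> k \<Longrightarrow> f X \<le> 50295 / 100000 * om"
  shows "50295 / 100000 * om * (2 * real k - m)
    \<le> perm_avg R (\<lambda>xs. (real k - m) * (9999 / 10000 * W xs) + k * a xs
          + (real (card (B xs \<inter> U)) + (real k - card Opt)) * (om / 2 - a xs))"
proof -
  have kpos: "0 < real k" using k by simp
  define t where "t = real (card T) / k"
  define b where "b = real m / k"
  define ya where "ya = perm_avg R y / om"
  define al where "al = perm_avg R a / om"
  define w where "w = perm_avg R W / om"
  define lam where "lam = min ya (50295 / 1400000)"
  define tau where "tau = real (card T) / m"
  have t: "0 \<le> t" "t \<le> 119 / 10000" using tk kpos by (simp_all add: t_def divide_le_eq)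
  have b: "0 \<le> b" "b \<le> 133 / 10000" using k kpos by (simp_all add: b_def divide_le_eq)
  have r: "71 / 1000 \<le> rho" "rho \<le> 1 / 14" using rk by (simp_all add: field_simps)
  have tau: "0 \<le> tau" "tau \<le> 150 * t"
  proof -
    have "real (card T) * k \<le> real (card T) * (150 * m)" using k by (intro mult_left_mono) (simp_all flip: of_nat_mult)
    then show "tau \<le> 150 * t" using m kpos by (simp add: tau_def t_def field_simps)
  qed (simp add: tau_def)
  have T_card: "real (card T) = t * k" using kpos by (simp add: t_def)
  have y0: "0 \<le> ya" unfolding ya_def using finR om0 y_nonneg by (intro divide_nonneg_pos perm_avg_ge_const) auto
  have lam_ge: "f Opt - lam * om \<le> perm_avg R (\<lambda>xs. f (A xs \<union> Opt))"
  proof -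
    have "14 * m \<le> k" using k by linarith
    then have "f Opt - (50295 / 100000 * om) / 14 \<le> perm_avg R (\<lambda>xs. f (A xs \<union> Opt))"
      using avg_Opt_A_ge2[of 14 k "50295 / 100000 * om"] rk V0 by simp
    moreover have "f Opt - ya * om \<le> perm_avg R (\<lambda>xs. f (A xs \<union> Opt))"
      using avg_Opt_A_ge1 om0 by (simp add: ya_def)
    ultimately show ?thesis by (simp add: lam_def min_def)
  qed
  have "(1 - rho) * om + rho * ph - lam * om \<le> perm_avg R W" by (rule avg_W_ge[OF om0(2) lam_ge])
  then have w: "(1 - rho) + rho * (4134 / 10000 + 3 * t) - lam \<le> w"
    using om0 unfolding w_def phk t_def[symmetric] by (simp add: le_divide_eq algebra_simps)
  have "0 \<le> ph" using om0 by (simp add: phk)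
  from avg_a_ge[OF this] have a1: "ya * om + (4134 / 10000 + 3 * t) * om * (rho - rho\<^sup>2 * card T / (2 * m)) - rho * (2 + tau) * (ya * om) \<le> al * om"
    using om0 unfolding phk t_def[symmetric] tau_def[symmetric] by (simp add: ya_def al_def)
  have a2: "rho\<^sup>2 * card T / (2 * m) = rho * rho * tau / 2" by (simp add: tau_def power2_eq_square)
  have a3: "om * (ya + c * d - x * ya) = ya * om + c * om * d - x * (ya * om)" for c d x :: real
    by (simp add: algebra_simps)
  have "om * (ya + (4134 / 10000 + 3 * t) * (rho - rho * rho * tau / 2) - rho * (2 + tau) * ya) \<le> om * al"
    using a1 unfolding a2 a3 mult.commute[of om al] .
  then have al: "ya + (4134 / 10000 + 3 * t) * (rho - rho * rho * tau / 2) - rho * (2 + tau) * ya \<le> al"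
    using om0 by (simp add: mult_le_cancel_left_pos)
  define u where "u = rho * card U + (real k - card Opt)"
  have Ocard: "card Opt = card U + card T"
  proof -
    have "Opt = U \<union> T" by auto
    then show ?thesis using card_Un_disjoint[OF finU finT] by (metis Diff_disjoint Int_assoc Int_commute Int_empty_right inf_assoc)
  qed
  have u_ge: "rho * (1 - t) * k \<le> u"
  proof -
    have "0 \<le> (1 - rho) * (real k - card Opt)" using rho Ok by (intro mult_nonneg_nonneg) auto
    moreover have "rho * (1 - t) * k = rho * (real k - card T)"
    proof -
      have "(1 - t) * k = real k - card T" by (simp add: T_card left_diff_distrib)
      then show ?thesis by (simp only: mult.assoc)
    qed
    moreover have "r * cu + (x - (cu + ct)) = r * (x - ct) + (1 - r) * (x - (cu + ct))" for r cu ct x :: real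
      by (simp add: algebra_simps)
    from this[of rho "card U" k "card T"]
    have "rho * card U + (real k - (real (card U) + real (card T))) = rho * (real k - card T) + (1 - rho) * (real k - (real (card U) + card T))" .
    ultimately show ?thesis unfolding u_def Ocard of_nat_add by linarith
  qed
  have u_le: "u \<le> k"
  proof -
    have "rho * real (card U) \<le> 1 * real (card U)" using rho by (intro mult_right_mono) auto
    then show ?thesis unfolding u_def Ocard by simp
  qed
  have u0: "0 \<le> u" using rho Ok by (auto simp: u_def)
  have prod: "perm_avg R (\<lambda>xs. (real (card (B xs \<inter> U)) + (real k - card Opt)) * (om / 2 - a xs)) \<ge> u * (om / 2 - perm_avg R a)"
  proof -
    have "perm_avg R (\<lambda>xs. (real (card (B xs \<inter> U)) + (real k - card Opt)) * (om / 2 - a xs))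
      = perm_avg R (\<lambda>xs. om / 2 * real (card (B xs \<inter> U)) + (real k - card Opt) * (om / 2)
          - (card (B xs \<inter> U) * a xs + (real k - card Opt) * a xs))"
      by (rule perm_avg_cong) (simp add: algebra_simps)
    also have "\<dots> = om / 2 * (rho * card U) + (real k - card Opt) * (om / 2)
          - (perm_avg R (\<lambda>xs. card (B xs \<inter> U) * a xs) + (real k - card Opt) * perm_avg R a)"
      using finR by (simp only: perm_avg_add perm_avg_diff perm_avg_cmult avg_cU perm_avg_const)
    moreover have "om / 2 * (rho * card U) + (real k - card Opt) * (om / 2)
          - (perm_avg R (\<lambda>xs. card (B xs \<inter> U) * a xs) + (real k - card Opt) * perm_avg R a) \<ge> om / 2 * (rho * card U) + (real k - card Opt) * (om / 2)
          - (rho * card U * perm_avg R a + (real k - card Opt) * perm_avg R a)"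
      using avg_cU_a by simp
    moreover have "om / 2 * x + z * (om / 2) - (x * v + z * v) = (x + z) * (om / 2 - v)" for x z v :: real
      by (simp add: field_simps)
    ultimately show ?thesis by (simp only: u_def)
  qed
  define al0 where "al0 = min al (1 / 2)"
  \<comment> \<open>If al exceeds 1/2 the last summand is negative. Replacing u / k by 1 there turns
    the last two summands into 1/2, and the term with w supplies more than the rest.\<close>
  have key: "50295 / 100000 * (2 - b) \<le> (1 - b) * (9999 / 10000 * w) + al + u / k * (1 / 2 - al)"
  proof (cases "al \<le> 1 / 2")
    case True
    have "50295 / 100000 * (2 - b) \<le> (1 - b) * (9999 / 10000 * w) + al + rho * (1 - t) * (1 / 2 - al)"
      by (rule symmetric_gain_numeric[OF t b r tau _ _ w al y0 True]) (simp_all add: lam_def)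
    moreover have "rho * (1 - t) \<le> u / k" using u_ge kpos by (simp add: le_divide_eq)
    then have "rho * (1 - t) * (1 / 2 - al) \<le> u / k * (1 / 2 - al)" using True by (intro mult_right_mono) auto
    ultimately show ?thesis by linarith
  next
    case False
    have "rho * (4134 / 10000 + 3 * t) \<ge> 0" using rho t by simp
    then have "1 - 1 / 14 - 50295 / 1400000 \<le> w" using w r unfolding lam_def by linarith
    then have "(1 - 133 / 10000) * (9999 / 10000 * (892 / 1000)) \<le> (1 - b) * (9999 / 10000 * w)" using b by (intro mult_mono) auto
    moreover have "u / k \<le> 1" using u_le kpos by (simp add: divide_le_eq)
    then have "1 * (1 / 2 - al) \<le> u / k * (1 / 2 - al)" using False by (intro mult_right_mono_neg) auto
    ultimately show ?thesis using b by simp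
  qed
  have "om * k * (50295 / 100000 * (2 - b)) \<le> om * k * ((1 - b) * (9999 / 10000 * w) + al + u / k * (1 / 2 - al))"
    using key om0 kpos by (intro mult_left_mono) auto
  also have "\<dots> = (real k - m) * (9999 / 10000 * perm_avg R W) + k * perm_avg R a + u * (om / 2 - perm_avg R a)"
    using om0 kpos by (simp add: b_def w_def al_def field_simps)
  also have "\<dots> \<le> perm_avg R (\<lambda>xs. (real k - m) * (9999 / 10000 * W xs)) + perm_avg R (\<lambda>xs. k * a xs)
          + perm_avg R (\<lambda>xs. (real (card (B xs \<inter> U)) + (real k - card Opt)) * (om / 2 - a xs))"
    using prod by (simp only: perm_avg_cmult)
  finally have "om * k * (50295 / 100000 * (2 - b)) \<le> perm_avg R (\<lambda>xs. (real k - m) * (9999 / 10000 * W xs)) + perm_avg R (\<lambda>xs. k * a xs)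
          + perm_avg R (\<lambda>xs. (real (card (B xs \<inter> U)) + (real k - card Opt)) * (om / 2 - a xs))" .
  moreover have "om * k * (50295 / 100000 * (2 - b)) = 50295 / 100000 * om * (2 * real k - m)"
    using kpos by (simp add: b_def field_simps)
  ultimately show ?thesis by (simp only: perm_avg_add)
qed

end

section \<open>Greedy picks from consecutive windows\<close>

section \<open>The streaming machine\<close>


definition upd :: "('a set \<Rightarrow> real) \<Rightarrow> 'a set \<Rightarrow> nat \<Rightarrow> 'a \<Rightarrow> 'a list \<Rightarrow> 'a list" where
  "upd f C j e p = (if length p \<le> j then p @ [e]
     else if f (insert (p ! j) (C \<union> set (take j p))) < f (insert e (C \<union> set (take j p))) then p[j := e]
     else p)"

text \<open>The picks after the first \<open>i\<close> arrivals; window \<open>j\<close> consists of the positions \<open>l \<ge> al\<close> with \<open>w l = j\<close>.\<close>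

primrec picks :: "('a set \<Rightarrow> real) \<Rightarrow> 'a set \<Rightarrow> (nat \<Rightarrow> nat) \<Rightarrow> 'a list \<Rightarrow> nat \<Rightarrow> nat \<Rightarrow> 'a list" where
  "picks f C w xs al 0 = []"
| "picks f C w xs al (Suc i) = (if al \<le> i then upd f C (w i) (xs ! i) (picks f C w xs al i) else [])"

lemma picks_before: "i \<le> al \<Longrightarrow> picks f C w xs al i = []"
  by (cases i) auto

lemma picks_cong: "(\<And>l. l < i \<Longrightarrow> xs ! l = ys ! l) \<Longrightarrow> picks f C w xs al i = picks f C w ys al i"
  by (induction i) auto

lemma take_upd: "j \<le> l \<Longrightarrow> l \<le> length p \<Longrightarrow> take j (upd f C l e p) = take j p"
  by (auto simp: upd_def)

text \<open>A window index that rises by at most one per arrival never skips a window; so each new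
  window appends exactly one pick and position j of the list belongs to window j.\<close>

locale window_fun =
  fixes w :: "nat \<Rightarrow> nat" and al be :: nat
  assumes w0: "al < be \<Longrightarrow> w al = 0"
    and w_step: "\<And>i. al \<le> i \<Longrightarrow> Suc i < be \<Longrightarrow> w i \<le> w (Suc i) \<and> w (Suc i) \<le> Suc (w i)"
begin

lemma w_mono: "al \<le> i \<Longrightarrow> i \<le> j \<Longrightarrow> j < be \<Longrightarrow> w i \<le> w j"
proof (induction j)
  case (Suc j)
  show ?case
  proof (cases "i = Suc j")
    case False
    then have "w i \<le> w j" using Suc by simp
    also have "w j \<le> w (Suc j)" using w_step[of j] Suc.prems False by simp
    finally show ?thesis .
  qed simp
qed simp

lemma length_picks: "al \<le> i \<Longrightarrow> i \<le> be \<Longrightarrow> length (picks f C w xs al i) = (if i = al then 0 else Suc (w (i - 1)))"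
proof (induction i)
  case (Suc i)
  show ?case
  proof (cases "Suc i = al")
    case True then show ?thesis by (simp add: picks_before)
  next
    case False
    then have ai: "al \<le> i" using Suc.prems by simp
    have IH: "length (picks f C w xs al i) = (if i = al then 0 else Suc (w (i - 1)))" using Suc ai by simp
    show ?thesis
    proof (cases "i = al")
      case True then show ?thesis using IH Suc.prems w0 by (simp add: upd_def)
    next
      case False
      have "w (i - 1) \<le> w i \<and> w i \<le> Suc (w (i - 1))" using w_step[of "i - 1"] False ai Suc.prems by simp
      then show ?thesis using IH False ai by (auto simp: upd_def)
    qed
  qed
qed simp

lemma w_le_length_picks: "al \<le> i \<Longrightarrow> i < be \<Longrightarrow> w i \<le> length (picks f C w xs al i)"
  using length_picks[of i f C xs] w_step[of "i - 1"] w0 by (cases "i = al") auto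

text \<open>Windows only move forward, so the picks of closed windows are frozen.\<close>

lemma take_picks: "al \<le> i \<Longrightarrow> i \<le> i' \<Longrightarrow> i' \<le> be \<Longrightarrow> i < be \<Longrightarrow> j \<le> w i \<Longrightarrow>
    take j (picks f C w xs al i') = take j (picks f C w xs al i)"
proof (induction i')
  case (Suc i')
  show ?case
  proof (cases "i = Suc i'")
    case False
    then have i': "i \<le> i'" "i' < be" using Suc.prems by auto
    have "j \<le> w i'" using w_mono[of i i'] Suc.prems i' by simp
    then have "take j (picks f C w xs al (Suc i')) = take j (picks f C w xs al i')"
      using Suc.prems i' w_le_length_picks[of i' f C xs] by (simp add: take_upd)
    then show ?thesis using Suc i' by simp
  qed simp
qed simp

text \<open>The pick of a window is judged over the picks of earlier windows, which no longer
  change; hence replacing only by strictly better elements keeps a maximum of the window.\<close>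

lemma picks_props:
  fixes f :: "'a set \<Rightarrow> real" and C :: "'a set" and xs :: "'a list" and i :: nat
  assumes "al \<le> i" "i \<le> be"
  defines "p \<equiv> picks f C w xs al i"
  shows "j < length p \<Longrightarrow> \<exists>l. al \<le> l \<and> l < i \<and> w l = j \<and> p ! j = xs ! l"
    and "al \<le> l \<Longrightarrow> l < i \<Longrightarrow> w l < length p \<and>
      f (insert (xs ! l) (C \<union> set (take (w l) p))) \<le> f (insert (p ! w l) (C \<union> set (take (w l) p)))"
proof -
  have "(\<forall>j<length p. \<exists>l. al \<le> l \<and> l < i \<and> w l = j \<and> p ! j = xs ! l) \<and>
     (\<forall>l. al \<le> l \<longrightarrow> l < i \<longrightarrow> w l < length p \<and>
      f (insert (xs ! l) (C \<union> set (take (w l) p))) \<le> f (insert (p ! w l) (C \<union> set (take (w l) p))))"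
    using assms(1,2) unfolding p_def
  proof (induction i)
    case 0 then show ?case by simp
  next
    case (Suc i)
    show ?case
    proof (cases "Suc i = al")
      case True then show ?thesis by (simp add: picks_before)
    next
      case False
      then have ai: "al \<le> i" "i < be" using Suc.prems by auto
      define q where "q = picks f C w xs al i"
      define p where "p = picks f C w xs al (Suc i)"
      have pq: "p = upd f C (w i) (xs ! i) q" using ai by (simp add: p_def q_def)
      have IH1: "\<exists>l. al \<le> l \<and> l < i \<and> w l = j \<and> q ! j = xs ! l" if "j < length q" for j
        using Suc ai that unfolding q_def by auto
      have IH2: "w l < length q \<and> f (insert (xs ! l) (C \<union> set (take (w l) q))) \<le> f (insert (q ! w l) (C \<union> set (take (w l) q)))"
        if "al \<le> l" "l < i" for l using Suc ai that unfolding q_def by auto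
      have wl: "w i \<le> length q" unfolding q_def by (rule w_le_length_picks) (use ai in auto)
      have lq: "length q \<le> Suc (w i)"
        using length_picks[of i f C xs] ai w_mono[of "i - 1" i] unfolding q_def by (cases "i = al") auto
      have lp: "length p = Suc (w i)" using pq wl lq by (auto simp: upd_def)
      have tk: "take j p = take j q" if "j \<le> w i" for j unfolding pq using that wl by (rule take_upd)
      have nth: "p ! j = q ! j" if "j < w i" for j
        using tk[of "w i"] that wl lp by (metis le_refl nth_take)
      have last: "p ! w i = (if length q \<le> w i then xs ! i else if f (insert (q ! w i) (C \<union> set (take (w i) q))) < f (insert (xs ! i) (C \<union> set (take (w i) q))) then xs ! i else q ! w i)"
        using wl by (auto simp: pq upd_def nth_append)
      have 1: "\<exists>l. al \<le> l \<and> l < Suc i \<and> w l = j \<and> p ! j = xs ! l" if j: "j < length p" for j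
      proof (cases "j < w i")
        case True then show ?thesis using IH1[of j] nth wl by (metis less_SucI less_le_trans)
      next
        case False
        then have "j = w i" using j lp by simp
        then have "p ! j = xs ! i \<or> (j < length q \<and> p ! j = q ! j)" using last by (auto split: if_splits)
        then show ?thesis
        proof
          assume "p ! j = xs ! i" then show ?thesis using \<open>j = w i\<close> ai(1) by blast
        next
          assume "j < length q \<and> p ! j = q ! j"
          then show ?thesis using IH1[of j] by (metis less_SucI)
        qed
      qed
      have 2: "w l < length p \<and> f (insert (xs ! l) (C \<union> set (take (w l) p))) \<le> f (insert (p ! w l) (C \<union> set (take (w l) p)))"
        if l: "al \<le> l" "l < Suc i" for l
      proof -
        have wli: "w l \<le> w i" using w_mono[of l i] l ai by simp
        show ?thesis
        proof (cases "l = i")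
          case True then show ?thesis using last tk[of "w i"] lp by auto
        next
          case False
          then have li: "l < i" using l by simp
          show ?thesis
          proof (cases "w l < w i")
            case True then show ?thesis using IH2[OF l(1) li] tk[of "w l"] nth lp by simp
          next
            case False
            then have "w l = w i" using wli by simp
            then show ?thesis using IH2[OF l(1) li] tk[of "w i"] last lp by auto
          qed
        qed
      qed
      show ?thesis using 1 2 unfolding p_def by blast
    qed
  qed
  then show "j < length p \<Longrightarrow> \<exists>l. al \<le> l \<and> l < i \<and> w l = j \<and> p ! j = xs ! l"
    "al \<le> l \<Longrightarrow> l < i \<Longrightarrow> w l < length p \<and>
      f (insert (xs ! l) (C \<union> set (take (w l) p))) \<le> f (insert (p ! w l) (C \<union> set (take (w l) p)))"
    by auto
qed

end

section \<open>How many later elements beat a whole window\<close>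

lemma top_subset_exists:
  fixes h :: "'a \<Rightarrow> real"
  assumes "finite R" "M \<le> card R"
  shows "\<exists>D\<subseteq>R. card D = M \<and> (\<forall>d\<in>D. \<forall>x\<in>R - D. h x \<le> h d)"
  using assms
proof (induction M)
  case 0 then show ?case by auto
next
  case (Suc M)
  then obtain D where D: "D \<subseteq> R" "card D = M" "\<forall>d\<in>D. \<forall>x\<in>R - D. h x \<le> h d" by auto
  have "R - D \<noteq> {}" using D Suc.prems by (metis Diff_eq_empty_iff card_mono finite_subset not_less_eq_eq)
  moreover have "finite (R - D)" using Suc.prems by simp
  ultimately have "Max (h ` (R - D)) \<in> h ` (R - D)" by (intro Max_in) simp_all
  then obtain x where x: "x \<in> R - D" "h x = Max (h ` (R - D))" by (metis imageE)
  then have mx: "h z \<le> h x" if "z \<in> R - D" for z using that \<open>finite (R - D)\<close> by simp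
  have "finite D" using D(1) Suc.prems(1) by (rule finite_subset)
  then have cardD: "card (insert x D) = Suc M" using x(1) D(2) by simp
  have top: "h z \<le> h d" if "d \<in> insert x D" "z \<in> R - insert x D" for d z
  proof (cases "d = x")
    case True then show ?thesis using mx that(2) by simp
  next
    case False
    then have "d \<in> D" "z \<in> R - D" using that by simp_all
    then show ?thesis using D(3) by simp
  qed
  have "insert x D \<subseteq> R" using x(1) D(1) by simp
  then have "insert x D \<subseteq> R \<and> card (insert x D) = Suc M \<and> (\<forall>d\<in>insert x D. \<forall>z\<in>R - insert x D. h z \<le> h d)"
  proof (intro conjI ballI)
    fix d z assume "d \<in> insert x D" "z \<in> R - insert x D" then show "h z \<le> h d" by (rule top)
  qed ((assumption | rule cardD)+)
  then show ?case by (rule exI)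
qed

text \<open>Let D be M best remaining elements for h, a criterion fixed by the prefix. Once the
  window contains one of them, only members of D can beat the entire window, so failure forces the
  window to miss D. If fewer than M elements remain, failure is impossible.\<close>

lemma window_fail:
  fixes h :: "'a list \<Rightarrow> 'a \<Rightarrow> real"
  assumes E: "finite E" "0 < card E" and g: "al + g \<le> card E" and ME: "M \<le> card E"
  shows "perm_avg E (\<lambda>xs. of_bool (M < card {e \<in> set (drop al xs). \<forall>e'\<in>set (take g (drop al xs)). h (take al xs) e' < h (take al xs) e}))
      \<le> (1 - M / card E) ^ g"
proof -
  let ?P = "\<lambda>P ys. of_bool (M < card {e \<in> set ys. \<forall>e'\<in>set (take g ys). h P e' < h P e}) :: real"
  have nonneg: "0 \<le> (1 - real M / card E) ^ g" using ME E by (intro zero_le_power) (simp add: divide_le_eq_1)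
  have "perm_avg E (\<lambda>xs. ?P (take al xs) (drop al xs))
     = perm_avg E (\<lambda>xs. perm_avg (E - set (take al xs)) (\<lambda>ys. ?P (take al (take al xs @ ys)) (drop al (take al xs @ ys))))"
    by (rule perm_avg_tower) (use E g in auto)
  also have "\<dots> \<le> (1 - M / card E) ^ g"
  proof (rule perm_avg_le_const[OF E(1)])
    fix xs assume xs: "xs \<in> permutations_of_set E"
    then have dist: "distinct xs" and sx: "set xs = E" and len: "length xs = card E"
      by (auto simp: permutations_of_set_def length_finite_permutations_of_set[OF xs])
    define P where "P = take al xs"
    define R where "R = E - set P"
    have lP: "length P = al" using len g by (simp add: P_def)
    have finR: "finite R" using E by (simp add: R_def)
    have cR: "card R = card E - al"
    proof -
      have "card (set P) = al" using dist lP by (metis P_def distinct_card distinct_take)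
      moreover have "set P \<subseteq> E" unfolding P_def sx[symmetric] by (rule set_take_subset)
      ultimately show ?thesis by (simp add: R_def card_Diff_subset finite_subset[OF _ E(1)])
    qed
    have split: "perm_avg (E - set (take al xs)) (\<lambda>ys. ?P (take al (take al xs @ ys)) (drop al (take al xs @ ys))) = perm_avg R (?P P)"
    proof -
      have "take al (P @ ys) = P" "drop al (P @ ys) = ys" for ys using lP by simp_all
      then show ?thesis unfolding P_def[symmetric] R_def[symmetric] by (simp only:)
    qed
    show "perm_avg (E - set (take al xs)) (\<lambda>ys. ?P (take al (take al xs @ ys)) (drop al (take al xs @ ys))) \<le> (1 - M / card E) ^ g"
    proof (cases "M \<le> card R")
      case False
      have "perm_avg R (\<lambda>ys. ?P P ys) \<le> 0"
      proof (rule perm_avg_le_const[OF finR])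
        fix ys assume "ys \<in> permutations_of_set R"
        then have "set ys = R" by (simp add: permutations_of_set_def)
        then have "{e \<in> set ys. \<forall>e'\<in>set (take g ys). h P e' < h P e} \<subseteq> R" by simp
        from card_mono[OF finR this] have "\<not> M < card {e \<in> set ys. \<forall>e'\<in>set (take g ys). h P e' < h P e}"
          using False by linarith
        then show "?P P ys \<le> 0" by (simp only: of_bool_eq order.refl)
      qed
      then have "perm_avg R (?P P) \<le> (1 - M / card E) ^ g" using nonneg by (rule order_trans)
      then show ?thesis unfolding split .
    next
      case True
      obtain D where D: "D \<subseteq> R" "card D = M" "\<forall>d\<in>D. \<forall>x\<in>R - D. h P x \<le> h P d"
        using top_subset_exists[OF finR True] by blast
      have "perm_avg R (\<lambda>ys. ?P P ys) \<le> perm_avg R (\<lambda>ys. of_bool (set (take g ys) \<inter> D = {}))"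
      proof (rule perm_avg_mono)
        fix ys assume "ys \<in> permutations_of_set R"
        then have ys: "set ys = R" by (simp add: permutations_of_set_def)
        have "card {e \<in> set ys. \<forall>e'\<in>set (take g ys). h P e' < h P e} \<le> M" if ne: "set (take g ys) \<inter> D \<noteq> {}"
        proof -
          obtain d where d: "d \<in> set (take g ys)" "d \<in> D" using ne by auto
          have "{e \<in> set ys. \<forall>e'\<in>set (take g ys). h P e' < h P e} \<subseteq> D"
          proof
            fix e assume e: "e \<in> {e \<in> set ys. \<forall>e'\<in>set (take g ys). h P e' < h P e}"
            show "e \<in> D"
            proof (rule ccontr)
              assume "e \<notin> D"
              then have "h P e \<le> h P d" using e ys D(3) d(2) by simp
              then show False using e d(1) by fastforce
            qed
          qed
          then show ?thesis using D(1,2) finR by (metis card_mono finite_subset)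
        qed
        then show "?P P ys \<le> of_bool (set (take g ys) \<inter> D = {})"
          by (cases "set (take g ys) \<inter> D = {}") (simp_all only: not_less of_bool_eq order.refl, simp_all)
      qed
      also have "\<dots> \<le> (1 - card D / card E) ^ g"
        by (rule perm_avg_prefix_avoids) (use D finR cR g E in auto)
      finally show ?thesis unfolding split D(2) .
    qed
  qed
  finally show ?thesis .
qed


section \<open>Tick counts, window boundaries and the chains they define\<close>

definition ticks :: "bool list \<Rightarrow> nat \<Rightarrow> nat" where
  "ticks bs i = length (filter id (take i bs))"

text \<open>Junk if there are fewer than \<open>K\<close> ticks.\<close>

definition cut :: "bool list \<Rightarrow> nat \<Rightarrow> nat" where
  "cut bs K = (LEAST i. K \<le> ticks bs i)"

lemma ticks_0 [simp]: "ticks bs 0 = 0" by (simp add: ticks_def)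

lemma ticks_Suc: "i < length bs \<Longrightarrow> ticks bs (Suc i) = ticks bs i + of_bool (bs ! i)"
  by (simp add: ticks_def take_Suc_conv_app_nth)

lemma ticks_ge_length: "length bs \<le> i \<Longrightarrow> ticks bs i = ticks bs (length bs)"
  by (simp add: ticks_def)

lemma ticks_Suc_le: "ticks bs (Suc i) \<le> Suc (ticks bs i)" "ticks bs i \<le> ticks bs (Suc i)"
  using ticks_Suc[of i bs] ticks_ge_length[of bs i] ticks_ge_length[of bs "Suc i"]
  by (cases "i < length bs"; auto)+

lemma ticks_mono: "i \<le> j \<Longrightarrow> ticks bs i \<le> ticks bs j"
  by (rule lift_Suc_mono_le[of "ticks bs"]) (simp_all add: ticks_Suc_le)

lemma cut_0 [simp]: "cut bs 0 = 0" by (simp add: cut_def)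

text \<open>The Galois connection between positions and tick counts; the assumption excludes the
  junk value of \<open>cut\<close>.\<close>

lemma less_cut_iff:
  assumes "K \<le> ticks bs n"
  shows "i < cut bs K \<longleftrightarrow> ticks bs i < K"
proof -
  have 1: "K \<le> ticks bs (cut bs K)" unfolding cut_def by (rule LeastI[of _ n]) (rule assms)
  have 2: "ticks bs i < K" if "i < cut bs K" using not_less_Least[of i "\<lambda>i. K \<le> ticks bs i"] that
    unfolding cut_def by simp
  have 3: "i < cut bs K" if "ticks bs i < K"
  proof (rule ccontr)
    assume "\<not> i < cut bs K"
    then have "ticks bs (cut bs K) \<le> ticks bs i" by (intro ticks_mono) simp
    then show False using 1 that by simp
  qed
  show ?thesis using 2 3 by blast
qed

lemma cut_le: "K \<le> ticks bs n \<Longrightarrow> cut bs K \<le> n"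
  unfolding cut_def by (rule Least_le)

lemma cut_mono:
  assumes "K \<le> K'" "K' \<le> ticks bs n" shows "cut bs K \<le> cut bs K'"
proof (rule cut_le)
  have "\<not> ticks bs (cut bs K') < K'" using less_cut_iff[OF assms(2), of "cut bs K'"] by simp
  then show "K \<le> ticks bs (cut bs K')" using assms by simp
qed

lemma ticks_cut:
  assumes "K \<le> ticks bs n" shows "ticks bs (cut bs K) = K"
proof -
  have 1: "K \<le> ticks bs (cut bs K)" using less_cut_iff[OF assms, of "cut bs K"] by simp
  show ?thesis
  proof (cases "cut bs K")
    case 0 then show ?thesis using 1 by simp
  next
    case (Suc i)
    then have "ticks bs i < K" using less_cut_iff[OF assms, of i] by simp
    then show ?thesis using ticks_Suc_le(1)[of bs i] 1 Suc by simp
  qed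
qed

locale chains = submod E f for E :: "'a set" and f +
  fixes bs :: "bool list" and L M :: nat
  assumes len: "length bs = card E" and L0: "0 < L"
begin

abbreviation "nE \<equiv> card E"

definition chain :: "'a set \<Rightarrow> nat \<Rightarrow> nat \<Rightarrow> 'a list \<Rightarrow> 'a list" where
  "chain C K q xs = picks f C (\<lambda>i. (ticks bs i - K) div L) xs (cut bs K) (cut bs (K + q * L))"

definition exceeding :: "('a \<Rightarrow> real) \<Rightarrow> nat \<Rightarrow> nat \<Rightarrow> 'a list \<Rightarrow> 'a set" where
  "exceeding h i g xs = {e \<in> set (drop i xs). \<forall>e'\<in>set (take g (drop i xs)). h e' < h e}"

definition fails :: "'a set \<Rightarrow> nat \<Rightarrow> nat \<Rightarrow> 'a list \<Rightarrow> nat \<Rightarrow> bool" where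
  "fails C K q xs j \<longleftrightarrow> M < card (exceeding (\<lambda>e. f (insert e (C \<union> set (take j (chain C K q xs)))))
      (cut bs (K + j * L)) (cut bs (K + Suc j * L) - cut bs (K + j * L)) xs)"

context
  fixes K q :: nat
  assumes Kq: "K + q * L \<le> ticks bs nE"
begin

lemma Kj: "j \<le> q \<Longrightarrow> K + j * L \<le> ticks bs nE"
proof -
  assume "j \<le> q"
  then have "j * L \<le> q * L" by simp
  then show ?thesis using Kq by linarith
qed

lemma window_iff:
  assumes "j < q"
  shows "cut bs K \<le> i \<and> i < cut bs (K + q * L) \<and> (ticks bs i - K) div L = j \<longleftrightarrow>
     cut bs (K + j * L) \<le> i \<and> i < cut bs (K + Suc j * L)"
proof -
  have a: "cut bs (K + l * L) \<le> i \<longleftrightarrow> K + l * L \<le> ticks bs i" if "l \<le> q" for l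
    using less_cut_iff[OF Kj[OF that], of i] by auto
  have b: "i < cut bs (K + l * L) \<longleftrightarrow> ticks bs i < K + l * L" if "l \<le> q" for l
    by (rule less_cut_iff[OF Kj[OF that]])
  have c: "Suc j * L \<le> q * L" using assms by (intro mult_le_mono1) simp
  have "(K \<le> ticks bs i \<and> ticks bs i < K + q * L \<and> (ticks bs i - K) div L = j) \<longleftrightarrow>
     (K + j * L \<le> ticks bs i \<and> ticks bs i < K + Suc j * L)"
  proof
    assume *: "K \<le> ticks bs i \<and> ticks bs i < K + q * L \<and> (ticks bs i - K) div L = j"
    then have "j * L \<le> ticks bs i - K" using div_times_less_eq_dividend[of "ticks bs i - K" L] by auto
    moreover have "ticks bs i - K < Suc j * L" using * dividend_less_div_times[of L "ticks bs i - K"] L0 by auto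
    ultimately show "K + j * L \<le> ticks bs i \<and> ticks bs i < K + Suc j * L" using * by linarith
  next
    assume *: "K + j * L \<le> ticks bs i \<and> ticks bs i < K + Suc j * L"
    then have "(ticks bs i - K) div L = j" by (intro div_nat_eqI) (auto simp: mult.commute)
    then show "K \<le> ticks bs i \<and> ticks bs i < K + q * L \<and> (ticks bs i - K) div L = j" using * c by linarith
  qed
  then show ?thesis using a[of j] b[of "Suc j"] a[of 0] b[of q] assms by simp
qed

lemma cut_window:
  assumes "j < q"
  shows "cut bs (K + j * L) < cut bs (K + Suc j * L)" "cut bs K \<le> cut bs (K + j * L)"
    "cut bs (K + Suc j * L) \<le> cut bs (K + q * L)" "cut bs (K + q * L) \<le> nE"
proof -
  show "cut bs (K + j * L) < cut bs (K + Suc j * L)"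
    using less_cut_iff[OF Kj, of "Suc j" "cut bs (K + j * L)"] ticks_cut[OF Kj, of j] assms L0 by simp
  show "cut bs K \<le> cut bs (K + j * L)" using assms by (intro cut_mono[OF _ Kj[of j]]) auto
  show "cut bs (K + Suc j * L) \<le> cut bs (K + q * L)" using assms by (intro cut_mono[OF _ Kq] add_left_mono mult_le_mono1) simp
  show "cut bs (K + q * L) \<le> nE" by (rule cut_le[OF Kq])
qed

lemma window_fun: "window_fun (\<lambda>i. (ticks bs i - K) div L) (cut bs K) (cut bs (K + q * L))"
proof
  have K: "K \<le> ticks bs nE" using Kq by simp
  show "(ticks bs (cut bs K) - K) div L = 0" using ticks_cut[OF K] by simp
  fix i assume i: "cut bs K \<le> i" "Suc i < cut bs (K + q * L)"
  have "K \<le> ticks bs i" using less_cut_iff[OF K, of i] i by simp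
  then have *: "ticks bs (Suc i) - K \<le> Suc (ticks bs i - K)" "ticks bs i - K \<le> ticks bs (Suc i) - K"
    using ticks_Suc_le[of bs i] by linarith+
  have "(ticks bs (Suc i) - K) div L \<le> (ticks bs i - K + L) div L" using * L0 by (intro div_le_mono) linarith
  also have "\<dots> = Suc ((ticks bs i - K) div L)" using L0 by simp
  finally show "(ticks bs i - K) div L \<le> (ticks bs (Suc i) - K) div L \<and>
      (ticks bs (Suc i) - K) div L \<le> Suc ((ticks bs i - K) div L)"
    using div_le_mono[OF *(2)] by blast
qed

lemma length_chain: "length (chain C K q xs) = q"
proof (cases q)
  case 0 then show ?thesis by (simp add: chain_def picks_before)
next
  case (Suc j)
  then have j: "j < q" by simp
  interpret w: window_fun "\<lambda>i. (ticks bs i - K) div L" "cut bs K" "cut bs (K + q * L)" by (rule window_fun)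
  have c: "cut bs K \<le> cut bs (K + q * L)" "cut bs (K + q * L) \<noteq> cut bs K"
    using cut_window[OF j] by auto
  have "cut bs (K + j * L) \<le> cut bs (K + q * L) - 1 \<and> cut bs (K + q * L) - 1 < cut bs (K + Suc j * L)"
    using cut_window[OF j] Suc by auto
  then have "(ticks bs (cut bs (K + q * L) - 1) - K) div L = j" using window_iff[OF j, of "cut bs (K + q * L) - 1"] by blast
  then show ?thesis unfolding chain_def using w.length_picks[OF c(1)] c(2) Suc by simp
qed

lemma chain_nth:
  assumes "j < q"
  shows "\<exists>i. cut bs (K + j * L) \<le> i \<and> i < cut bs (K + Suc j * L) \<and> chain C K q xs ! j = xs ! i"
proof -
  interpret w: window_fun "\<lambda>i. (ticks bs i - K) div L" "cut bs K" "cut bs (K + q * L)" by (rule window_fun)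
  have c: "cut bs K \<le> cut bs (K + q * L)" using cut_window[OF assms] by auto
  obtain i where "cut bs K \<le> i" "i < cut bs (K + q * L)" "(ticks bs i - K) div L = j" "chain C K q xs ! j = xs ! i"
    using w.picks_props(1)[OF c, of j f C xs] assms length_chain[of C xs] unfolding chain_def by auto
  then show ?thesis using window_iff[OF assms, of i] by blast
qed

lemma chain_nth_max:
  fixes C :: "'a set" and xs :: "'a list"
  assumes "j < q" "cut bs (K + j * L) \<le> i" "i < cut bs (K + Suc j * L)"
  defines "p \<equiv> chain C K q xs"
  shows "f (insert (xs ! i) (C \<union> set (take j p))) \<le> f (insert (p ! j) (C \<union> set (take j p)))"
proof -
  interpret w: window_fun "\<lambda>i. (ticks bs i - K) div L" "cut bs K" "cut bs (K + q * L)" by (rule window_fun)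
  have c: "cut bs K \<le> cut bs (K + q * L)" using cut_window[OF assms(1)] by auto
  have "cut bs K \<le> i" "i < cut bs (K + q * L)" "(ticks bs i - K) div L = j" using window_iff[OF assms(1), of i] assms by auto
  then show ?thesis using w.picks_props(2)[OF c, of i f C xs] unfolding p_def chain_def by auto
qed

lemma set_chain:
  assumes "xs \<in> permutations_of_set E"
  shows "set (chain C K q xs) \<subseteq> set (take (cut bs (K + q * L) - cut bs K) (drop (cut bs K) xs))"
proof
  fix e assume "e \<in> set (chain C K q xs)"
  then obtain j where j: "j < q" "e = chain C K q xs ! j" using length_chain by (metis in_set_conv_nth)
  obtain i where i: "cut bs (K + j * L) \<le> i" "i < cut bs (K + Suc j * L)" "e = xs ! i"
    using chain_nth[OF j(1), of C xs] j(2) by auto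
  have lx: "length xs = nE" using assms by (rule length_finite_permutations_of_set)
  have i': "cut bs K \<le> i" "i < cut bs (K + q * L)" "i < nE" using i cut_window[OF j(1)] by auto
  then have "take (cut bs (K + q * L) - cut bs K) (drop (cut bs K) xs) ! (i - cut bs K) = e"
    using i lx by simp
  moreover have "i - cut bs K < length (take (cut bs (K + q * L) - cut bs K) (drop (cut bs K) xs))"
    using i' lx by auto
  ultimately show "e \<in> set (take (cut bs (K + q * L) - cut bs K) (drop (cut bs K) xs))" by (metis nth_mem)
qed

text \<open>The picks preceding window j depend only on the stream up to its start. This makes the
  criterion of \<open>window_fail\<close> a function of the prefix.\<close>

lemma take_chain:
  assumes "j < q"
  shows "take j (chain C K q xs) = take j (picks f C (\<lambda>i. (ticks bs i - K) div L) (take (cut bs (K + j * L)) xs) (cut bs K) (cut bs (K + j * L)))"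
proof -
  interpret w: window_fun "\<lambda>i. (ticks bs i - K) div L" "cut bs K" "cut bs (K + q * L)" by (rule window_fun)
  have c: "cut bs K \<le> cut bs (K + j * L)" "cut bs (K + j * L) < cut bs (K + q * L)" using cut_window[OF assms] by auto
  have "(ticks bs (cut bs (K + j * L)) - K) div L = j" using ticks_cut[OF Kj, of j] assms L0 by simp
  then have "take j (chain C K q xs) = take j (picks f C (\<lambda>i. (ticks bs i - K) div L) xs (cut bs K) (cut bs (K + j * L)))"
    unfolding chain_def using c by (intro w.take_picks) auto
  also have "picks f C (\<lambda>i. (ticks bs i - K) div L) xs (cut bs K) (cut bs (K + j * L))
    = picks f C (\<lambda>i. (ticks bs i - K) div L) (take (cut bs (K + j * L)) xs) (cut bs K) (cut bs (K + j * L))"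
    by (rule picks_cong) simp
  finally show ?thesis .
qed

lemma chain_cong_prefix:
  assumes "\<And>i. i < cut bs (K + q * L) \<Longrightarrow> xs ! i = ys ! i"
  shows "chain C K q xs = chain C K q ys"
  unfolding chain_def by (rule picks_cong) (rule assms)

text \<open>The base set may depend on the stream, as the core does, but only on the part before
  tick K; with \<open>take_chain\<close> the criterion is then settled before the window is
  drawn.\<close>

lemma fails_prob:
  assumes j: "j < q" and C: "\<And>xs. C xs = C (take (cut bs K) xs)" and M: "M \<le> nE"
  shows "perm_avg E (\<lambda>xs. of_bool (fails (C xs) K q xs j))
     \<le> (1 - M / nE) ^ (cut bs (K + Suc j * L) - cut bs (K + j * L))"
proof -
  define al where "al = cut bs (K + j * L)"
  define g where "g = cut bs (K + Suc j * L) - al"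
  have alg: "cut bs K \<le> al" "al + g \<le> nE" "0 < nE" using cut_window[OF j] unfolding al_def g_def by auto
  define h where "h ys e = f (insert e (C ys \<union> set (take j (picks f (C ys) (\<lambda>i. (ticks bs i - K) div L) ys (cut bs K) al))))" for ys e
  have Ct: "C (take al xs) = C xs" for xs
    using C[of "take al xs"] C[of xs] alg by (simp add: min_def)
  have "fails (C xs) K q xs j \<longleftrightarrow> M < card {e \<in> set (drop al xs). \<forall>e'\<in>set (take g (drop al xs)). h (take al xs) e' < h (take al xs) e}" for xs
    unfolding fails_def exceeding_def h_def Ct take_chain[OF j] al_def[symmetric] g_def[symmetric] ..
  then show ?thesis using window_fail[OF fin alg(3,2) M, of h] unfolding al_def[symmetric] g_def[symmetric] by simp
qed

text \<open>Let i be the window of the smallest increment up to level g. An element passing at g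
  beats that increment, and by submodularity it does so already over the first i picks. So it beats
  all of window i: a single window accounts for all elements passing at this level.\<close>

lemma card_passes_le:
  assumes xs: "xs \<in> permutations_of_set E" and C: "C \<subseteq> set (take (cut bs K) xs)" and g: "g < q"
    and ok: "\<And>j. j < q \<Longrightarrow> \<not> fails C K q xs j"
  shows "card {e \<in> set (drop (cut bs (K + q * L)) xs). passes f {g} C (chain C K q xs) e} \<le> M"
proof -
  define p where "p = chain C K q xs"
  define ga where "ga = gain f C p"
  obtain i where i: "i \<le> g" "\<And>l. l \<le> g \<Longrightarrow> ga i \<le> ga l"
  proof -
    have "Min (ga ` {..g}) \<in> ga ` {..g}" by (intro Min_in) auto
    then obtain i where "i \<le> g" "ga i = Min (ga ` {..g})" by (metis atMost_iff imageE)
    moreover have "Min (ga ` {..g}) \<le> ga l" if "l \<le> g" for l using that by (intro Min_le) auto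
    ultimately show thesis using that by metis
  qed
  have iq: "i < q" using i g by simp
  have dist: "distinct xs" and sx: "set xs = E" and lx: "length xs = nE"
    using xs length_finite_permutations_of_set[OF xs] by (auto simp: permutations_of_set_def)
  define al where "al = cut bs (K + i * L)"
  define be where "be = cut bs (K + Suc i * L)"
  have cuts: "al < be" "be \<le> cut bs (K + q * L)" "cut bs (K + q * L) \<le> nE"
    using cut_window[OF iq] by (auto simp: al_def be_def)
  let ?h = "\<lambda>e. f (insert e (C \<union> set (take i p)))"
  have before: "C \<union> set p \<subseteq> set (take (cut bs (K + q * L)) xs)"
  proof -
    have c: "cut bs K \<le> cut bs (K + q * L)" using cut_window[OF iq] by auto
    have "set (take (cut bs (K + q * L) - cut bs K) (drop (cut bs K) xs)) \<subseteq> set (take (cut bs (K + q * L)) xs)"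
    proof -
      have "take (cut bs (K + q * L) - cut bs K) (drop (cut bs K) xs) = drop (cut bs K) (take (cut bs (K + q * L)) xs)"
        by (simp add: drop_take)
      then show ?thesis by (metis set_drop_subset)
    qed
    moreover have "set (take (cut bs K) xs) \<subseteq> set (take (cut bs (K + q * L)) xs)" using c by (rule set_take_subset_set_take)
    ultimately show ?thesis using C set_chain[OF xs, of C] unfolding p_def by blast
  qed
  have disj: "set (take (cut bs (K + q * L)) xs) \<inter> set (drop (cut bs (K + q * L)) xs) = {}"
    using dist by (rule set_take_disj_set_drop_if_distinct) simp
  have "{e \<in> set (drop (cut bs (K + q * L)) xs). passes f {g} C p e} \<subseteq> exceeding ?h al (be - al) xs"
  proof
    fix e assume "e \<in> {e \<in> set (drop (cut bs (K + q * L)) xs). passes f {g} C p e}"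
    then have e: "e \<in> set (drop (cut bs (K + q * L)) xs)" "passes f {g} C p e" by auto
    then obtain l where l: "l \<le> g" "ga l < f (insert e (C \<union> set (take g p))) - f (C \<union> set (take g p))"
      unfolding passes_def ga_def by auto
    have eE: "e \<in> E" using e(1) sx by (meson in_set_dropD)
    have eC: "e \<notin> C \<union> set p" using before disj e(1) by blast
    have CE: "C \<union> set p \<subseteq> E" using before sx by (meson in_set_takeD subset_iff)
    have tg: "set (take i p) \<subseteq> set (take g p)" using i(1) by (rule set_take_subset_set_take)
    have tp: "set (take g p) \<subseteq> set p" by (rule set_take_subset)
    have "f (insert e (C \<union> set (take g p))) - f (C \<union> set (take g p)) \<le> f (insert e (C \<union> set (take i p))) - f (C \<union> set (take i p))"
      by (rule marginal_antimono) (use tg tp CE eC eE in auto)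
    moreover have "ga i = f (insert (p ! i) (C \<union> set (take i p))) - f (C \<union> set (take i p))"
      unfolding ga_def gain_def using iq length_chain[of C xs] by (simp add: p_def take_Suc_conv_app_nth)
    ultimately have lt: "?h (p ! i) < ?h e" using l i(2)[OF l(1)] by linarith
    have "?h e' < ?h e" if e': "e' \<in> set (take (be - al) (drop al xs))" for e'
    proof -
      obtain x where x: "x < be - al" "e' = xs ! (al + x)"
        using e' cuts lx by (auto simp: in_set_conv_nth)
      have "?h (xs ! (al + x)) \<le> ?h (p ! i)" unfolding p_def
        by (rule chain_nth_max[OF iq]) (use x in \<open>auto simp: al_def be_def\<close>)
      then show ?thesis using lt x by simp
    qed
    moreover have "e \<in> set (drop al xs)" using e(1) set_drop_subset_set_drop[of al "cut bs (K + q * L)" xs] cuts by auto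
    ultimately show "e \<in> exceeding ?h al (be - al) xs" unfolding exceeding_def by auto
  qed
  moreover have "finite (exceeding ?h al (be - al) xs)" unfolding exceeding_def by simp
  ultimately have "card {e \<in> set (drop (cut bs (K + q * L)) xs). passes f {g} C p e} \<le> card (exceeding ?h al (be - al) xs)"
    by (intro card_mono)
  also have "\<dots> \<le> M" using ok[OF iq] unfolding fails_def p_def al_def be_def by simp
  finally show ?thesis unfolding p_def .
qed

end

end

section \<open>The state machine and the closed form of its runs\<close>

type_synonym 'a state = "nat \<times> 'a list \<times> 'a set \<times> 'a set \<times> 'a list"

locale machine =
  fixes k L K2 m M h :: nat
  assumes k0: "0 < k" and L0: "0 < L" and K12: "k * L \<le> K2" and mk: "m \<le> k" "86 \<le> k \<Longrightarrow> m < k"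
begin

definition K3 :: nat where "K3 = K2 + (k - m) * L"
definition G :: "nat set" where "G = levels h k"
text \<open>A share of M for each level of the first chain, and one for the single level of the
  second.\<close>

definition cap :: nat where "cap = (card G + 1) * M"

text \<open>A state consists of the tick count, the first chain, the elements saved, the best of them at tick
  \<open>K2\<close>, and the second chain. The subtraction of \<open>0\<close> makes the first chain an instance of
  \<open>chain\<close> syntactically.\<close>

definition step :: "('a set \<Rightarrow> real) \<Rightarrow> bool \<Rightarrow> 'a \<Rightarrow> 'a state \<Rightarrow> 'a state" where
  "step f b e = (\<lambda>(t, p, H, A, r).
     (let p' = (if t < k * L then upd f {} ((t - 0) div L) e p else p);
          H' = (if k * L \<le> t \<and> card H < cap \<and> (passes f G {} p e \<or> (86 \<le> k \<and> K3 \<le> t \<and> passes f {k - m - 1} A r e))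
                then insert e H else H);
          r' = (if K2 \<le> t \<and> t < K3 then upd f A ((t - K2) div L) e r else r);
          t' = (if b \<and> t < K3 then Suc t else t);
          A' = (if t < K2 \<and> t' = K2 then pick_best f m H' else A)
      in (t', p', H', A', r')))"

definition init :: "'a state" where "init = (0, [], {}, {}, [])"

definition run :: "('a set \<Rightarrow> real) \<Rightarrow> bool list \<Rightarrow> 'a list \<Rightarrow> 'a state" where
  "run f bs xs = foldl (\<lambda>s (b, e). step f b e s) init (zip bs xs)"

definition carrier :: "'a state \<Rightarrow> 'a set" where
  "carrier = (\<lambda>(t, p, H, A, r). set p \<union> H \<union> A \<union> set r)"

end

locale coin_run = machine k L K2 m M h + chains E f bs L M
  for k L K2 m M h and E :: "'a set" and f bs +
  assumes K3: "machine.K3 k L K2 m \<le> ticks bs (card E)"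
begin

definition n1 where "n1 = cut bs (k * L)"
definition n2 where "n2 = cut bs K2"
definition n3 where "n3 = cut bs K3"

lemma K_le: "k * L \<le> ticks bs nE" "K2 \<le> ticks bs nE" "K3 \<le> ticks bs nE" "K2 \<le> K3" "0 + k * L \<le> ticks bs nE"
  "K2 + (k - m) * L \<le> ticks bs nE"
  using K3 K12 by (auto simp: K3_def)

lemma n_le: "n1 \<le> n2" "n2 \<le> n3" "n3 \<le> nE" "0 < n1"
proof -
  show "n1 \<le> n2" "n2 \<le> n3" unfolding n1_def n2_def n3_def using K_le K12 cut_mono by blast+
  show "n3 \<le> nE" unfolding n3_def by (rule cut_le[OF K_le(3)])
  show "0 < n1" unfolding n1_def using less_cut_iff[OF K_le(1), of 0] k0 L0 by simp
qed

lemma less_n: "i < n1 \<longleftrightarrow> ticks bs i < k * L" "i < n2 \<longleftrightarrow> ticks bs i < K2" "i < n3 \<longleftrightarrow> ticks bs i < K3"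
  unfolding n1_def n2_def n3_def using less_cut_iff K_le by blast+

definition ch1 :: "'a list \<Rightarrow> 'a list" where "ch1 = chain {} 0 k"

text \<open>The offline description of register A after tick \<open>K2\<close>, taken from all
  passing elements of the block, with the cap disregarded.\<close>

definition core :: "'a list \<Rightarrow> 'a set" where
  "core xs = pick_best f m {e \<in> set (take (n2 - n1) (drop n1 xs)). passes f G {} (ch1 xs) e}"

definition ch2 :: "'a list \<Rightarrow> 'a list" where "ch2 xs = chain (core xs) K2 (k - m) xs"

definition saves :: "'a list \<Rightarrow> nat \<Rightarrow> bool" where
  "saves xs j \<longleftrightarrow> n1 \<le> j \<and> (passes f G {} (ch1 xs) (xs ! j) \<or>
      (86 \<le> k \<and> n3 \<le> j \<and> passes f {k - m - 1} (core xs) (ch2 xs) (xs ! j)))"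

definition saved :: "'a list \<Rightarrow> nat \<Rightarrow> 'a set" where
  "saved xs i = (\<lambda>j. xs ! j) ` {j. j < i \<and> saves xs j}"

lemma saved_n2: "xs \<in> permutations_of_set E \<Longrightarrow> saved xs n2 = {e \<in> set (take (n2 - n1) (drop n1 xs)). passes f G {} (ch1 xs) e}"
proof -
  assume xs: "xs \<in> permutations_of_set E"
  have lx: "length xs = nE" using xs by (rule length_finite_permutations_of_set)
  have "set (take (n2 - n1) (drop n1 xs)) = (\<lambda>j. xs ! j) ` {n1..<n2}"
  proof -
    have "take (n2 - n1) (drop n1 xs) = map (\<lambda>j. xs ! j) [n1..<n2]"
      using n_le lx by (intro nth_equalityI) auto
    then show ?thesis by simp
  qed
  then show ?thesis using n_le unfolding saved_def saves_def by (auto simp: not_le)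
qed

text \<open>The registers follow the offline description as long as the cap does not interfere, and
  it cannot interfere if the final number of saved elements respects it. The minima express that
  counter and picks stop at their last tick.\<close>

lemma run_closed:
  assumes xs: "xs \<in> permutations_of_set E" and cap: "card (saved xs nE) \<le> cap"
  shows "i \<le> nE \<Longrightarrow> run f (take i bs) (take i xs) =
    (min (ticks bs i) K3, picks f {} (\<lambda>i. (ticks bs i - 0) div L) xs (cut bs 0) (min i n1), saved xs i, if i < n2 then {} else core xs,
     picks f (core xs) (\<lambda>i. (ticks bs i - K2) div L) xs n2 (min i n3))"
proof (induction i)
  case 0
  then show ?case using n_le by (simp add: run_def init_def saved_def)
next
  case (Suc i)
  then have i: "i < nE" by simp
  have lx: "length xs = nE" using xs by (rule length_finite_permutations_of_set)
  have dist: "distinct xs" using xs by (simp add: permutations_of_set_def)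
  have "zip (take (Suc i) bs) (take (Suc i) xs) = zip (take i bs) (take i xs) @ [(bs ! i, xs ! i)]"
    using i lx len by (simp add: take_Suc_conv_app_nth)
  then have run: "run f (take (Suc i) bs) (take (Suc i) xs) = step f (bs ! i) (xs ! i) (run f (take i bs) (take i xs))"
    by (simp add: run_def)
  define p where "p = picks f {} (\<lambda>i. (ticks bs i - 0) div L) xs (cut bs 0) (min i n1)"
  define r where "r = picks f (core xs) (\<lambda>i. (ticks bs i - K2) div L) xs n2 (min i n3)"
  define A where "A = (if i < n2 then {} else core xs)"
  define t where "t = min (ticks bs i) K3"
  have IH: "run f (take i bs) (take i xs) = (t, p, saved xs i, A, r)" using Suc unfolding t_def p_def A_def r_def by simp
  have t1: "t < k * L \<longleftrightarrow> i < n1" "k * L \<le> t \<longleftrightarrow> n1 \<le> i" and t2: "t < K2 \<longleftrightarrow> i < n2" "K2 \<le> t \<longleftrightarrow> n2 \<le> i"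
    and t3: "t < K3 \<longleftrightarrow> i < n3" "K3 \<le> t \<longleftrightarrow> n3 \<le> i"
    using less_n[of i] K12 K_le(4) by (auto simp: t_def)
  have pn: "p = ch1 xs" if "n1 \<le> i" using that unfolding p_def ch1_def chain_def n1_def by (simp add: min_def)
  have rn: "r = ch2 xs" if "n3 \<le> i" using that unfolding r_def ch2_def chain_def n2_def n3_def K3_def by (simp add: min_def)
  have p': "(if t < k * L then upd f {} ((t - 0) div L) (xs ! i) p else p) = picks f {} (\<lambda>i. (ticks bs i - 0) div L) xs (cut bs 0) (min (Suc i) n1)"
  proof (cases "i < n1")
    case True
    then have "i < n3" using n_le by simp
    then have "t = ticks bs i" using t3 by (simp add: t_def)
    then show ?thesis using True t1 by (simp add: p_def min_def)
  next
    case False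
    then show ?thesis using t1 by (simp add: p_def min_def)
  qed
  have saved_Suc: "saved xs (Suc i) = (if saves xs i then insert (xs ! i) (saved xs i) else saved xs i)"
  proof -
    have "{j. j < Suc i \<and> saves xs j} = (if saves xs i then insert i {j. j < i \<and> saves xs j} else {j. j < i \<and> saves xs j})"
      by (auto simp: less_Suc_eq)
    then show ?thesis unfolding saved_def by simp
  qed
  have fin_saved: "finite (saved xs j)" for j unfolding saved_def by simp
  have H': "(if k * L \<le> t \<and> card (saved xs i) < cap \<and> (passes f G {} p (xs ! i) \<or> (86 \<le> k \<and> K3 \<le> t \<and> passes f {k - m - 1} A r (xs ! i)))
                then insert (xs ! i) (saved xs i) else saved xs i) = saved xs (Suc i)"
  proof -
    have s: "saves xs i \<longleftrightarrow> k * L \<le> t \<and> (passes f G {} p (xs ! i) \<or> (86 \<le> k \<and> K3 \<le> t \<and> passes f {k - m - 1} A r (xs ! i)))"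
    proof (cases "n1 \<le> i")
      case True
      have "A = core xs" if "n3 \<le> i" using that n_le by (simp add: A_def)
      then show ?thesis using True pn rn t1 t3 unfolding saves_def by auto
    qed (use t1 in \<open>auto simp: saves_def\<close>)
    \<comment> \<open>The arriving element is new because the order has no repetitions; saving it
      with the cap already reached would push the final number beyond the cap.\<close>
    have lt: "card (saved xs i) < cap" if "saves xs i"
    proof -
      have "xs ! i \<notin> saved xs i" unfolding saved_def using dist i lx by (auto simp: nth_eq_iff_index_eq)
      then have "card (saved xs (Suc i)) = Suc (card (saved xs i))" using that saved_Suc fin_saved by simp
      moreover have "saved xs (Suc i) \<subseteq> saved xs nE" unfolding saved_def using i by (intro image_mono) auto
      then have "card (saved xs (Suc i)) \<le> card (saved xs nE)" by (intro card_mono fin_saved)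
      ultimately show ?thesis using cap by simp
    qed
    have "(k * L \<le> t \<and> card (saved xs i) < cap \<and> (passes f G {} p (xs ! i) \<or> (86 \<le> k \<and> K3 \<le> t \<and> passes f {k - m - 1} A r (xs ! i)))) = saves xs i"
    proof (cases "saves xs i")
      case True
      then show ?thesis using s lt[OF True] by (simp only: simp_thms)
    next
      case False
      then show ?thesis using s by argo
    qed
    then show ?thesis unfolding saved_Suc by (simp only:)
  qed
  have r': "(if K2 \<le> t \<and> t < K3 then upd f A ((t - K2) div L) (xs ! i) r else r)
     = picks f (core xs) (\<lambda>i. (ticks bs i - K2) div L) xs n2 (min (Suc i) n3)"
  proof (cases "n2 \<le> i \<and> i < n3")
    case True
    then have "t = ticks bs i" using t3 by (simp add: t_def)
    then show ?thesis using True t2 t3 by (simp add: r_def A_def min_def)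
  next
    case False
    show ?thesis
    proof (cases "n3 \<le> i")
      case True then show ?thesis using t3 by (simp add: r_def min_def)
    next
      case F: False
      then have "i < n2" using False by simp
      then show ?thesis using t2 n_le by (simp add: r_def picks_before)
    qed
  qed
  have t': "(if bs ! i \<and> t < K3 then Suc t else t) = min (ticks bs (Suc i)) K3"
    using ticks_Suc[of i bs] i len by (auto simp: t_def min_def)
  have A': "(if t < K2 \<and> min (ticks bs (Suc i)) K3 = K2 then pick_best f m (saved xs (Suc i)) else A) = (if Suc i < n2 then {} else core xs)"
  proof (cases "i < n2")
    case False then show ?thesis using t2 by (simp add: A_def)
  next
    case True
    have "ticks bs i < K2" using True less_n(2) by simp
    then have "min (ticks bs (Suc i)) K3 = K2 \<longleftrightarrow> \<not> ticks bs (Suc i) < K2" using ticks_Suc_le(1)[of bs i] K_le(4) by (auto simp: min_def)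
    then have e: "min (ticks bs (Suc i)) K3 = K2 \<longleftrightarrow> \<not> Suc i < n2" using less_n(2)[of "Suc i"] by simp
    show ?thesis
    proof (cases "Suc i < n2")
      case True then show ?thesis using e by (simp add: A_def)
    next
      case False
      then have "Suc i = n2" using True by simp
      then have "pick_best f m (saved xs (Suc i)) = core xs" using saved_n2[OF xs] by (simp add: core_def)
      then show ?thesis using e False True t2 by simp
    qed
  qed
  show ?case unfolding run IH step_def Let_def prod.case t' p' H' r' A' ..
qed

end

section \<open>Guarantees for fixed coins, averaged over the order\<close>

section \<open>Approximation ratio for fixed coins\<close>


context machine
begin

text \<open>Bounds that hold along every run, whatever the coins and the order; the buffer guarantee
  rests on them and not on \<open>ok\<close>. The inclusion of A in H makes the core part of the
  saved elements.\<close>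

definition wf :: "'a state \<Rightarrow> bool" where
  "wf = (\<lambda>(t, p, H, A, r). t \<le> K3 \<and> length p \<le> k \<and> length r \<le> k \<and> finite H \<and> card H \<le> cap \<and> A \<subseteq> H)"

lemma wf_init: "wf init"
  by (simp add: wf_def init_def)

lemma set_upd: "set (upd f C j e p) \<subseteq> insert e (set p)"
  unfolding upd_def using set_update_subset_insert[of p j e] by auto

lemma length_upd: "length p \<le> k \<Longrightarrow> j < k \<Longrightarrow> length (upd f C j e p) \<le> k"
  unfolding upd_def by auto

lemma step_wf:
  assumes "wf s"
  shows "wf (step f b e s) \<and> carrier (step f b e s) \<subseteq> insert e (carrier s)"
proof -
  obtain t p H A r where s: "s = (t, p, H, A, r)" by (cases s) auto
  have w: "t \<le> K3" "length p \<le> k" "length r \<le> k" "finite H" "card H \<le> cap" "A \<subseteq> H"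
    using assms by (auto simp: wf_def s)
  obtain t' p' H' A' r' where s': "step f b e s = (t', p', H', A', r')" by (cases "step f b e s") auto
  have t': "t' = (if b \<and> t < K3 then Suc t else t)"
    and p': "p' = (if t < k * L then upd f {} ((t - 0) div L) e p else p)"
    and H': "H' = (if k * L \<le> t \<and> card H < cap \<and> (passes f G {} p e \<or> (86 \<le> k \<and> K3 \<le> t \<and> passes f {k - m - 1} A r e))
                then insert e H else H)"
    and r': "r' = (if K2 \<le> t \<and> t < K3 then upd f A ((t - K2) div L) e r else r)"
    and A': "A' = (if t < K2 \<and> t' = K2 then pick_best f m H' else A)"
    using s' unfolding s step_def Let_def by auto
  have lp: "length p' \<le> k"
    unfolding p' using w(2) L0 by (auto intro!: length_upd simp: less_mult_imp_div_less)
  have lr: "length r' \<le> k"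
  proof (cases "K2 \<le> t \<and> t < K3")
    case True
    then have "t - K2 < (k - m) * L" unfolding K3_def by linarith
    then have "(t - K2) div L < k - m" by (rule less_mult_imp_div_less)
    then have "(t - K2) div L < k" by simp
    then show ?thesis unfolding r' using w(3) length_upd True by simp
  qed (use w in \<open>auto simp: r'\<close>)
  have fH: "finite H'" using w by (simp add: H')
  have cH: "card H' \<le> cap" using w by (auto simp: H' card_insert_if)
  have HH: "H' \<subseteq> insert e H" "H \<subseteq> H'" by (auto simp: H')
  have AH: "A' \<subseteq> H'"
  proof (cases "t < K2 \<and> t' = K2")
    case True then show ?thesis using pick_best(1)[OF fH] by (simp add: A')
  next
    case False
    then have "A' = A" unfolding A' by (rule if_not_P)
    then show ?thesis using w HH by blast
  qed
  have "t' \<le> K3" using w by (auto simp: t')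
  then have "wf (step f b e s)" using lp lr fH cH AH unfolding wf_def s' by simp
  moreover have "set p' \<subseteq> insert e (set p)" unfolding p' using set_upd[of f "{}"] by auto
  moreover have "set r' \<subseteq> insert e (set r)" unfolding r' using set_upd[of f A] by auto
  moreover have "carrier (step f b e s) = set p' \<union> H' \<union> A' \<union> set r'" unfolding s' carrier_def by simp
  moreover have "carrier s = set p \<union> H \<union> A \<union> set r" unfolding s carrier_def by simp
  ultimately show ?thesis using AH HH by (simp only: simp_thms) blast
qed

lemma run_wf: "wf (run f bs xs) \<and> carrier (run f bs xs) \<subseteq> set xs"
proof -
  have "wf s \<Longrightarrow> wf (foldl (\<lambda>s (b, e). step f b e s) s zs) \<and>
      carrier (foldl (\<lambda>s (b, e). step f b e s) s zs) \<subseteq> carrier s \<union> snd ` set zs" for s zs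
  proof (induction zs arbitrary: s)
    case Nil then show ?case by simp
  next
    case (Cons z zs)
    obtain b e where z: "z = (b, e)" by (cases z)
    have st: "wf (step f b e s)" "carrier (step f b e s) \<subseteq> insert e (carrier s)" using step_wf[OF Cons.prems] by auto
    show ?case using Cons.IH[OF st(1)] st(2) unfolding z by auto
  qed
  from this[OF wf_init, of "zip bs xs"] have "wf (run f bs xs) \<and> carrier (run f bs xs) \<subseteq> carrier init \<union> snd ` set (zip bs xs)"
    unfolding run_def .
  moreover have "snd ` set (zip bs xs) \<subseteq> set xs" by (auto dest: set_zip_rightD)
  moreover have "carrier init = {}" by (simp add: carrier_def init_def)
  ultimately show ?thesis by (metis Un_empty_left subset_trans)
qed

lemma G_levels: "finite G" "k - 1 \<in> G" "g \<in> G \<Longrightarrow> g < k"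
  using k0 by (auto simp: G_def levels_def)

end

context coin_run
begin

definition ok :: "'a list \<Rightarrow> bool" where
  "ok xs \<longleftrightarrow> (\<forall>j<k. \<not> fails {} 0 k xs j) \<and> (\<forall>j<k - m. \<not> fails (core xs) K2 (k - m) xs j)"

definition stored :: "'a list \<Rightarrow> 'a set" where
  "stored xs = set (ch1 xs) \<union> saved xs nE \<union> core xs \<union> set (ch2 xs)"

definition V :: "'a list \<Rightarrow> real" where
  "V xs = f (pick_best f k (carrier (run f bs xs)))"

lemma perm_facts:
  assumes "xs \<in> permutations_of_set E"
  shows "length xs = nE" "distinct xs" "set xs = E"
  using assms length_finite_permutations_of_set[OF assms] by (auto simp: permutations_of_set_def)

lemma core_sub: "core xs \<subseteq> set (take (n2 - n1) (drop n1 xs))" "card (core xs) \<le> m"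
  "core xs \<subseteq> {e. passes f G {} (ch1 xs) e}"
  using pick_best(1,2)[of "{e \<in> set (take (n2 - n1) (drop n1 xs)). passes f G {} (ch1 xs) e}" f m]
  unfolding core_def by auto

lemma core_before: "core xs \<subseteq> set (take n2 xs)"
proof -
  have "take (n2 - n1) (drop n1 xs) = drop n1 (take n2 xs)" by (simp add: drop_take)
  then show ?thesis using core_sub(1) by (metis set_drop_subset subset_trans)
qed

lemma ch1_sub: "xs \<in> permutations_of_set E \<Longrightarrow> set (ch1 xs) \<subseteq> set (take n1 xs)"
  using set_chain[OF K_le(5), of xs "{}"] unfolding ch1_def n1_def by simp

lemma ch2_sub: "xs \<in> permutations_of_set E \<Longrightarrow> set (ch2 xs) \<subseteq> set (take (n3 - n2) (drop n2 xs))"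
  using set_chain[OF K_le(6), of xs "core xs"] unfolding ch2_def n2_def n3_def K3_def by simp

lemma length_ch: "length (ch1 xs) = k" "length (ch2 xs) = k - m"
  using length_chain[OF K_le(5), of "{}" xs] length_chain[OF K_le(6), of "core xs" xs] unfolding ch1_def ch2_def by simp_all

lemma saved_card:
  assumes xs: "xs \<in> permutations_of_set E" and ok: "ok xs"
  shows "card (saved xs nE) \<le> cap"
proof -
  let ?X = "\<lambda>g. {e \<in> set (drop n1 xs). passes f {g} {} (ch1 xs) e}"
  define Y where "Y = (if 86 \<le> k then {e \<in> set (drop n3 xs). passes f {k - m - 1} (core xs) (ch2 xs) e} else {})"
  note [simp] = perm_facts[OF xs]
  have "saved xs nE \<subseteq> (\<Union>g\<in>G. ?X g) \<union> Y"
  proof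
    fix e assume "e \<in> saved xs nE"
    then obtain j where j: "j < nE" "saves xs j" "e = xs ! j" unfolding saved_def by auto
    have in_drop: "e \<in> set (drop i xs)" if "i \<le> j" for i
    proof -
      have "e = drop i xs ! (j - i)" using that j by simp
      moreover have "j - i < length (drop i xs)" using that j by simp
      ultimately show ?thesis by (metis nth_mem)
    qed
    show "e \<in> (\<Union>g\<in>G. ?X g) \<union> Y"
    proof (cases "passes f G {} (ch1 xs) e")
      case True
      then obtain g where "g \<in> G" "passes f {g} {} (ch1 xs) e" unfolding passes_def by auto
      then show ?thesis using in_drop[of n1] j by (auto simp: saves_def)
    next
      case False
      then show ?thesis using in_drop[of n3] j by (auto simp: saves_def Y_def)
    qed
  qed
  moreover have "card (?X g) \<le> M" if "g \<in> G" for g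
    using card_passes_le[OF K_le(5) xs, of "{}" g] ok G_levels(3)[OF that] unfolding ok_def n1_def ch1_def by simp
  then have "card (\<Union>g\<in>G. ?X g) \<le> card G * M"
    using card_UN_le[OF G_levels(1), of ?X] sum_bounded_above[of G "\<lambda>g. card (?X g)" M] by simp
  moreover have "card Y \<le> M"
  proof (cases "86 \<le> k")
    case True
    then have "k - m - 1 < k - m" using mk by simp
    then show ?thesis using card_passes_le[OF K_le(6) xs, of "core xs" "k - m - 1"] core_before ok True
      unfolding ok_def n2_def[symmetric] ch2_def[symmetric] n3_def K3_def Y_def by (simp add: n2_def)
  qed (simp add: Y_def)
  moreover have "finite ((\<Union>g\<in>G. ?X g) \<union> Y)" using G_levels(1) by (simp add: Y_def)
  ultimately have "card (saved xs nE) \<le> card G * M + M"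
    using card_mono[of "(\<Union>g\<in>G. ?X g) \<union> Y" "saved xs nE"] card_Un_le[of "\<Union>g\<in>G. ?X g" Y] by linarith
  then show ?thesis by (simp add: cap_def)
qed

lemma carrier_run:
  assumes xs: "xs \<in> permutations_of_set E" and ok: "ok xs"
  shows "carrier (run f bs xs) = stored xs"
proof -
  have "run f (take nE bs) (take nE xs) = (min (ticks bs nE) K3, ch1 xs, saved xs nE, core xs, ch2 xs)"
  proof -
    have "min nE n1 = n1" "min nE n3 = n3" "\<not> nE < n2" using n_le by auto
    moreover have "ch1 xs = picks f {} (\<lambda>i. (ticks bs i - 0) div L) xs (cut bs 0) n1"
      unfolding ch1_def chain_def n1_def by simp
    moreover have "ch2 xs = picks f (core xs) (\<lambda>i. (ticks bs i - K2) div L) xs n2 n3"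
      unfolding ch2_def chain_def n2_def n3_def K3_def by simp
    ultimately show ?thesis using run_closed[OF xs saved_card[OF xs ok] order.refl] by (simp only: if_False)
  qed
  moreover have "take nE bs = bs" "take nE xs = xs" using perm_facts(1)[OF xs] len by simp_all
  ultimately show ?thesis unfolding carrier_def stored_def by (simp only: prod.case)
qed

lemma stored_sub: "xs \<in> permutations_of_set E \<Longrightarrow> ok xs \<Longrightarrow> stored xs \<subseteq> E"
  using run_wf[of f bs xs] carrier_run perm_facts by metis

lemma V_nonneg: "xs \<in> permutations_of_set E \<Longrightarrow> 0 \<le> V xs"
proof -
  assume xs: "xs \<in> permutations_of_set E"
  have c: "carrier (run f bs xs) \<subseteq> E" using run_wf[of f bs xs] perm_facts[OF xs] by simp
  then have "finite (carrier (run f bs xs))" using fin by (rule finite_subset)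
  from pick_best(1)[OF this, of f k] c have "pick_best f k (carrier (run f bs xs)) \<subseteq> E" by (rule subset_trans)
  then show ?thesis unfolding V_def by (rule f_nonneg)
qed

lemma V_ge:
  assumes xs: "xs \<in> permutations_of_set E" "ok xs" and X: "X \<subseteq> stored xs" "card X \<le> k"
  shows "f X \<le> V xs"
  using pick_best(3)[of "stored xs" X k f] X finite_subset[OF stored_sub[OF xs] fin] unfolding V_def carrier_run[OF xs] by simp

lemma not_mem_take:
  assumes xs: "xs \<in> permutations_of_set E" and e: "e \<in> E" "e \<notin> set (take i xs)"
  obtains j where "i \<le> j" "j < nE" "e = xs ! j"
proof -
  obtain j where j: "j < nE" "e = xs ! j" using e(1) perm_facts[OF xs] by (metis in_set_conv_nth)
  have "i \<le> j"
  proof (rule ccontr)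
    assume "\<not> i \<le> j"
    then have "take i xs ! j = e" "j < length (take i xs)" using j perm_facts[OF xs] by auto
    then show False using e(2) by (metis nth_mem)
  qed
  then show ?thesis using j that by blast
qed

lemma passes_mono: "G1 \<subseteq> G2 \<Longrightarrow> passes f G1 C p e \<Longrightarrow> passes f G2 C p e"
  unfolding passes_def by blast

text \<open>\<open>run_bound\<close> over the empty set with j = l = k. The set S of the first k - 1
  picks lies in the prefix, so \<open>worst\<close> with Z = S bounds the value reached.\<close>

lemma general_ratio:
  assumes xs: "xs \<in> permutations_of_set E" and ok: "ok xs" and Opt: "Opt \<subseteq> E" "card Opt \<le> k"
  shows "k * worst Opt Opt (set (take n1 xs)) \<le> (2 * real k - 1) * V xs"
proof -
  define P1 where "P1 = set (take n1 xs)"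
  define Q where "Q = {e \<in> Opt - P1. passes f G {} (ch1 xs) e}"
  define U where "U = {e \<in> Opt - P1. \<not> passes f G {} (ch1 xs) e}"
  have P1E: "P1 \<subseteq> E" using perm_facts[OF xs] unfolding P1_def by (metis set_take_subset)
  have QS: "Q \<subseteq> stored xs"
  proof
    fix e assume e: "e \<in> Q"
    obtain j where j: "n1 \<le> j" "j < nE" "e = xs ! j"
      using not_mem_take[OF xs, of e n1] e Opt unfolding Q_def P1_def by blast
    then have "saves xs j" using e unfolding saves_def Q_def by simp
    then show "e \<in> stored xs" using j unfolding stored_def saved_def by blast
  qed
  have fO: "finite Opt" using Opt(1) fin by (rule finite_subset)
  have c: "card ((Q \<union> U) - {}) \<le> k" using Opt(2) card_mono[OF fO, of "Q \<union> U"] by (auto simp: Q_def U_def)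
  have chE: "set (ch1 xs) \<subseteq> E" using ch1_sub[OF xs] P1E by (simp add: P1_def)
  have chS: "set (ch1 xs) \<subseteq> stored xs" by (auto simp: stored_def)
  have QE: "Q \<subseteq> E" "U \<subseteq> E" using Opt by (auto simp: Q_def U_def)
  have np: "\<not> passes f {k - 1} {} (ch1 xs) u" if "u \<in> U" for u
    using that passes_mono[of "{k - 1}" G "{}" "ch1 xs" u] G_levels(2) by (auto simp: U_def)
  have VV: "f X \<le> V xs" if "X \<subseteq> stored xs" "X \<subseteq> E" "card X \<le> k" for X
    using V_ge[OF xs ok that(1,3)] .
  have ck: "card {} + k \<le> k" by simp
  define W where "W = f (set (take (k - 1) (ch1 xs)) \<union> (Opt - (Opt \<inter> P1)))"
  have un: "{} \<union> set (take (k - 1) (ch1 xs)) \<union> Q \<union> U = set (take (k - 1) (ch1 xs)) \<union> (Opt - (Opt \<inter> P1))"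
    by (auto simp: Q_def U_def)
  have "real k * (f ({} \<union> set (take (k - 1) (ch1 xs)) \<union> Q \<union> U) - f {}) \<le> (real k + real k - 1) * (V xs - f {})"
    by (rule run_bound[OF empty_subsetI empty_subsetI chE chS length_ch(1) k0 QE(1) QS QE(2) np VV ck c k0])
  then have rb: "real k * (W - f {}) \<le> (2 * real k - 1) * (V xs - f {})" unfolding un W_def by simp
  have "set (take (k - 1) (ch1 xs)) \<subseteq> P1"
    using ch1_sub[OF xs] set_take_subset[of "k - 1" "ch1 xs"] unfolding P1_def by (rule subset_trans[rotated])
  then have "worst Opt Opt P1 \<le> W" unfolding W_def by (intro worst_le) (simp_all add: P1_def)
  then have "real k * (worst Opt Opt P1 - f {}) \<le> real k * (W - f {})" by (intro mult_left_mono) simp_all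
  then have "real k * (worst Opt Opt P1 - f {}) \<le> (2 * real k - 1) * (V xs - f {})" using rb by linarith
  moreover have "0 \<le> f {}" by (intro f_nonneg) simp
  then have "0 \<le> (real k - 1) * f {}" using k0 by (intro mult_nonneg_nonneg) auto
  ultimately show ?thesis unfolding P1_def by (simp add: algebra_simps)
qed

text \<open>\<open>run_bound\<close> over the core with j = k - m. The saved part of the optimum
  belongs to Q at once; the part D still to come is split by the test of the second chain, and what
  falls into its own windows is charged to \<open>worst\<close>.\<close>

lemma second_chain_bound:
  assumes xs: "xs \<in> permutations_of_set E" and ok: "ok xs" and k86: "86 \<le> k" and Opt: "Opt \<subseteq> E - set (take n1 xs)"
  defines "Z \<equiv> {e \<in> E - set (take n1 xs). passes f G {} (ch1 xs) e}" and "B \<equiv> set (take (n2 - n1) (drop n1 xs))"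
    and "P3 \<equiv> set (take (n3 - n2) (drop n2 xs))"
  shows "(real k - m) * (worst (core xs \<union> (Z \<inter> Opt) \<union> (Opt - Z - B)) (Opt - Z - B) P3 - f (core xs))
    \<le> (real k - m + card (Z \<inter> Opt) + card (Opt - Z - B)) * (V xs - f (core xs))"
proof -
  define D where "D = Opt - Z - B"
  define Q where "Q = (Z \<inter> Opt) \<union> {e \<in> D - P3. passes f {k - m - 1} (core xs) (ch2 xs) e}"
  define U where "U = {e \<in> D - P3. \<not> passes f {k - m - 1} (core xs) (ch2 xs) e}"
  note pf = perm_facts[OF xs]
  have mk': "m < k" "0 < k - m" using mk k86 by auto
  have "set (take n2 xs) \<subseteq> set xs" "set (take n1 xs) \<subseteq> set xs" by (rule set_take_subset)+
  then have tE: "set (take n2 xs) \<subseteq> E" "set (take n1 xs) \<subseteq> E" using pf by simp_all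
  have P3E: "P3 \<subseteq> E" unfolding P3_def using pf by (metis set_drop_subset set_take_subset subset_trans)
  have cE: "core xs \<subseteq> E" using core_before tE by blast
  have OE: "Opt \<subseteq> E" using Opt by blast
  have fO: "finite Opt" using OE fin by (rule finite_subset)
  have take2: "set (take n2 xs) = set (take n1 xs) \<union> B"
  proof -
    have "n2 = n1 + (n2 - n1)" using n_le by simp
    then have "take n2 xs = take n1 xs @ take (n2 - n1) (drop n1 xs)" by (metis take_add)
    then show ?thesis by (simp add: B_def)
  qed
  have take3: "set (take n3 xs) = set (take n2 xs) \<union> P3"
  proof -
    have "n3 = n2 + (n3 - n2)" using n_le by simp
    then have "take n3 xs = take n2 xs @ take (n3 - n2) (drop n2 xs)" by (metis take_add)
    then show ?thesis by (simp add: P3_def)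
  qed
  have TS: "e \<in> stored xs" if e: "e \<in> Z" for e
  proof -
    obtain j where j: "n1 \<le> j" "j < nE" "e = xs ! j" using not_mem_take[OF xs, of e n1] e unfolding Z_def by blast
    then have "saves xs j" using e unfolding saves_def Z_def by simp
    then show ?thesis using j unfolding stored_def saved_def by blast
  qed
  have "e \<in> stored xs" if e: "e \<in> D - P3" "passes f {k - m - 1} (core xs) (ch2 xs) e" for e
  proof -
    have "e \<in> E" "e \<notin> set (take n3 xs)" using e Opt unfolding take3 take2 D_def by auto
    then obtain j where j: "n3 \<le> j" "j < nE" "e = xs ! j" using not_mem_take[OF xs] by blast
    then have "saves xs j" using e k86 n_le unfolding saves_def by auto
    then show ?thesis using j unfolding stored_def saved_def by blast
  qed
  then have QS: "Q \<subseteq> stored xs" using TS unfolding Q_def by blast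
  have QE: "Q \<subseteq> E" "U \<subseteq> E" using OE unfolding Q_def U_def D_def by blast+
  have chE: "set (ch2 xs) \<subseteq> E" using ch2_sub[OF xs] P3E by (simp add: P3_def)
  have S: "set (ch2 xs) \<subseteq> stored xs" "core xs \<subseteq> stored xs" by (auto simp: stored_def)
  have np: "\<not> passes f {k - m - 1} (core xs) (ch2 xs) u" if "u \<in> U" for u using that by (simp add: U_def)
  have fT: "finite (Z \<inter> Opt)" "finite D" using fO by (auto simp: D_def)
  have "card ((Q \<union> U) - core xs) \<le> card ((Z \<inter> Opt) \<union> D)" using fT by (intro card_mono) (auto simp: Q_def U_def)
  \<comment> \<open>The successor keeps the count positive, as \<open>run_bound\<close> requires,
    and cancels against its - 1.\<close>
  then have c: "card ((Q \<union> U) - core xs) \<le> Suc (card (Z \<inter> Opt) + card D)" using card_Un_le[of "Z \<inter> Opt" D] by linarith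
  have ck: "card (core xs) + (k - m) \<le> k" using core_sub(2)[of xs] mk(1) by linarith
  have VV: "f X \<le> V xs" if "X \<subseteq> stored xs" "X \<subseteq> E" "card X \<le> k" for X
    using V_ge[OF xs ok that(1,3)] .
  define W where "W = f (set (take (k - m - 1) (ch2 xs)) \<union> ((core xs \<union> (Z \<inter> Opt) \<union> D) - (D \<inter> P3)))"
  have un: "core xs \<union> set (take (k - m - 1) (ch2 xs)) \<union> Q \<union> U
      = set (take (k - m - 1) (ch2 xs)) \<union> ((core xs \<union> (Z \<inter> Opt) \<union> D) - (D \<inter> P3))"
  proof -
    have "core xs \<inter> D = {}" using core_sub(1) unfolding D_def B_def by blast
    moreover have "Z \<inter> Opt \<inter> D = {}" unfolding D_def by blast
    ultimately show ?thesis unfolding Q_def U_def by blast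
  qed
  have "real (k - m) * (f (core xs \<union> set (take (k - m - 1) (ch2 xs)) \<union> Q \<union> U) - f (core xs))
     \<le> (real (k - m) + real (Suc (card (Z \<inter> Opt) + card D)) - 1) * (V xs - f (core xs))"
    by (rule run_bound[OF cE S(2) chE S(1) length_ch(2) mk'(2) QE(1) QS QE(2) np VV ck c zero_less_Suc])
  then have rb: "real (k - m) * (W - f (core xs))
     \<le> (real (k - m) + real (Suc (card (Z \<inter> Opt) + card D)) - 1) * (V xs - f (core xs))" unfolding un W_def .
  have "set (take (k - m - 1) (ch2 xs)) \<subseteq> P3"
    using ch2_sub[OF xs] set_take_subset[of "k - m - 1" "ch2 xs"] unfolding P3_def by (rule subset_trans[rotated])
  then have "worst (core xs \<union> (Z \<inter> Opt) \<union> D) D P3 \<le> W" unfolding W_def by (intro worst_le) (simp_all add: P3_def)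
  then have "real (k - m) * (worst (core xs \<union> (Z \<inter> Opt) \<union> D) D P3 - f (core xs)) \<le> real (k - m) * (W - f (core xs))"
    by (intro mult_left_mono) simp_all
  then have "real (k - m) * (worst (core xs \<union> (Z \<inter> Opt) \<union> D) D P3 - f (core xs))
     \<le> (real (k - m) + real (Suc (card (Z \<inter> Opt) + card D)) - 1) * (V xs - f (core xs))" using rb by linarith
  moreover have rk: "real (k - m) = real k - m" using mk' by simp
  moreover have "real (k - m) + real (Suc (card (Z \<inter> Opt) + card D)) - 1 = real k - m + card (Z \<inter> Opt) + card D"
    unfolding rk by simp
  ultimately show ?thesis unfolding D_def by (simp only:)
qed

lemma avg_worst_first:
  assumes "Opt \<subseteq> E"
  shows "(1 - 2 * (n1 / nE)) * f Opt \<le> perm_avg E (\<lambda>xs. worst Opt Opt (set (take n1 xs)))"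
  by (rule perm_avg_worst_ge) (use assms n_le in auto)

lemma general_average:
  assumes Opt: "Opt \<subseteq> E" "card Opt \<le> k" and vmax: "\<And>X. X \<subseteq> E \<Longrightarrow> card X \<le> k \<Longrightarrow> f X \<le> f Opt"
  shows "k * ((1 - 2 * (n1 / nE)) * f Opt) \<le>
     (2 * real k - 1) * perm_avg E V + 2 * k * f Opt * perm_avg E (\<lambda>xs. of_bool (\<not> ok xs))"
proof -
  have "k * ((1 - 2 * (n1 / nE)) * f Opt) \<le> k * perm_avg E (\<lambda>xs. worst Opt Opt (set (take n1 xs)))"
    using avg_worst_first[OF Opt(1)] by (intro mult_left_mono) auto
  also have "\<dots> = perm_avg E (\<lambda>xs. k * worst Opt Opt (set (take n1 xs)))" by (simp only: perm_avg_cmult)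
  also have "\<dots> \<le> perm_avg E (\<lambda>xs. (2 * real k - 1) * V xs + 2 * k * f Opt * of_bool (\<not> ok xs))"
  proof (rule perm_avg_mono)
    fix xs assume xs: "xs \<in> permutations_of_set E"
    show "k * worst Opt Opt (set (take n1 xs)) \<le> (2 * real k - 1) * V xs + 2 * k * f Opt * of_bool (\<not> ok xs)"
    proof (cases "ok xs")
      case True then show ?thesis using general_ratio[OF xs True Opt] by simp
    next
      case False
      \<comment> \<open>If a window fails, the left side is still at most k f Opt, since with Z
        empty what remains of \<open>Opt\<close> is a feasible set; the penalty covers this.\<close>
      have "worst Opt Opt (set (take n1 xs)) \<le> f ({} \<union> (Opt - (Opt \<inter> set (take n1 xs))))" by (rule worst_le) auto
      also have "\<dots> \<le> f Opt"
        using Opt finite_subset[OF Opt(1) fin] card_mono[of Opt "Opt - Opt \<inter> set (take n1 xs)"] by (intro vmax) auto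
      finally have "real k * worst Opt Opt (set (take n1 xs)) \<le> real k * f Opt" by (intro mult_left_mono) simp_all
      moreover have "0 \<le> real k * f Opt" using f_nonneg[OF Opt(1)] by simp
      moreover have "0 \<le> (2 * real k - 1) * V xs" using V_nonneg[OF xs] k0 by simp
      moreover have "2 * k * f Opt * of_bool (\<not> ok xs) = 2 * (real k * f Opt)" using False by simp
      ultimately show ?thesis by linarith
    qed
  qed
  also have "\<dots> = (2 * real k - 1) * perm_avg E V + 2 * k * f Opt * perm_avg E (\<lambda>xs. of_bool (\<not> ok xs))"
    by (simp only: perm_avg_add perm_avg_cmult)
  finally show ?thesis .
qed

end

section \<open>Symmetric functions: first chain, block and second chain combined\<close>

locale sym_coin_run = coin_run k L K2 m M h E f bs + sym_submod E f
  for k L K2 m M h and E :: "'a set" and f bs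
begin

text \<open>The prefix holding the first chain is kept fixed and the rest is averaged. Either the
  chain with its saved elements is already worth 0.50295 om, or the ratios to om satisfy
  \<open>tight_chain\<close>, which supplies the critical level for \<open>block\<close>. Orders
  with a failing window pay the penalty in \<open>Psi\<close>.\<close>

lemma symmetric_prefix_average:
  assumes Opt: "Opt \<subseteq> E" "card Opt \<le> k" and vmax: "\<And>X. X \<subseteq> E \<Longrightarrow> card X \<le> k \<Longrightarrow> f X \<le> f Opt"
    and k86: "86 \<le> k" and mk': "k \<le> 150 * m" "10000 * m \<le> 133 * k" and h: "0 < h" "100000 * (h - 1) \<le> k"
    and l: "71 * (nE - n1) \<le> 1000 * (n2 - n1)" "14 * (n2 - n1) \<le> nE - n1" "20000 * (n3 - n2) \<le> nE - n2"
    and xs0: "xs0 \<in> permutations_of_set E"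
  defines "P \<equiv> take n1 xs0"
  shows "50295 / 100000 * (2 * real k - m) * worst Opt Opt (set P)
    \<le> perm_avg (E - set P) (\<lambda>ys. (2 * real k - m) * V (P @ ys) + 4 * k * f Opt * of_bool (\<not> ok (P @ ys)))"
proof -
  define R where "R = E - set P"
  define om where "om = worst Opt Opt (set P)"
  define v where "v = f Opt"
  define O' where "O' = Opt - set P"
  define p where "p = ch1 P"
  define Z where "Z = {e \<in> R. passes f G {} p e}"
  define Psi where "Psi ys = (2 * real k - m) * V (P @ ys) + 4 * k * v * of_bool (\<not> ok (P @ ys))" for ys
  note pf0 = perm_facts[OF xs0]
  have lP: "length P = n1" using pf0 n_le by (simp add: P_def)
  have PE: "set P \<subseteq> E" unfolding P_def using set_take_subset[of n1 xs0] pf0 by simp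
  have cR: "card R = nE - n1"
  proof -
    have "card (set P) = n1" using pf0 lP by (metis P_def distinct_card distinct_take)
    then show ?thesis using PE fin by (simp add: R_def card_Diff_subset finite_subset)
  qed
  have finR: "finite R" using fin by (simp add: R_def)
  have RE: "R \<subseteq> E" by (auto simp: R_def)
  have v0: "0 \<le> v" using f_nonneg[OF Opt(1)] by (simp add: v_def)
  have mk0: "m < k" "0 < m" "0 < real k" using mk k86 mk' by auto
  have kk: "0 \<le> 2 * real k - m" "2 * real k - m \<le> 2 * k" using mk0 by auto
  have perm: "P @ ys \<in> permutations_of_set E" if "ys \<in> permutations_of_set R" for ys
  proof -
    have "set ys = R" "distinct ys" "distinct P" using that pf0 by (auto simp: permutations_of_set_def P_def)
    then show ?thesis using PE by (auto simp: permutations_of_set_def R_def)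
  qed
  have takeP: "take n1 (P @ ys) = P" "drop n1 (P @ ys) = ys" for ys using lP by simp_all
  have chP: "ch1 (P @ ys) = p" for ys
    unfolding ch1_def p_def
    by (rule chain_cong_prefix[OF K_le(5)]) (simp add: nth_append lP[unfolded n1_def])
  have Psi0: "0 \<le> Psi ys" if "ys \<in> permutations_of_set R" for ys
    unfolding Psi_def using V_nonneg[OF perm[OF that]] kk v0 by simp
  have fO: "finite Opt" using Opt(1) fin by (rule finite_subset)
  have O'R: "O' \<subseteq> R" "O' \<subseteq> E" using Opt by (auto simp: O'_def R_def)
  have cO': "card O' \<le> k" using Opt(2) card_mono[OF fO, of O'] by (auto simp: O'_def)
  have fO': "finite O'" using fO by (simp add: O'_def)
  have om_le: "om \<le> f (S \<union> O')" if "S \<subseteq> set P" for S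
  proof -
    have "Opt - (Opt \<inter> set P) = O'" by (auto simp: O'_def)
    then show ?thesis unfolding om_def using worst_le[of "set P" S Opt Opt] that by simp
  qed
  have fO'v: "f O' \<le> v" using vmax[OF O'R(2) cO'] by (simp add: v_def)
  have om_v: "om \<le> v" using om_le[of "{}"] fO'v by simp
  have pP: "set p \<subseteq> set P"
    using ch1_sub[OF xs0] chP[of "drop n1 xs0"] by (simp add: P_def)
  have lp: "length p = k" using length_ch(1)[of P] by (simp add: p_def)
  have ZE: "Z \<subseteq> R" by (auto simp: Z_def)
  have ZS: "set p \<union> Z \<subseteq> stored (P @ ys)" if ys: "ys \<in> permutations_of_set R" for ys
  proof
    fix e assume "e \<in> set p \<union> Z"
    then show "e \<in> stored (P @ ys)"
    proof
      assume "e \<in> set p" then show ?thesis unfolding stored_def chP by simp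
    next
      assume e: "e \<in> Z"
      then have "e \<in> E" "e \<notin> set (take n1 (P @ ys))" unfolding takeP by (auto simp: Z_def R_def)
      then obtain j where j: "n1 \<le> j" "j < nE" "e = (P @ ys) ! j" using not_mem_take[OF perm[OF ys]] by metis
      then have "saves (P @ ys) j" using e unfolding saves_def chP Z_def by simp
      then show ?thesis using j unfolding stored_def saved_def by blast
    qed
  qed
  have goal: "50295 / 100000 * om * (2 * real k - m) \<le> perm_avg R Psi"
  proof (cases "0 < om")
    case False
    then have "50295 / 100000 * om * (2 * real k - m) \<le> 0" using kk by (simp add: mult_nonpos_nonneg)
    also have "0 \<le> perm_avg R Psi" by (rule perm_avg_ge_const[OF finR Psi0])
    finally show ?thesis .
  next
    case om0: True
    have finPZ: "finite (set p \<union> Z)" using finite_subset[OF ZE finR] by simp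
    \<comment> \<open>The best value offered by the first chain and its saved elements. It is
      determined by the prefix, so distinguishing cases by it leaves the order of the rest
      uniform.\<close>
    define V0 where "V0 = f (pick_best f k (set p \<union> Z))"
    have V0_ge: "f X \<le> V0" if "X \<subseteq> set p \<union> Z" "card X \<le> k" for X
      unfolding V0_def by (rule pick_best(3)[OF finPZ that])
    have V0_le: "V0 \<le> V (P @ ys)" if "ys \<in> permutations_of_set R" "ok (P @ ys)" for ys
      unfolding V0_def using pick_best(1,2)[OF finPZ, of f k] ZS[OF that(1)] by (intro V_ge perm that) auto
    show ?thesis
    proof (cases "50295 / 100000 * om \<le> V0")
      case True
      show ?thesis
      proof (rule perm_avg_ge_const[OF finR])
        fix ys assume ys: "ys \<in> permutations_of_set R"
        show "50295 / 100000 * om * (2 * real k - m) \<le> Psi ys"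
        proof (cases "ok (P @ ys)")
          case ok: True
          then have "(2 * real k - m) * (50295 / 100000 * om) \<le> (2 * real k - m) * V (P @ ys)"
            using V0_le[OF ys ok] True kk by (intro mult_left_mono) auto
          then show ?thesis using ok by (simp add: Psi_def mult.commute)
        next
          case False
          have "50295 / 100000 * om * (2 * real k - m) \<le> v * (2 * real k)"
            using om0 om_v kk v0 by (intro mult_mono) auto
          also have "\<dots> = 2 * (real k * v)" by simp
          finally have "50295 / 100000 * om * (2 * real k - m) \<le> 2 * (real k * v)" .
          moreover have "0 \<le> (2 * real k - m) * V (P @ ys)" using kk V_nonneg[OF perm[OF ys]] by simp
          moreover have "0 \<le> real k * v" using v0 by simp
          moreover have "Psi ys = (2 * real k - m) * V (P @ ys) + 4 * (real k * v)" using False by (simp add: Psi_def)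
          ultimately show ?thesis by linarith
        qed
      qed
    next
      case V0s: False
      define s where "s j = f (set (take j p)) / om" for j
      define ga where "ga = gain f {} p"
      define nu where "nu j = Min ((\<lambda>i. ga i / om) ` {..j})" for j
      define T where "T = Z \<inter> O'"
      define U where "U = O' - Z"
      have fTU: "finite T" "finite U" "T \<inter> U = {}" "O' = T \<union> U" using fO' by (auto simp: T_def U_def)
      have cTU: "card O' = card T + card U" using card_Un_disjoint[OF fTU(1-3)] fTU(4) by simp
      have nu_le: "nu j \<le> ga i / om" if "i \<le> j" for i j unfolding nu_def using that by (intro Min_le) auto
      have ga_s: "ga i / om = s (Suc i) - s i" for i by (simp add: ga_def gain_def s_def diff_divide_distrib)
      have take_p: "set (take j p) \<subseteq> set P" "set (take j p) \<subseteq> set p" for j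
        using set_take_subset[of j p] pP by auto
      have gain_U: "f (insert u (set (take g p))) - f (set (take g p)) \<le> max 0 (nu g) * om" if u: "u \<in> U" and g: "g \<in> G" for u g
      proof -
        have "\<not> passes f G {} p u" using u O'R unfolding U_def Z_def by blast
        then have le: "f (insert u (set (take g p))) - f (set (take g p)) \<le> ga i" if "i \<le> g" for i
          using g that unfolding passes_def ga_def by (auto simp: not_less)
        have "nu g \<in> (\<lambda>i. ga i / om) ` {..g}" unfolding nu_def by (rule Min_in) auto
        then obtain i where i: "i \<le> g" "nu g = ga i / om" by auto
        have "ga i = nu g * om" using om0 i(2) by simp
        also have "\<dots> \<le> max 0 (nu g) * om" using om0 by (intro mult_right_mono) auto
        finally have "ga i \<le> max 0 (nu g) * om" .
        then show ?thesis using le[OF i(1)] by linarith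
      qed
      have tight: "real (card T) \<le> 0.0119 * k \<and> (\<exists>g\<in>levels h k. s g + card U * max 0 (nu g) \<le> 0.5866 - 3 * (card T / k))"
      proof (rule tight_chain[OF k86 h, of nu s "V0 / om" "card U" "card T"])
        show "nu j \<le> nu i" if "i \<le> j" for i j
          unfolding nu_def using that by (intro Min_antimono image_mono) auto
        show "nu i \<le> s (Suc i) - s i" for i using nu_le[of i i] ga_s by simp
        show "0 \<le> s j" for j unfolding s_def using om0 take_p(1)[of j] PE by (intro divide_nonneg_pos f_nonneg) auto
        show "s j \<le> V0 / om" if "j \<le> k" for j
          unfolding s_def using om0 take_p(2)[of j] that card_length[of "take j p"] by (intro divide_right_mono V0_ge) auto
        show "V0 / om < 0.50295" using V0s om0 by (simp add: divide_less_eq)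
        show "card U + card T \<le> k" using cTU cO' by simp
        fix g assume "g \<in> levels h k"
        then have g: "g \<in> G" "g < k" by (auto simp: G_def levels_def)
        let ?S = "set (take g p)"
        define c where "c = max 0 (nu g) * om"
        have c0: "0 \<le> c" using om0 by (simp add: c_def)
        have SE: "?S \<subseteq> E" using take_p(1) PE by blast
        have cS: "card (?S \<union> T) \<le> g + card T"
          using card_Un_le[of ?S T] card_length[of "take g p"] by simp
        have X: "?S \<union> T \<subseteq> E" "?S \<union> T \<subseteq> set p \<union> Z" using SE O'R take_p(2)[of g] by (auto simp: T_def)
        have "om \<le> f ((?S \<union> T) \<union> U)" using om_le[OF take_p(1)] fTU(4) by (simp add: Un_assoc)
        also have "\<dots> \<le> f (?S \<union> T) + card U * c"
        proof (rule f_Un_le_card[OF X(1) _ c0])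
          show "U \<subseteq> E" using O'R by (auto simp: U_def)
          fix u assume u: "u \<in> U" "u \<notin> ?S \<union> T"
          have "f (insert u (?S \<union> T)) - f (?S \<union> T) \<le> f (insert u ?S) - f ?S"
            by (rule marginal_antimono[OF _ X(1)]) (use u O'R in \<open>auto simp: U_def\<close>)
          then show "f (insert u (?S \<union> T)) - f (?S \<union> T) \<le> c" using gain_U[OF u(1) g(1)] by (simp add: c_def)
        qed
        \<comment> \<open>Level g and the saved elements together may exceed k places; then the
          proportional bound applies, with the excess factor that \<open>tight_chain\<close> allows
          for.\<close>
        also have "f (?S \<union> T) \<le> V0 * max 1 (real (g + card T) / k)"
        proof (cases "g + card T \<le> k")
          case True
          then have "f (?S \<union> T) \<le> V0" using cS by (intro V0_ge X) simp
          moreover have "max 1 (real (g + card T) / k) = 1" using True mk0 by (simp add: max_def divide_le_eq)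
          ultimately show ?thesis by simp
        next
          case False
          have e0: "0 \<le> f {}" by (intro f_nonneg) simp
          have V0e: "f {} \<le> V0" by (rule V0_ge) auto
          have "real k * (f ({} \<union> (?S \<union> T)) - f {}) \<le> real (g + card T) * (V0 - f {})"
          proof (rule f_Un_le_proportional)
            show "f ({} \<union> Y) - f {} \<le> V0 - f {}" if "Y \<subseteq> ?S \<union> T - {}" "card Y \<le> k" for Y
              using V0_ge[of Y] that X(2) by auto
          qed (use X k86 V0e cS False in auto)
          moreover have "0 \<le> (real (g + card T) - k) * f {}" using False e0 by (intro mult_nonneg_nonneg) auto
          ultimately have "real k * f (?S \<union> T) \<le> real (g + card T) * V0" by (simp add: algebra_simps)
          then have "f (?S \<union> T) \<le> real (g + card T) / k * V0" using mk0 by (simp add: field_simps)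
          moreover have "max 1 (real (g + card T) / k) = real (g + card T) / k" using False mk0 by (simp add: max_def le_divide_eq)
          ultimately show ?thesis by (simp only: mult.commute)
        qed
        finally have "om \<le> V0 * max 1 (real (g + card T) / k) + card U * c" by simp
        then have "om / om \<le> (V0 * max 1 (real (g + card T) / k) + card U * c) / om" using om0 by (intro divide_right_mono) auto
        then show "1 \<le> V0 / om * max 1 (real (g + card T) / k) + card U * max 0 (nu g)"
          using om0 by (simp add: c_def add_divide_distrib)
      qed
      then obtain g where g: "g \<in> levels h k" "s g + card U * max 0 (nu g) \<le> 0.5866 - 3 * (card T / k)" by blast
      define S where "S = set (take g p)"
      define c where "c = max 0 (nu g) * om"
      define ph where "ph = (4134 / 10000 + 3 * (card T / k)) * om"
      define ll where "ll = n2 - n1"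
      have gG: "g \<in> G" using g by (simp add: G_def)
      have SP: "S \<subseteq> set P" "S \<subseteq> E" using take_p(1) PE by (auto simp: S_def)
      have phi: "f S + card U * c \<le> om - ph"
      proof -
        have "(s g + card U * max 0 (nu g)) * om \<le> (0.5866 - 3 * (card T / k)) * om" using g(2) om0 by (intro mult_right_mono) auto
        moreover have "(s g + card U * max 0 (nu g)) * om = f S + card U * c" using om0 by (simp add: s_def S_def c_def field_simps)
        moreover have "(0.5866 - 3 * (card T / k)) * om = om - ph" by (simp add: ph_def algebra_simps)
        ultimately show ?thesis by simp
      qed
      interpret b: block E f R Z O' S ll m om ph c
      proof
        show "R \<subseteq> E" "Z \<subseteq> R" "O' \<subseteq> R" "S \<subseteq> E" by (fact RE ZE O'R SP)+
        show "S \<inter> R = {}" using SP by (auto simp: R_def)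
        show "ll \<le> card R" using n_le by (simp add: cR ll_def)
        show "0 < m" by (rule mk0)
        show "om \<le> f (S \<union> O')" by (rule om_le[OF SP(1)])
        show "0 \<le> c" using om0 by (simp add: c_def)
        show "f (insert u S) - f S \<le> c" if "u \<in> O' - Z" for u using gain_U[OF _ gG] that by (simp add: U_def S_def c_def)
        show "f S + card (O' - Z) * c \<le> om - ph" using phi by (simp add: U_def)
      qed
      have tk: "10000 * card (Z \<inter> O') \<le> 119 * k" using tight by (simp add: T_def)
      have rk: "71 * card R \<le> 1000 * ll" "14 * ll \<le> card R" using l by (simp_all add: cR ll_def)
      \<comment> \<open>With nothing left to arrive, om \<le> f {} \<le> V0 would contradict the
        tight case.\<close>
      have R0: "0 < card R"
      proof (rule ccontr)
        assume "\<not> 0 < card R"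
        then have "R = {}" using finR by simp
        then have "O' = {}" "Z = {}" using O'R ZE by auto
        then have "f O' \<le> V0" by (intro V0_ge) auto
        then show False using om_le[of "{}"] V0s om0 by simp
      qed
      have V0': "f X \<le> 50295 / 100000 * om" if "X \<subseteq> Z" "card X \<le> k" for X
      proof -
        have "X \<subseteq> set p \<union> Z" using that(1) by (rule le_supI2)
        then have "f X \<le> V0" using that(2) by (rule V0_ge)
        then show ?thesis using V0s by linarith
      qed
      have omO: "om \<le> f O'" using om_le[of "{}"] by simp
      have bg: "50295 / 100000 * om * (2 * real k - m) \<le> perm_avg R (\<lambda>ys. (real k - m) * (9999 / 10000 * b.W ys) + k * b.a ys
          + (real (card (set (take ll ys) \<inter> (O' - Z))) + (real k - card O')) * (om / 2 - b.a ys))"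
        by (rule b.block_gain[OF k86 mk' cO' om0 omO tk _ rk R0 V0']) (simp_all add: ph_def T_def)
      define rest where "rest ys = k * b.a ys + (real (card (set (take ll ys) \<inter> (O' - Z))) + (real k - card O')) * (om / 2 - b.a ys)" for ys
      define X where "X ys = b.A ys \<union> (Z \<inter> O') \<union> (O' - Z - set (take ll ys))" for ys
      define D where "D ys = O' - Z - set (take ll ys)" for ys
      define l3 where "l3 = n3 - n2"
      define w3 where "w3 ys = worst (X ys) (D ys) (set (take l3 (drop ll ys)))" for ys
      have core: "core (P @ ys) = b.A ys" if "ys \<in> permutations_of_set R" for ys
      proof -
        have "set (take ll ys) \<subseteq> R" using that set_take_subset[of ll ys] by (auto simp: permutations_of_set_def)
        then have "{e \<in> set (take (n2 - n1) (drop n1 (P @ ys))). passes f G {} (ch1 (P @ ys)) e} = Z \<inter> set (take ll ys)"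
          unfolding takeP chP Z_def ll_def by auto
        then show ?thesis unfolding core_def b.A_def by simp
      qed
      have XE: "X ys \<subseteq> E" "D ys \<subseteq> X ys" for ys
        using b.A_sub(1)[of ys] ZE RE O'R unfolding X_def D_def by blast+
      \<comment> \<open>With a the value of the core, the second chain gives (k - m)(w3 - a) \<le>
        (k - m + |T| + cd)(V - a). The factor on the right equals 2k - m - w, where w counts the
        unsaved elements lost in the block and the k - |O'| missing ones. Moving w (V - a) to the
        left and using V \<ge> om / 2 there yields the claim.\<close>
      have low: "(real k - m) * w3 ys + rest ys \<le> Psi ys" if ys: "ys \<in> permutations_of_set R" for ys
      proof -
        define x where "x = P @ ys"
        have x: "x \<in> permutations_of_set E" using perm[OF ys] by (simp add: x_def)
        define cu where "cu = card (set (take ll ys) \<inter> (O' - Z))"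
        define cd where "cd = card (O' - Z - set (take ll ys))"
        have "card U = cu + cd"
        proof -
          have "U = (set (take ll ys) \<inter> (O' - Z)) \<union> (O' - Z - set (take ll ys))" by (auto simp: U_def)
          moreover have "card \<dots> = cu + cd" unfolding cu_def cd_def using fO' by (intro card_Un_disjoint) auto
          ultimately show ?thesis by simp
        qed
        then have cc: "real (card O') = card T + cu + cd" using cTU by simp
        define w where "w = real cu + (real k - card O')"
        have w: "0 \<le> w" "w \<le> k" using cO' cc by (auto simp: w_def)
        have a: "b.a ys = f (core x)" using core[OF ys] b.A_sub(3)[of ys] by (simp add: x_def)
        have rest: "rest ys = k * f (core x) + w * (om / 2 - f (core x))" by (simp add: rest_def a w_def cu_def)
        show ?thesis
        proof (cases "ok x")
          case True
          have P3: "set (take (n3 - n2) (drop n2 x)) = set (take l3 (drop ll ys))"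
            using lP n_le by (simp add: x_def l3_def ll_def)
          have tn: "take n1 x = P" "drop n1 x = ys" "ch1 x = p" "core x = b.A ys" using takeP chP core[OF ys] by (simp_all add: x_def)
          have O'': "O' \<subseteq> E - set (take n1 x)" using O'R by (simp add: tn R_def)
          have sec: "(real k - m) * (w3 ys - f (core x)) \<le> (real k - m + card T + cd) * (V x - f (core x))"
            using second_chain_bound[OF x True k86 O'']
            unfolding P3 tn R_def[symmetric] Z_def[symmetric] ll_def[symmetric]
            by (simp add: w3_def X_def D_def T_def cd_def)
          have "real k * om \<le> (2 * real k - 1) * V x"
            using general_ratio[OF x True Opt] by (simp add: tn om_def)
          then have "real k * om \<le> 2 * real k * V x" using V_nonneg[OF x] by (simp add: algebra_simps)
          then have "om / 2 \<le> V x" using mk0 by simp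
          then have "w * (om / 2 - f (core x)) \<le> w * (V x - f (core x))" using w by (intro mult_left_mono) auto
          moreover have ident: "(kk' - mm) * ww + (kk' * aa + ww' * (vv - aa)) = (kk' - mm) * (ww - aa) + (2 * kk' - mm) * aa + ww' * (vv - aa)"
            for kk' mm ww aa ww' vv :: real by (simp add: algebra_simps)
          moreover have "(kk' - mm + tt + dd) * (vv - aa) + (2 * kk' - mm) * aa + (cc' + (kk' - (tt + cc' + dd))) * (vv - aa) = (2 * kk' - mm) * vv"
            for kk' mm tt dd cc' vv aa :: real by (simp add: algebra_simps)
          then have "(real k - m + card T + cd) * (V x - f (core x)) + (2 * real k - m) * f (core x) + w * (V x - f (core x)) = (2 * real k - m) * V x"
            unfolding w_def cc by simp
          ultimately have "(real k - m) * w3 ys + rest ys \<le> (2 * real k - m) * V x"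
            using sec unfolding rest by (simp only: ident)
          then show ?thesis using True by (simp add: Psi_def x_def)
        next
          case False
          \<comment> \<open>On a failing order the left side is at most 3 k v: subadditivity gives
            w3 \<le> 2 v, and \<open>rest\<close> is k times a convex combination of values at most
            v. The penalty is 4 k v.\<close>
          have AE: "b.A ys \<subseteq> E" "card (b.A ys) \<le> k" using b.A_sub(1,2)[of ys] ZE RE mk0 by auto
          have fA: "0 \<le> f (b.A ys)" "f (b.A ys) \<le> v" using f_nonneg[OF AE(1)] vmax[OF AE] by (simp_all add: v_def)
          have "w3 ys \<le> f ({} \<union> (X ys - (D ys \<inter> set (take l3 (drop ll ys)))))" unfolding w3_def by (rule worst_le) auto
          also have "\<dots> \<le> f (b.A ys \<union> (O' \<inter> (X ys - (D ys \<inter> set (take l3 (drop ll ys))) )))"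
          proof -
            have "b.A ys \<inter> D ys = {}" using b.A_sub(1)[of ys] unfolding D_def by blast
            then have "{} \<union> (X ys - (D ys \<inter> set (take l3 (drop ll ys)))) = b.A ys \<union> (O' \<inter> (X ys - (D ys \<inter> set (take l3 (drop ll ys)))))"
              unfolding X_def by blast
            then show ?thesis by simp
          qed
          also have "\<dots> \<le> f (b.A ys) + f (O' \<inter> (X ys - (D ys \<inter> set (take l3 (drop ll ys)))))"
            using AE O'R by (intro subadditive) auto
          also have "f (O' \<inter> (X ys - (D ys \<inter> set (take l3 (drop ll ys))))) \<le> v"
          proof -
            have "card (O' \<inter> (X ys - (D ys \<inter> set (take l3 (drop ll ys))))) \<le> card O'" by (intro card_mono fO') auto
            then show ?thesis unfolding v_def using O'R cO' by (intro vmax) auto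
          qed
          finally have w3: "w3 ys \<le> 2 * v" using fA by simp
          have "(real k - m) * w3 ys \<le> (real k - m) * (2 * v)" using w3 mk0 by (intro mult_left_mono) auto
          also have "\<dots> \<le> k * (2 * v)" using v0 by (intro mult_right_mono) auto
          finally have 1: "(real k - m) * w3 ys \<le> 2 * (real k * v)" by simp
          have "rest ys = (k - w) * f (b.A ys) + w * (om / 2)" unfolding rest a[symmetric] b.A_sub(3)[symmetric] by (simp add: algebra_simps)
          also have "\<dots> \<le> (k - w) * v + w * v" using fA w om_v om0 by (intro add_mono mult_left_mono) auto
          finally have "rest ys \<le> real k * v" by (simp add: algebra_simps)
          moreover have "0 \<le> (2 * real k - m) * V x" using kk V_nonneg[OF x] by simp
          moreover have "0 \<le> real k * v" using v0 by simp
          moreover have "Psi ys = (2 * real k - m) * V x + 4 * (real k * v)" using False by (simp add: Psi_def x_def)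
          ultimately show ?thesis using 1 by linarith
        qed
      qed
      have lle: "ll \<le> card R" using n_le by (simp add: cR ll_def)
      have "perm_avg R (\<lambda>ys. (real k - m) * (9999 / 10000 * b.W ys) + rest ys) \<le>
          perm_avg R (\<lambda>ys. perm_avg (R - set (take ll ys)) (\<lambda>zs. (real k - m) * w3 (take ll ys @ zs) + rest (take ll ys @ zs)))"
      proof (rule perm_avg_mono)
        fix ys assume ys: "ys \<in> permutations_of_set R"
        have ysf: "length ys = card R" "set ys = R" "distinct ys"
          using ys length_finite_permutations_of_set[OF ys] by (auto simp: permutations_of_set_def)
        define Bs where "Bs = take ll ys"
        have lB: "length Bs = ll" using ysf lle by (simp add: Bs_def)
        define R2 where "R2 = R - set Bs"
        have BR: "set Bs \<subseteq> R" using ysf set_take_subset[of ll ys] by (simp add: Bs_def)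
        have "card (set Bs) = ll" using ysf lB by (metis Bs_def distinct_card distinct_take)
        then have cR2: "card R2 = nE - n2" using BR finR n_le by (simp add: R2_def card_Diff_subset cR finite_subset ll_def)
        have tB: "take ll (Bs @ zs) = Bs" "drop ll (Bs @ zs) = zs" for zs using lB by simp_all
        have same: "X (Bs @ zs) = X ys" "D (Bs @ zs) = D ys" "rest (Bs @ zs) = rest ys" for zs
          unfolding X_def D_def rest_def b.A_def b.a_def tB unfolding Bs_def by simp_all
        have fR2: "finite R2" using finR by (simp add: R2_def)
        \<comment> \<open>The windows of the second chain take up at most 1/20000 of what follows
          the block, and \<open>worst\<close> loses twice this fraction.\<close>
        have "9999 / 10000 * f (X ys) \<le> (1 - 2 * (l3 / card R2)) * f (X ys)"
        proof (rule mult_right_mono)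
          have "20000 * real l3 \<le> card R2" using l(3) unfolding cR2 l3_def by linarith
          then show "9999 / 10000 \<le> 1 - 2 * (real l3 / card R2)"
            by (cases "card R2 = 0") (simp_all add: field_simps)
          show "0 \<le> f (X ys)" by (rule f_nonneg[OF XE(1)])
        qed
        also have "\<dots> \<le> perm_avg R2 (\<lambda>zs. worst (X ys) (D ys) (set (take l3 zs)))"
          by (rule perm_avg_worst_ge) (use RE XE l(3) in \<open>auto simp: R2_def cR2[unfolded R2_def] l3_def\<close>)
        finally have "(real k - m) * (9999 / 10000 * f (X ys)) \<le> (real k - m) * perm_avg R2 (\<lambda>zs. worst (X ys) (D ys) (set (take l3 zs)))"
          using mk0 by (intro mult_left_mono) auto
        moreover have "b.W ys = f (X ys)" by (simp add: b.W_def X_def)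
        moreover have "perm_avg R2 (\<lambda>zs. (real k - m) * w3 (Bs @ zs) + rest (Bs @ zs))
          = (real k - m) * perm_avg R2 (\<lambda>zs. worst (X ys) (D ys) (set (take l3 zs))) + rest ys"
          unfolding w3_def same tB by (simp only: perm_avg_add perm_avg_cmult perm_avg_const[OF fR2])
        ultimately show "(real k - m) * (9999 / 10000 * b.W ys) + rest ys
          \<le> perm_avg (R - set (take ll ys)) (\<lambda>zs. (real k - m) * w3 (take ll ys @ zs) + rest (take ll ys @ zs))"
          unfolding Bs_def[symmetric] R2_def[symmetric] by simp
      qed
      also have "\<dots> = perm_avg R (\<lambda>ys. (real k - m) * w3 ys + rest ys)"
        by (rule perm_avg_tower[OF finR lle, symmetric])
      also have "\<dots> \<le> perm_avg R Psi" by (rule perm_avg_mono) (rule low)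
      finally show ?thesis using bg unfolding rest_def by (simp only: add.assoc)
    qed
  qed
  have "50295 / 100000 * (2 * real k - m) * om = 50295 / 100000 * om * (2 * real k - m)" by simp
  then show ?thesis using goal unfolding om_def R_def Psi_def v_def by (simp only:)
qed

lemma symmetric_average:
  assumes Opt: "Opt \<subseteq> E" "card Opt \<le> k" and vmax: "\<And>X. X \<subseteq> E \<Longrightarrow> card X \<le> k \<Longrightarrow> f X \<le> f Opt"
    and k86: "86 \<le> k" and mk': "k \<le> 150 * m" "10000 * m \<le> 133 * k" and h: "0 < h" "100000 * (h - 1) \<le> k"
    and l: "71 * (nE - n1) \<le> 1000 * (n2 - n1)" "14 * (n2 - n1) \<le> nE - n1" "20000 * (n3 - n2) \<le> nE - n2"
  shows "50295 / 100000 * (2 * real k - m) * ((1 - 2 * (n1 / nE)) * f Opt) \<le>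
     (2 * real k - m) * perm_avg E V + 4 * k * f Opt * perm_avg E (\<lambda>xs. of_bool (\<not> ok xs))"
proof -
  have "0 \<le> 2 * real k - m" using mk by simp
  then have "50295 / 100000 * (2 * real k - m) * ((1 - 2 * (n1 / nE)) * f Opt) \<le>
      50295 / 100000 * (2 * real k - m) * perm_avg E (\<lambda>xs. worst Opt Opt (set (take n1 xs)))"
    using avg_worst_first[OF Opt(1)] by (intro mult_left_mono) auto
  also have "\<dots> = perm_avg E (\<lambda>xs. 50295 / 100000 * (2 * real k - m) * worst Opt Opt (set (take n1 xs)))"
    by (simp only: perm_avg_cmult)
  also have "\<dots> \<le> perm_avg E (\<lambda>xs. perm_avg (E - set (take n1 xs)) (\<lambda>ys. (2 * real k - m) * V (take n1 xs @ ys)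
      + 4 * k * f Opt * of_bool (\<not> ok (take n1 xs @ ys))))"
    by (rule perm_avg_mono) (rule symmetric_prefix_average[OF assms])
  also have "\<dots> = perm_avg E (\<lambda>xs. (2 * real k - m) * V xs + 4 * k * f Opt * of_bool (\<not> ok xs))"
    by (rule perm_avg_tower[OF fin, symmetric]) (use n_le in auto)
  also have "\<dots> = (2 * real k - m) * perm_avg E V + 4 * k * f Opt * perm_avg E (\<lambda>xs. of_bool (\<not> ok xs))"
    by (simp only: perm_avg_add perm_avg_cmult)
  finally show ?thesis .
qed

end

context coin_run
begin

text \<open>A union bound over the windows of both chains.\<close>

lemma not_ok_prob:
  assumes M: "M \<le> nE"
  shows "perm_avg E (\<lambda>xs. of_bool (\<not> ok xs)) \<le>
     (\<Sum>j<k. (1 - M / nE) ^ (cut bs (0 + Suc j * L) - cut bs (0 + j * L))) +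
     (\<Sum>j<k - m. (1 - M / nE) ^ (cut bs (K2 + Suc j * L) - cut bs (K2 + j * L)))"
proof -
  \<comment> \<open>The core is settled by the stream up to tick K2, as \<open>fails_prob\<close>
    demands of a base set.\<close>
  have core: "core xs = core (take n2 xs)" for xs
  proof -
    have "take (n2 - n1) (drop n1 xs) = take (n2 - n1) (drop n1 (take n2 xs))" by (simp add: drop_take)
    moreover have "ch1 xs = ch1 (take n2 xs)" unfolding ch1_def
      by (rule chain_cong_prefix[OF K_le(5)]) (use n_le in \<open>simp add: n1_def\<close>)
    ultimately show ?thesis unfolding core_def by simp
  qed
  have "perm_avg E (\<lambda>xs. of_bool (\<not> ok xs)) \<le> perm_avg E (\<lambda>xs. (\<Sum>j<k. of_bool (fails {} 0 k xs j)) +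
      (\<Sum>j<k - m. of_bool (fails (core xs) K2 (k - m) xs j)))"
  proof (rule perm_avg_mono)
    fix xs
    show "of_bool (\<not> ok xs) \<le> (\<Sum>j<k. of_bool (fails {} 0 k xs j)) + (\<Sum>j<k - m. of_bool (fails (core xs) K2 (k - m) xs j) :: real)"
    proof (cases "ok xs")
      case True then show ?thesis by (simp add: sum_nonneg)
    next
      case False
      then consider j where "j < k" "fails {} 0 k xs j" | j where "j < k - m" "fails (core xs) K2 (k - m) xs j"
        unfolding ok_def by blast
      then show ?thesis
      proof cases
        case 1
        then have "(1 :: real) \<le> (\<Sum>j<k. of_bool (fails {} 0 k xs j))"
          using member_le_sum[of j "{..<k}" "\<lambda>j. of_bool (fails {} 0 k xs j) :: real"] by simp
        then show ?thesis using False by (simp add: sum_nonneg add_increasing2)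
      next
        case 2
        then have "(1 :: real) \<le> (\<Sum>j<k - m. of_bool (fails (core xs) K2 (k - m) xs j))"
          using member_le_sum[of j "{..<k - m}" "\<lambda>j. of_bool (fails (core xs) K2 (k - m) xs j) :: real"] by simp
        then show ?thesis using False by (simp add: sum_nonneg add_increasing)
      qed
    qed
  qed
  also have "\<dots> = (\<Sum>j<k. perm_avg E (\<lambda>xs. of_bool (fails {} 0 k xs j))) + (\<Sum>j<k - m. perm_avg E (\<lambda>xs. of_bool (fails (core xs) K2 (k - m) xs j)))"
    by (simp only: perm_avg_add perm_avg_sum)
  also have "\<dots> \<le> (\<Sum>j<k. (1 - M / nE) ^ (cut bs (0 + Suc j * L) - cut bs (0 + j * L))) +
     (\<Sum>j<k - m. (1 - M / nE) ^ (cut bs (K2 + Suc j * L) - cut bs (K2 + j * L)))"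
  proof (intro add_mono sum_mono)
    fix j assume "j \<in> {..<k}"
    then show "perm_avg E (\<lambda>xs. of_bool (fails {} 0 k xs j)) \<le> (1 - M / nE) ^ (cut bs (0 + Suc j * L) - cut bs (0 + j * L))"
      using fails_prob[OF K_le(5) _ _ M, of j "\<lambda>_. {}"] by simp
  next
    fix j assume j: "j \<in> {..<k - m}"
    show "perm_avg E (\<lambda>xs. of_bool (fails (core xs) K2 (k - m) xs j)) \<le> (1 - M / nE) ^ (cut bs (K2 + Suc j * L) - cut bs (K2 + j * L))"
      by (rule fails_prob[OF K_le(6) _ _ M, of j core]) (use j core n2_def in auto)
  qed
  finally show ?thesis .
qed

end

section \<open>Independent coins: tick counts and window lengths\<close>

section \<open>Random ticks\<close>


text \<open>The mean over n independent coins, unfolded at the last coin, because runs and memories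
  grow at the end of the stream.\<close>

primrec coin_avg :: "real \<Rightarrow> nat \<Rightarrow> (bool list \<Rightarrow> real) \<Rightarrow> real" where
  "coin_avg p 0 g = g []"
| "coin_avg p (Suc n) g = coin_avg p n (\<lambda>bs. p * g (bs @ [True]) + (1 - p) * g (bs @ [False]))"

primrec coins :: "real \<Rightarrow> nat \<Rightarrow> bool list pmf" where
  "coins p 0 = return_pmf []"
| "coins p (Suc n) = bind_pmf (coins p n) (\<lambda>bs. map_pmf (\<lambda>b. bs @ [b]) (bernoulli_pmf p))"

lemma coin_avg_mono:
  assumes "0 \<le> p" "p \<le> 1" and "\<And>bs. length bs = n \<Longrightarrow> g bs \<le> h bs"
  shows "coin_avg p n g \<le> coin_avg p n h"
  using assms(3)
proof (induction n arbitrary: g h)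
  case 0 then show ?case by simp
next
  case (Suc n)
  have "p * g (bs @ [True]) + (1 - p) * g (bs @ [False]) \<le> p * h (bs @ [True]) + (1 - p) * h (bs @ [False])"
    if "length bs = n" for bs
    using Suc.prems[of "bs @ [True]"] Suc.prems[of "bs @ [False]"] that assms(1,2)
    by (intro add_mono mult_left_mono) auto
  then show ?case using Suc.IH by simp
qed

lemma coin_avg_cong:
  assumes "\<And>bs. length bs = n \<Longrightarrow> g bs = h bs"
  shows "coin_avg p n g = coin_avg p n h"
  using assms
proof (induction n arbitrary: g h)
  case (Suc n)
  have "p * g (bs @ [True]) + (1 - p) * g (bs @ [False]) = p * h (bs @ [True]) + (1 - p) * h (bs @ [False])"
    if "length bs = n" for bs
    using Suc.prems[of "bs @ [True]"] Suc.prems[of "bs @ [False]"] that by simp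
  then show ?case using Suc.IH[of "\<lambda>bs. p * g (bs @ [True]) + (1 - p) * g (bs @ [False])"
        "\<lambda>bs. p * h (bs @ [True]) + (1 - p) * h (bs @ [False])"] by simp
qed simp

lemma coin_avg_const [simp]: "coin_avg p n (\<lambda>_. c) = c"
  by (induction n) (simp_all add: left_diff_distrib)

lemma coin_avg_add: "coin_avg p n (\<lambda>bs. g bs + h bs) = coin_avg p n g + coin_avg p n h"
proof (induction n arbitrary: g h)
  case (Suc n)
  have "coin_avg p (Suc n) (\<lambda>bs. g bs + h bs) = coin_avg p n (\<lambda>bs. (p * g (bs @ [True]) + (1 - p) * g (bs @ [False]))
      + (p * h (bs @ [True]) + (1 - p) * h (bs @ [False])))"
    by (simp add: algebra_simps)
  also have "\<dots> = coin_avg p n (\<lambda>bs. p * g (bs @ [True]) + (1 - p) * g (bs @ [False]))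
      + coin_avg p n (\<lambda>bs. p * h (bs @ [True]) + (1 - p) * h (bs @ [False]))" by (rule Suc.IH)
  finally show ?case by simp
qed simp

lemma coin_avg_cmult: "coin_avg p n (\<lambda>bs. c * g bs) = c * coin_avg p n g"
proof (induction n arbitrary: g)
  case (Suc n)
  have "coin_avg p (Suc n) (\<lambda>bs. c * g bs) = coin_avg p n (\<lambda>bs. c * (p * g (bs @ [True]) + (1 - p) * g (bs @ [False])))"
    by (simp add: algebra_simps)
  then show ?case unfolding Suc.IH by simp
qed simp

lemma coin_avg_sum: "finite I \<Longrightarrow> coin_avg p n (\<lambda>bs. \<Sum>i\<in>I. g i bs) = (\<Sum>i\<in>I. coin_avg p n (g i))"
  by (induction I rule: finite_induct) (simp_all add: coin_avg_add)

lemma coin_avg_take: "a \<le> n \<Longrightarrow> coin_avg p n (\<lambda>bs. g (take a bs)) = coin_avg p a g"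
proof (induction n)
  case (Suc n)
  show ?case
  proof (cases "a = Suc n")
    case True
    then show ?thesis by (simp only:) (rule coin_avg_cong, simp)
  next
    case False
    then have "coin_avg p (Suc n) (\<lambda>bs. g (take a bs)) = coin_avg p n (\<lambda>bs. g (take a bs))"
      using Suc.prems unfolding coin_avg.simps by (intro coin_avg_cong) (simp add: left_diff_distrib)
    then show ?thesis using Suc False by simp
  qed
qed simp

lemma coin_avg_perm_avg:
  "perm_avg R (\<lambda>xs. coin_avg p n (\<lambda>bs. g bs xs)) = coin_avg p n (\<lambda>bs. perm_avg R (g bs))"
proof (induction n arbitrary: g)
  case (Suc n)
  have "perm_avg R (\<lambda>xs. coin_avg p (Suc n) (\<lambda>bs. g bs xs))
    = coin_avg p n (\<lambda>bs. perm_avg R (\<lambda>xs. p * g (bs @ [True]) xs + (1 - p) * g (bs @ [False]) xs))"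
    using Suc.IH[of "\<lambda>bs xs. p * g (bs @ [True]) xs + (1 - p) * g (bs @ [False]) xs"] by simp
  then show ?case by (simp add: perm_avg_add perm_avg_cmult)
qed simp

lemma set_pmf_coins: "set_pmf (coins p n) \<subseteq> {bs. length bs = n}"
  by (induction n) auto

lemma finite_coins: "finite (set_pmf (coins p n))"
proof -
  have "finite {bs :: bool list. length bs = n}" using finite_lists_length_eq[of "UNIV :: bool set" n] by simp
  then show ?thesis by (rule finite_subset[OF set_pmf_coins])
qed

lemma expectation_coins:
  fixes g :: "bool list \<Rightarrow> real"
  assumes p: "0 \<le> p" "p \<le> 1"
  shows "measure_pmf.expectation (coins p n) g = coin_avg p n g"
proof (induction n arbitrary: g)
  case (Suc n)
  have *: "measure_pmf.expectation (map_pmf (\<lambda>b. bs @ [b]) (bernoulli_pmf p)) g = p * g (bs @ [True]) + (1 - p) * g (bs @ [False])" for bs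
    using p by simp
  have "measure_pmf.expectation (coins p (Suc n)) g
    = (\<Sum>bs\<in>set_pmf (coins p n). pmf (coins p n) bs *\<^sub>R measure_pmf.expectation (map_pmf (\<lambda>b. bs @ [b]) (bernoulli_pmf p)) g)"
    unfolding coins.simps by (rule pmf_expectation_bind) (auto simp: finite_coins)
  also have "\<dots> = measure_pmf.expectation (coins p n) (\<lambda>bs. p * g (bs @ [True]) + (1 - p) * g (bs @ [False]))"
    unfolding * by (rule integral_measure_pmf[symmetric]) (auto simp: finite_coins)
  finally show ?case using Suc.IH by simp
qed simp

lemma coin_avg_variance:
  "coin_avg p n (\<lambda>bs. (real (ticks bs n) - n * p)\<^sup>2) = n * (p * (1 - p))"
proof -
  have "coin_avg p n (\<lambda>bs. (real (length (filter id bs)) - n * p)\<^sup>2) = n * (p * (1 - p))"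
  proof (induction n)
    case (Suc n)
    \<comment> \<open>Splitting off the last coin: the squared deviation grows by the variance of
      one coin, and the mixed term vanishes.\<close>
    have id: "p * (x + 1 - (nn + 1) * p)\<^sup>2 + (1 - p) * (x - (nn + 1) * p)\<^sup>2 = (x - nn * p)\<^sup>2 + p * (1 - p)" for x nn :: real
      by (simp add: power2_eq_square algebra_simps)
    have "coin_avg p (Suc n) (\<lambda>bs. (real (length (filter id bs)) - Suc n * p)\<^sup>2)
       = coin_avg p n (\<lambda>bs. p * (real (length (filter id bs)) + 1 - (real n + 1) * p)\<^sup>2 + (1 - p) * (real (length (filter id bs)) - (real n + 1) * p)\<^sup>2)"
      by (simp add: add.commute)
    also have "\<dots> = n * (p * (1 - p)) + p * (1 - p)" unfolding id coin_avg_add coin_avg_const Suc.IH ..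
    also have "n * (p * (1 - p)) + p * (1 - p) = Suc n * (p * (1 - p))" by (simp add: algebra_simps)
    finally show ?case .
  qed simp
  moreover have "coin_avg p n (\<lambda>bs. (real (ticks bs n) - n * p)\<^sup>2) = coin_avg p n (\<lambda>bs. (real (length (filter id bs)) - n * p)\<^sup>2)"
    by (rule coin_avg_cong) (simp add: ticks_def)
  ultimately show ?thesis by simp
qed

text \<open>Only the first a coins matter, and their variance a p (1 - p) is at most a p.\<close>

lemma ticks_chebyshev:
  assumes p: "0 \<le> p" "p \<le> 1" and "a \<le> n" "0 < d"
  shows "coin_avg p n (\<lambda>bs. of_bool (d \<le> \<bar>real (ticks bs a) - a * p\<bar>)) \<le> a * p / d\<^sup>2"
proof -
  have "coin_avg p n (\<lambda>bs. of_bool (d \<le> \<bar>real (ticks bs a) - a * p\<bar>)) \<le> coin_avg p n (\<lambda>bs. 1 / d\<^sup>2 * (real (ticks (take a bs) a) - a * p)\<^sup>2)"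
  proof (rule coin_avg_mono[OF p])
    fix bs :: "bool list"
    have "1 \<le> 1 / d\<^sup>2 * (real (ticks bs a) - a * p)\<^sup>2" if "d \<le> \<bar>real (ticks bs a) - a * p\<bar>"
      using power_mono[OF that, of 2] assms(4) by (simp add: le_divide_eq)
    then show "of_bool (d \<le> \<bar>real (ticks bs a) - a * p\<bar>) \<le> 1 / d\<^sup>2 * (real (ticks (take a bs) a) - a * p)\<^sup>2"
      by (simp add: ticks_def)
  qed
  also have "\<dots> = 1 / d\<^sup>2 * coin_avg p a (\<lambda>bs. (real (ticks bs a) - a * p)\<^sup>2)"
    unfolding coin_avg_cmult by (subst coin_avg_take[OF assms(3)]) simp
  also have "\<dots> = 1 / d\<^sup>2 * (a * (p * (1 - p)))" by (simp only: coin_avg_variance)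
  also have "\<dots> \<le> 1 / d\<^sup>2 * (a * (p * 1))" using p by (intro mult_left_mono) auto
  finally show ?thesis by simp
qed

lemma ticks_append: "i \<le> length bs \<Longrightarrow> ticks (bs @ cs) i = ticks bs i"
  by (simp add: ticks_def)

text \<open>The potential multiplies the discount collected so far by a bound on the expected discount still
  to be collected.\<close>

lemma window_discount:
  assumes p: "0 \<le> p" "p \<le> 1" and mu: "p \<le> mu" "mu \<le> 1"
  shows "coin_avg p n (\<lambda>bs. of_bool (a + L \<le> ticks bs n) * (1 - mu) ^ (cut bs (a + L) - cut bs a)) \<le> (1 / 2) ^ L"
proof -
  define len where "len bs = card {i. i < length bs \<and> a \<le> ticks bs i \<and> ticks bs i < a + L}" for bs
  define Psi where "Psi bs = (1 - mu) ^ len bs * (1 / 2) ^ min L (a + L - ticks bs (length bs))" for bs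
  have step: "p * Psi (bs @ [True]) + (1 - p) * Psi (bs @ [False]) \<le> Psi bs" for bs
  proof -
    define T where "T = ticks bs (length bs)"
    have T: "ticks (bs @ [b]) (length (bs @ [b])) = T + of_bool b" for b by (simp add: ticks_def T_def)
    have len: "len (bs @ [b]) = len bs + of_bool (a \<le> T \<and> T < a + L)" for b
    proof -
      have "{i. i < length (bs @ [b]) \<and> a \<le> ticks (bs @ [b]) i \<and> ticks (bs @ [b]) i < a + L}
        = (if a \<le> T \<and> T < a + L then insert (length bs) {i. i < length bs \<and> a \<le> ticks bs i \<and> ticks bs i < a + L}
           else {i. i < length bs \<and> a \<le> ticks bs i \<and> ticks bs i < a + L})"
        by (auto simp: less_Suc_eq ticks_append T_def)
      then show ?thesis unfolding len_def by simp
    qed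
    show ?thesis
    proof (cases "a \<le> T \<and> T < a + L")
      case True
      then obtain r where r: "a + L - T = Suc r" "Suc r \<le> L" by (metis Suc_diff_Suc add_diff_cancel_left' diff_le_mono2)
      then have r': "a + L - (T + 1) = r" by simp
      \<comment> \<open>An arrival in the window multiplies the potential by 1 - mu, and by a
        further 2 if it is a tick; the mean factor is (1 - mu)(p * 2 + 1 - p). So failure rate at
        least the tick rate is exactly what is needed.\<close>
      have "(1 - mu) * (1 + p) \<le> (1 - p) * (1 + p)" using p mu by (intro mult_right_mono) auto
      also have "\<dots> \<le> 1" by (simp add: algebra_simps)
      finally have le: "(1 - mu) * (1 + p) \<le> 1" .
      have "p * Psi (bs @ [True]) + (1 - p) * Psi (bs @ [False])
         = ((1 - mu) * (1 + p)) * ((1 - mu) ^ len bs * (1 / 2) ^ Suc r)"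
        unfolding Psi_def T len using True r r' by (simp add: min_def algebra_simps)
      also have "\<dots> \<le> 1 * ((1 - mu) ^ len bs * (1 / 2) ^ Suc r)" using le mu by (intro mult_right_mono) auto
      also have "\<dots> = Psi bs" unfolding Psi_def T_def[symmetric] using r by (simp add: min_def)
      finally show ?thesis .
    next
      case False
      then have "min L (a + L - (T + of_bool b)) = min L (a + L - T)" for b by (cases b) auto
      moreover have "of_bool (a \<le> T \<and> T < a + L) = (0 :: nat)" using False by simp
      ultimately have "Psi (bs @ [b]) = Psi bs" for b unfolding Psi_def T len T_def[symmetric] by (simp only: add_0_right)
      then show ?thesis by (simp add: left_diff_distrib)
    qed
  qed
  have "coin_avg p n (\<lambda>bs. of_bool (a + L \<le> ticks bs n) * (1 - mu) ^ (cut bs (a + L) - cut bs a)) \<le> coin_avg p n Psi"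
  proof (rule coin_avg_mono[OF p])
    fix bs :: "bool list" assume n: "length bs = n"
    show "of_bool (a + L \<le> ticks bs n) * (1 - mu) ^ (cut bs (a + L) - cut bs a) \<le> Psi bs"
    proof (cases "a + L \<le> ticks bs n")
      case False then show ?thesis using mu by (simp add: Psi_def)
    next
      case True
      then have "a \<le> ticks bs n" by simp
      have "{i. i < length bs \<and> a \<le> ticks bs i \<and> ticks bs i < a + L} = {cut bs a..<cut bs (a + L)}"
        using less_cut_iff[OF True] less_cut_iff[OF \<open>a \<le> ticks bs n\<close>] cut_le[OF True] n by (force simp: not_less[symmetric])
      then have "len bs = cut bs (a + L) - cut bs a" by (simp add: len_def)
      then show ?thesis using True n by (simp add: Psi_def)
    qed
  qed
  also have "\<dots> \<le> Psi []"
  proof (induction n)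
    case (Suc n)
    have "coin_avg p (Suc n) Psi \<le> coin_avg p n Psi" unfolding coin_avg.simps by (rule coin_avg_mono[OF p step])
    then show ?case using Suc by simp
  qed simp
  also have "Psi [] = (1 / 2) ^ L" by (simp add: Psi_def len_def)
  finally show ?thesis .
qed

section \<open>Encoding of states as bits, and the streaming algorithm\<close>

section \<open>Encoding of states\<close>


text \<open>This and the next two lemmas record which sets are queried; they allow the restricted
  oracle to be exchanged for \<open>f\<close>.\<close>

lemma pick_best_cong:
  assumes "\<And>B. B \<subseteq> X \<Longrightarrow> q B = f B"
  shows "pick_best q m X = pick_best f m X"
proof -
  have "(A \<subseteq> X \<and> card A \<le> m \<and> (\<forall>B. B \<subseteq> X \<longrightarrow> card B \<le> m \<longrightarrow> q B \<le> q A)) \<longleftrightarrow>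
      (A \<subseteq> X \<and> card A \<le> m \<and> (\<forall>B. B \<subseteq> X \<longrightarrow> card B \<le> m \<longrightarrow> f B \<le> f A))" for A
    using assms by (cases "A \<subseteq> X") auto
  then show ?thesis unfolding pick_best_def by simp
qed

lemma passes_cong:
  assumes "\<And>B. B \<subseteq> insert e (C \<union> set p) \<Longrightarrow> q B = f B"
  shows "passes q G C p e = passes f G C p e"
proof -
  have t: "C \<union> set (take i p) \<subseteq> insert e (C \<union> set p)" "insert e (C \<union> set (take i p)) \<subseteq> insert e (C \<union> set p)" for i
    using set_take_subset[of i p] by auto
  have "q (C \<union> set (take i p)) = f (C \<union> set (take i p))" "q (insert e (C \<union> set (take i p))) = f (insert e (C \<union> set (take i p)))" for i
    using assms t by blast+
  then show ?thesis unfolding passes_def gain_def by simp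
qed

lemma upd_cong:
  assumes "\<And>B. B \<subseteq> insert e (C \<union> set p) \<Longrightarrow> q B = f B"
  shows "upd q C j e p = upd f C j e p"
proof (cases "length p \<le> j")
  case False
  then have "p ! j \<in> set p" by simp
  then have "insert (p ! j) (C \<union> set (take j p)) \<subseteq> insert e (C \<union> set p)" "insert e (C \<union> set (take j p)) \<subseteq> insert e (C \<union> set p)"
    using set_take_subset[of j p] by auto
  then have "q (insert (p ! j) (C \<union> set (take j p))) = f (insert (p ! j) (C \<union> set (take j p)))"
    "q (insert e (C \<union> set (take j p))) = f (insert e (C \<union> set (take j p)))" using assms by blast+
  then show ?thesis unfolding upd_def by simp
qed (simp add: upd_def)

lemma card_lists_le:
  assumes M: "finite M" "card M \<le> 2 ^ D" and k: "k < 2 ^ D"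
  shows "finite {xs. set xs \<subseteq> M \<and> length xs \<le> k}" "card {xs. set xs \<subseteq> M \<and> length xs \<le> k} \<le> 2 ^ (D + D * k)"
proof -
  show "finite {xs. set xs \<subseteq> M \<and> length xs \<le> k}" using M(1) by (rule finite_lists_length_le)
  have "card M ^ i \<le> 2 ^ (D * k)" if "i \<le> k" for i
  proof -
    have "card M ^ i \<le> (2 ^ D) ^ i" using M(2) by (rule power_mono) simp
    also have "\<dots> \<le> (2 ^ D) ^ k" using that by (intro power_increasing) auto
    finally show ?thesis by (simp only: power_mult)
  qed
  then have "(\<Sum>i\<le>k. card M ^ i) \<le> of_nat (card {..k}) * 2 ^ (D * k)" by (intro sum_bounded_above) simp
  also have "\<dots> \<le> 2 ^ D * 2 ^ (D * k)" using k by (intro mult_right_mono) auto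
  finally show "card {xs. set xs \<subseteq> M \<and> length xs \<le> k} \<le> 2 ^ (D + D * k)"
    unfolding card_lists_length_le[OF M(1)] by (simp add: power_add)
qed

context machine
begin

lemma step_cong:
  assumes q: "\<And>B. B \<subseteq> insert e (carrier s) \<Longrightarrow> q B = f B" and s: "wf s"
  shows "step q b e s = step f b e s"
proof -
  obtain t p H A r where st: "s = (t, p, H, A, r)" by (cases s) auto
  have c: "carrier s = set p \<union> H \<union> A \<union> set r" by (simp add: carrier_def st)
  have AH: "A \<subseteq> H" using s by (simp add: wf_def st)
  have 1: "upd q {} j e p = upd f {} j e p" for j by (rule upd_cong) (rule q, auto simp: c)
  have 2: "upd q A j e r = upd f A j e r" for j by (rule upd_cong) (rule q, auto simp: c)
  have 3: "passes q G {} p e = passes f G {} p e" by (rule passes_cong) (rule q, auto simp: c)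
  have 4: "passes q {k - m - 1} A r e = passes f {k - m - 1} A r e" by (rule passes_cong) (rule q, auto simp: c)
  have 5: "pick_best q m H = pick_best f m H" by (rule pick_best_cong) (rule q, auto simp: c)
  have 6: "pick_best q m (insert e H) = pick_best f m (insert e H)" by (rule pick_best_cong) (rule q, auto simp: c)
  show ?thesis unfolding st step_def prod.case Let_def 1 2 3 4 by (simp add: 5 6)
qed

lemma carrier_bound: "wf s \<Longrightarrow> finite (carrier s) \<and> card (carrier s) \<le> cap + 2 * k"
proof -
  assume s: "wf s"
  obtain t p H A r where st: "s = (t, p, H, A, r)" by (cases s) auto
  have w: "length p \<le> k" "length r \<le> k" "finite H" "card H \<le> cap" "A \<subseteq> H" using s by (auto simp: wf_def st)
  have c: "carrier s = set p \<union> H \<union> set r" using w by (auto simp: carrier_def st)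
  have "card (carrier s) \<le> card (set p) + card H + card (set r)"
    unfolding c using card_Un_le[of "set p \<union> H" "set r"] card_Un_le[of "set p" H] by linarith
  then show ?thesis using w card_length[of p] card_length[of r] unfolding c by auto
qed

definition states :: "'a set \<Rightarrow> 'a state set" where
  "states C = {s. wf s \<and> carrier s = C}"

text \<open>Relative to the carrier, the counter costs D bits, each list of at most k stored
  elements D + D * k bits, and each of the two subsets one bit per stored element.\<close>

lemma card_states_le:
  assumes cm: "cap + 2 * k \<le> cm" "cm \<le> 2 ^ D" and D: "k < 2 ^ D" "K3 < 2 ^ D"
  shows "finite (states C)" "card (states C) \<le> 2 ^ (3 * D + 2 * (D * k) + 2 * cm)"
proof -
  have "finite (states C) \<and> card (states C) \<le> 2 ^ (3 * D + 2 * (D * k) + 2 * cm)"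
  proof (cases "states C = {}")
    case False
    then obtain s where "wf s" "carrier s = C" by (auto simp: states_def)
    then have C: "finite C" "card C \<le> cm" using carrier_bound[of s] cm by auto
    let ?L = "{xs. set xs \<subseteq> C \<and> length xs \<le> k}"
    let ?X = "{..K3} \<times> ?L \<times> Pow C \<times> Pow C \<times> ?L"
    have MD: "card C \<le> 2 ^ D" using C cm by simp
    note L = card_lists_le[OF C(1) MD D(1)]
    have "states C \<subseteq> ?X" by (auto simp: states_def wf_def carrier_def)
    moreover have fX: "finite ?X" using L(1) C(1) by simp
    ultimately have "finite (states C)" "card (states C) \<le> card ?X" by (auto intro: finite_subset card_mono)
    moreover have "card ?X \<le> 2 ^ D * (2 ^ (D + D * k) * (2 ^ cm * (2 ^ cm * 2 ^ (D + D * k))))"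
    proof -
      have "card (Pow C) \<le> 2 ^ cm" using C by (simp add: card_Pow)
      moreover have "card {..K3} \<le> 2 ^ D" using D by simp
      ultimately show ?thesis unfolding card_cartesian_product using L(2) by (intro mult_mono) auto
    qed
    moreover have "2 ^ D * (2 ^ (D + D * k) * (2 ^ cm * (2 ^ cm * 2 ^ (D + D * k)))) = (2 :: nat) ^ (3 * D + 2 * (D * k) + 2 * cm)"
      unfolding power_add[symmetric] by (rule arg_cong[where f = "power 2"]) simp
    ultimately show ?thesis by simp
  qed simp
  then show "finite (states C)" "card (states C) \<le> 2 ^ (3 * D + 2 * (D * k) + 2 * cm)" by auto
qed

text \<open>Codes are relative to the carrier, which is kept as the set of stored elements anyway.
  No bits are spent on identifying elements of E, so b does not grow with E. Injectivity is obtained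
  by counting.\<close>

definition enc :: "nat \<Rightarrow> 'a set \<Rightarrow> 'a state \<Rightarrow> bool list" where
  "enc b C = (SOME g. inj_on g (states C) \<and> (\<forall>s\<in>states C. length (g s) = b))"

lemma enc:
  fixes C :: "'b set"
  assumes "finite (states C)" "card (states C) \<le> 2 ^ b"
  shows "inj_on (enc b C) (states C)" "\<And>s. s \<in> states C \<Longrightarrow> length (enc b C s) = b"
proof -
  let ?B = "{w :: bool list. set w \<subseteq> UNIV \<and> length w = b}"
  have "card ?B = 2 ^ b" by (subst card_lists_length_eq) simp_all
  moreover have "finite ?B" by (rule finite_lists_length_eq) simp
  ultimately obtain g where "g ` states C \<subseteq> ?B" "inj_on g (states C)"
    using card_le_inj[OF assms(1), of ?B] assms(2) by auto
  then have "inj_on g (states C) \<and> (\<forall>s\<in>states C. length (g s) = b)" by auto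
  then have "\<exists>g :: 'b state \<Rightarrow> bool list. inj_on g (states C) \<and> (\<forall>s\<in>states C. length (g s) = b)" by blast
  from someI_ex[OF this] have "inj_on (enc b C) (states C) \<and> (\<forall>s\<in>states C. length (enc b C s) = b)" unfolding enc_def .
  then show "inj_on (enc b C) (states C)" "\<And>s. s \<in> states C \<Longrightarrow> length (enc b C s) = b" by auto
qed

definition mem :: "nat \<Rightarrow> 'a state \<Rightarrow> 'a memory" where
  "mem b s = (carrier s, enc b (carrier s) s)"

text \<open>The tick coin is flipped on arrival, so earlier coins need no record. A word encoding no
  state empties the memory, and an infinite stored set gives the empty output; this keeps
  \<open>valid_alg\<close> true on arbitrary memories.\<close>

definition alg :: "real \<Rightarrow> nat \<Rightarrow> 'a streaming_alg" where
  "alg p b = \<lparr>start = return_pmf (enc b ({} :: 'a set) init),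
     arrive = (\<lambda>e q (C, w). if w \<in> enc b C ` states C
        then map_pmf (\<lambda>c. mem b (step q c e (inv_into (states C) (enc b C) w))) (bernoulli_pmf p)
        else return_pmf ({}, w)),
     finish = (\<lambda>q (C, w). return_pmf (if finite C then pick_best q k C else {}))\<rparr>"

lemma valid_alg: "valid_alg k (alg p b)"
proof -
  have 1: "C' \<subseteq> insert e C" if mem: "(C', w') \<in> set_pmf (arrive (alg p b) e q (C, w))" for e q C w C' w'
  proof (cases "w \<in> enc b C ` states C")
    case True
    define s where "s = inv_into (states C) (enc b C) w"
    have "s \<in> states C" unfolding s_def using True by (rule inv_into_into)
    then have "wf s" "carrier s = C" by (auto simp: states_def)
    moreover obtain c where "C' = carrier (step q c e s)" using mem True by (auto simp: alg_def mem_def s_def)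
    ultimately show ?thesis using step_wf[of s q c e] by simp
  next
    case False
    then show ?thesis using mem by (simp add: alg_def)
  qed
  have 2: "X \<subseteq> C" "card X \<le> k" if "X \<in> set_pmf (finish (alg p b) q (C, w))" for q C w X
    using that pick_best(1,2)[of C q k] by (auto simp: alg_def split: if_splits)
  show ?thesis unfolding valid_alg_def
  proof (intro conjI allI ballI)
    fix e q C w x assume "x \<in> set_pmf (arrive (alg p b) e q (C, w))"
    then show "case x of (C', w') \<Rightarrow> C' \<subseteq> insert e C" using 1 by (cases x) simp
  qed (rule 2, assumption)+
qed

context
  fixes cm D b :: nat
  assumes cm: "cap + 2 * k \<le> cm" "cm \<le> 2 ^ D" and D: "k < 2 ^ D" "K3 < 2 ^ D"
    and b: "b = 3 * D + 2 * (D * k) + 2 * cm"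
begin

lemma run_snoc: "length bs = length xs \<Longrightarrow> run f (bs @ [c]) (xs @ [e]) = step f c e (run f bs xs)"
  by (simp add: run_def)

text \<open>Decoding inverts encoding on the states that occur, and \<open>step\<close> queries only
  subsets of the stored elements and the arriving one, so one arrival is one step of
  \<open>run\<close> with a fresh coin.\<close>

lemma memory_alg: "memory_after (alg p b) f xs = map_pmf (\<lambda>bs. mem b (run f bs xs)) (coins p (length xs))"
proof (induction xs rule: rev_induct)
  case Nil
  show ?case by (simp add: memory_after_def alg_def mem_def run_def carrier_def init_def map_return_pmf)
next
  case (snoc e xs)
  have "memory_after (alg p b) f (xs @ [e]) = bind_pmf (memory_after (alg p b) f xs)
      (\<lambda>(C, w). arrive (alg p b) e (restrict f (Pow (insert e C))) (C, w))"
    by (simp add: memory_after_def)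
  also have "\<dots> = bind_pmf (coins p (length xs)) (\<lambda>bs. case mem b (run f bs xs) of
      (C, w) \<Rightarrow> arrive (alg p b) e (restrict f (Pow (insert e C))) (C, w))"
    unfolding snoc.IH by (rule bind_map_pmf)
  also have "\<dots> = bind_pmf (coins p (length xs)) (\<lambda>bs. map_pmf (\<lambda>c. mem b (run f (bs @ [c]) (xs @ [e]))) (bernoulli_pmf p))"
  proof (rule bind_pmf_cong[OF refl])
    fix bs assume "bs \<in> set_pmf (coins p (length xs))"
    then have len: "length bs = length xs" using set_pmf_coins by blast
    define s where "s = run f bs xs"
    define C where "C = carrier s"
    have wf: "wf s" unfolding s_def by (rule conjunct1[OF run_wf])
    then have sM: "s \<in> states C" by (simp add: states_def C_def)
    have "inv_into (states C) (enc b C) (enc b C s) = s"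
      by (rule inv_into_f_f[OF enc(1)[OF card_states_le[OF cm D]] sM, folded b])
    moreover have "step (restrict f (Pow (insert e C))) c e s = step f c e s" for c
      by (rule step_cong[OF _ wf]) (simp add: C_def)
    moreover have "mem b s = (C, enc b C s)" by (simp add: mem_def C_def)
    ultimately show "(case mem b (run f bs xs) of (C, w) \<Rightarrow> arrive (alg p b) e (restrict f (Pow (insert e C))) (C, w))
      = map_pmf (\<lambda>c. mem b (run f (bs @ [c]) (xs @ [e]))) (bernoulli_pmf p)"
      using sM unfolding run_snoc[OF len] s_def[symmetric] by (simp add: alg_def)
  qed
  also have "\<dots> = map_pmf (\<lambda>bs. mem b (run f bs (xs @ [e]))) (coins p (length (xs @ [e])))"
    by (simp add: map_bind_pmf map_pmf_comp)
  finally show ?case .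
qed

lemma buffer_alg: "buffer_within (alg p b) f xs (cm + 1 + b)"
proof -
  have "card (if i < length xs then insert (xs ! i) C else C) + length w \<le> cm + 1 + b"
    if i: "i \<le> length xs" and m: "(C, w) \<in> set_pmf (memory_after (alg p b) f (take i xs))" for i C w
  proof -
    obtain bs where bs: "(C, w) = mem b (run f bs (take i xs))" using m unfolding memory_alg by auto
    define s where "s = run f bs (take i xs)"
    have wf: "wf s" unfolding s_def by (rule conjunct1[OF run_wf])
    have C: "C = carrier s" "w = enc b C s" using bs by (auto simp: mem_def s_def)
    then have "s \<in> states C" using wf by (simp add: states_def)
    then have "length w = b" unfolding C(2) by (rule enc(2)[OF card_states_le[OF cm D], folded b])
    moreover have "card C \<le> cm" "finite C" using carrier_bound[OF wf] cm C by auto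
    ultimately show ?thesis by (auto simp: card_insert_if)
  qed
  then show ?thesis unfolding buffer_within_def by blast
qed

lemma output_alg: "alg_output (alg p b) f xs = map_pmf (\<lambda>bs. pick_best f k (carrier (run f bs xs))) (coins p (length xs))"
proof -
  have "(case mem b (run f bs xs) of (C, w) \<Rightarrow> finish (alg p b) (restrict f (Pow C)) (C, w))
      = return_pmf (pick_best f k (carrier (run f bs xs)))" for bs
  proof -
    have "finite (carrier (run f bs xs))" using carrier_bound[OF conjunct1[OF run_wf]] by (rule conjunct1)
    moreover have "pick_best (restrict f (Pow C)) k C = pick_best f k C" for C by (rule pick_best_cong) simp
    ultimately show ?thesis by (simp add: mem_def alg_def)
  qed
  then show ?thesis unfolding alg_output_def memory_alg bind_map_pmf by (simp add: map_pmf_def)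
qed

lemma expectation_alg:
  assumes p: "0 \<le> p" "p \<le> 1" and E: "finite E"
  shows "measure_pmf.expectation (random_order_output (alg p b) E f) f
    = coin_avg p (card E) (\<lambda>bs. perm_avg E (\<lambda>xs. f (pick_best f k (carrier (run f bs xs)))))"
proof -
  let ?P = "permutations_of_set E"
  have fin: "finite ?P" "?P \<noteq> {}" using E by auto
  have len: "length xs = card E" if "xs \<in> ?P" for xs using that by (rule length_finite_permutations_of_set)
  have "measure_pmf.expectation (random_order_output (alg p b) E f) f
    = (\<Sum>xs\<in>?P. pmf (pmf_of_set ?P) xs *\<^sub>R measure_pmf.expectation (alg_output (alg p b) f xs) f)"
    unfolding random_order_output_def
    by (rule pmf_expectation_bind) (use fin finite_coins in \<open>auto simp: output_alg\<close>)
  also have "\<dots> = (\<Sum>xs\<in>?P. coin_avg p (card E) (\<lambda>bs. f (pick_best f k (carrier (run f bs xs)))) / fact (card E))"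
    by (rule sum.cong[OF refl])
       (simp add: fin pmf_of_set[OF fin(2,1)] card_perms[OF E] output_alg expectation_coins[OF p] len)
  also have "\<dots> = perm_avg E (\<lambda>xs. coin_avg p (card E) (\<lambda>bs. f (pick_best f k (carrier (run f bs xs)))))"
    unfolding perm_avg_def by (rule sum_divide_distrib[symmetric])
  finally show ?thesis unfolding coin_avg_perm_avg .
qed

end

end

section \<open>Short streams and k = 0\<close>

definition store_alg :: "nat \<Rightarrow> 'a streaming_alg" where
  "store_alg k = \<lparr>start = return_pmf [], arrive = (\<lambda>e q (M, w). return_pmf (insert e M, [])),
     finish = (\<lambda>q (M, w). return_pmf (if finite M then pick_best q k M else {}))\<rparr>"

lemma valid_store_alg: "valid_alg k (store_alg k)"
  using pick_best(1,2)[of _ _ k] by (auto simp: valid_alg_def store_alg_def)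

lemma memory_store_alg: "memory_after (store_alg k) f xs = return_pmf (set xs, [])"
  by (induction xs rule: rev_induct) (simp_all add: memory_after_def store_alg_def map_return_pmf bind_return_pmf)

lemma buffer_store_alg: "buffer_within (store_alg k) f xs (length xs)"
proof -
  have "card (if i < length xs then insert (xs ! i) (set (take i xs)) else set (take i xs)) \<le> length xs" if "i \<le> length xs" for i
  proof -
    have "(if i < length xs then insert (xs ! i) (set (take i xs)) else set (take i xs)) \<subseteq> set xs"
      using set_take_subset[of i xs] by auto
    then show ?thesis using card_mono[OF finite_set] card_length[of xs] order_trans by blast
  qed
  then show ?thesis unfolding buffer_within_def memory_store_alg by auto
qed

lemma output_store_alg: "alg_output (store_alg k) f xs = return_pmf (pick_best f k (set xs))"
proof -
  have "pick_best (restrict f (Pow M)) k M = pick_best f k M" for M by (rule pick_best_cong) simp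
  then show ?thesis unfolding alg_output_def memory_store_alg by (simp add: bind_return_pmf store_alg_def)
qed

text \<open>For k = 0, where the machine would have no windows; the empty set is then the only
  feasible output.\<close>

definition idle_alg :: "'a streaming_alg" where
  "idle_alg = \<lparr>start = return_pmf [], arrive = (\<lambda>e q (M, w). return_pmf ({}, [])), finish = (\<lambda>q (M, w). return_pmf {})\<rparr>"

lemma valid_idle_alg: "valid_alg 0 idle_alg"
  by (auto simp: valid_alg_def idle_alg_def)

lemma memory_idle_alg: "memory_after idle_alg f xs = return_pmf ({}, [])"
  by (induction xs rule: rev_induct) (simp_all add: memory_after_def idle_alg_def map_return_pmf bind_return_pmf)

lemma buffer_idle_alg: "buffer_within idle_alg f xs 1"
  unfolding buffer_within_def memory_idle_alg by auto

lemma output_idle_alg: "alg_output idle_alg f xs = return_pmf {}"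
  unfolding alg_output_def memory_idle_alg by (simp add: bind_return_pmf idle_alg_def)

section \<open>Parameters and their bounds\<close>

section \<open>Choice of the parameters\<close>


text \<open>Windows have \<open>win k\<close> ticks, so that one fails with probability at most \<open>1 / (10 ^ 9 * k\<^sup>2)\<close>; there are
  \<open>rate k\<close> ticks on average, \<open>mid k\<close> of them (\<open>0.071245\<close>) before the second chain. States with at most
  \<open>room k\<close> elements are encoded in \<open>info k\<close> bits, all other counters being below \<open>2 ^ width k\<close>.\<close>

definition win :: "nat \<Rightarrow> nat" where "win k = 30 + 2 * floorlog 2 k"
definition rate :: "nat \<Rightarrow> nat" where "rate k = 10 ^ 20 * k\<^sup>2 * win k"
definition mid :: "nat \<Rightarrow> nat" where "mid k = 71245 * 10 ^ 14 * k\<^sup>2 * win k"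
text \<open>The size m of the core, k / 150 rounded up: large enough to hold the saved elements of
  the optimum in the block up to the constant 150 in \<open>tau\<close>, small enough that the k - m
  places left to the second chain cost little.\<close>

definition part :: "nat \<Rightarrow> nat" where "part k = (k + 149) div 150"
text \<open>The spacing h of the levels: it gives about 10^5 multiples below k, while h - 1 stays
  below the k / 100000 that \<open>tight_chain\<close> tolerates.\<close>

definition gap :: "nat \<Rightarrow> nat" where "gap k = k div 100000 + 1"
definition room :: "nat \<Rightarrow> nat" where "room k = 10 ^ 26 * k\<^sup>2 * (win k)\<^sup>2"
definition width :: "nat \<Rightarrow> nat" where "width k = 87 + 3 * win k"
definition info :: "nat \<Rightarrow> nat" where "info k = 3 * width k + 2 * (width k * k) + 2 * room k"

lemma win_pos: "30 \<le> win k" by (simp add: win_def)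

lemma pow_win: "0 < k \<Longrightarrow> 10 ^ 9 * k\<^sup>2 \<le> 2 ^ win k"
proof -
  assume k: "0 < k"
  have "k \<le> 2 ^ floorlog 2 k" using floorlog_bounds[of k 2] k by simp
  then have "k\<^sup>2 \<le> (2 ^ floorlog 2 k)\<^sup>2" by (rule power_mono) simp
  then have "2 ^ 30 * k\<^sup>2 \<le> 2 ^ 30 * (2 ^ floorlog 2 k)\<^sup>2" by (rule mult_le_mono2)
  also have "\<dots> = 2 ^ win k" unfolding win_def power_add by (simp add: power_mult power2_eq_square flip: power_mult_distrib)
  finally show ?thesis by simp
qed

lemma k_le_sq: "(k :: nat) \<le> k\<^sup>2" by (simp add: power2_eq_square)

lemma machine_params: "0 < k \<Longrightarrow> machine k (win k) (mid k) (part k)"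
proof
  assume k: "0 < k"
  show "0 < k" by fact
  show "0 < win k" using win_pos[of k] by simp
  have "k * win k \<le> k\<^sup>2 * win k" using k_le_sq by (rule mult_le_mono1)
  also have "\<dots> \<le> mid k" by (simp add: mid_def)
  finally show "k * win k \<le> mid k" .
  show "part k \<le> k" using k unfolding part_def by linarith
  show "part k < k" if "86 \<le> k" using that unfolding part_def by linarith
qed

text \<open>The quotient \<open>part k / k\<close> is largest at k = 151, where it is 2 / 151 <
  0.0133.\<close>

lemma part_bounds: "k \<le> 150 * part k" "86 \<le> k \<Longrightarrow> 10000 * part k \<le> 133 * k"
proof -
  show "k \<le> 150 * part k" unfolding part_def by linarith
  assume k: "86 \<le> k"
  show "10000 * part k \<le> 133 * k"
  proof (cases "k \<le> 150")
    case True
    then have "part k \<le> 1" unfolding part_def by linarith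
    then show ?thesis using k by linarith
  next
    case False
    have "150 * part k \<le> k + 149" unfolding part_def by simp
    then show ?thesis using False by linarith
  qed
qed

lemma gap_bounds: "0 < gap k" "100000 * (gap k - 1) \<le> k"
  by (simp_all add: gap_def)

text \<open>About 10^5 multiples of the gap, the last level, and fewer powers of 2 than
  \<open>win k\<close>.\<close>

lemma card_levels: "0 < k \<Longrightarrow> card (levels (gap k) k) + 1 \<le> 10 ^ 5 * win k"
proof -
  assume k: "0 < k"
  have "levels (gap k) k \<subseteq> (\<lambda>i. gap k * i) ` {..100000} \<union> {k - 1} \<union> (\<lambda>a. 2 ^ a) ` {..<floorlog 2 k}"
  proof
    fix g assume "g \<in> levels (gap k) k"
    then have g: "g < k" "gap k dvd g \<or> g = k - 1 \<or> (\<exists>a. g = 2 ^ a)" by (auto simp: levels_def)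
    from g(2) show "g \<in> (\<lambda>i. gap k * i) ` {..100000} \<union> {k - 1} \<union> (\<lambda>a. 2 ^ a) ` {..<floorlog 2 k}"
    proof (elim disjE exE)
      assume "gap k dvd g"
      then obtain i where i: "g = gap k * i" by (elim dvdE)
      have "k < 100000 * gap k" unfolding gap_def by simp
      then have "gap k * i < gap k * 100000" using g(1) i by linarith
      then have "i \<le> 100000" by simp
      then show ?thesis using i by blast
    next
      fix a assume a: "g = 2 ^ a"
      have "k < 2 ^ floorlog 2 k" using floorlog_bounds[of k 2] k by simp
      then have "(2::nat) ^ a < 2 ^ floorlog 2 k" using g(1) a by linarith
      then have "a < floorlog 2 k" by (rule power_less_imp_less_exp[rotated]) simp
      then show ?thesis using a by blast
    qed simp
  qed
  then have "card (levels (gap k) k) \<le> card ((\<lambda>i. gap k * i) ` {..100000} \<union> {k - 1} \<union> (\<lambda>a. 2 ^ a) ` {..<floorlog 2 k})"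
    by (intro card_mono) auto
  also have "\<dots> \<le> card ((\<lambda>i. gap k * i) ` {..100000}) + card {k - 1} + card ((\<lambda>a. (2::nat) ^ a) ` {..<floorlog 2 k})"
    by (meson add_right_mono card_Un_le order_trans)
  also have "\<dots> \<le> 100001 + 1 + floorlog 2 k"
    using card_image_le[of "{..100000}" "\<lambda>i. gap k * i"] card_image_le[of "{..<floorlog 2 k}" "\<lambda>a. (2::nat) ^ a"] by simp
  finally show ?thesis by (simp add: win_def)
qed

text \<open>The cap is at most 10^5 \<open>win k\<close> times \<open>rate k\<close>, that is 10^25
  k^2 (win k)^2, which leaves ample space for the two chains in \<open>room k\<close>. The width
  uses 10^26 \<le> 2^87.\<close>

lemma bounds:
  assumes k: "0 < k"
  shows "machine.cap k (rate k) (gap k) + 2 * k \<le> room k" "room k \<le> 2 ^ width k" "k < 2 ^ width k"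
    "machine.K3 k (win k) (mid k) (part k) < 2 ^ width k" "rate k \<le> room k"
proof -
  interpret machine k "win k" "mid k" "part k" "rate k" "gap k" by (rule machine_params[OF k])
  have w: "win k \<le> (win k)\<^sup>2" "1 \<le> win k" using k_le_sq win_pos[of k] by simp_all
  define Y where "Y = k\<^sup>2 * (win k)\<^sup>2"
  have kY: "k \<le> Y" unfolding Y_def using mult_le_mono[OF k_le_sq[of k], of 1 "(win k)\<^sup>2"] w by simp
  have kwY: "k\<^sup>2 * win k \<le> Y" unfolding Y_def using w by simp
  have kw: "k * win k \<le> Y" unfolding Y_def using k_le_sq[of k] w by (intro mult_le_mono) auto
  have "cap \<le> (10 ^ 5 * win k) * rate k" unfolding cap_def G_def using card_levels[OF k] by (rule mult_le_mono1)
  also have "\<dots> = 10 ^ 25 * Y" by (simp add: rate_def Y_def power2_eq_square)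
  finally show "cap + 2 * k \<le> room k" using kY by (simp add: room_def Y_def[symmetric] mult.assoc)
  show rr: "room k \<le> 2 ^ width k"
  proof -
    have "k\<^sup>2 \<le> 10 ^ 9 * k\<^sup>2" by simp
    then have k2: "k\<^sup>2 \<le> 2 ^ win k" using pow_win[OF k] by linarith
    have "win k \<le> 2 ^ win k" using less_exp[of "win k"] by simp
    then have "(win k)\<^sup>2 \<le> (2 ^ win k)\<^sup>2" by (rule power_mono) simp
    with k2 have "k\<^sup>2 * (win k)\<^sup>2 \<le> 2 ^ win k * (2 ^ win k)\<^sup>2" by (rule mult_le_mono)
    also have "\<dots> = 2 ^ (3 * win k)" by (simp add: power_mult power3_eq_cube power2_eq_square mult.commute[of 3] flip: power_mult power_add)
    finally have "10 ^ 26 * (k\<^sup>2 * (win k)\<^sup>2) \<le> 2 ^ 87 * 2 ^ (3 * win k)" by (intro mult_le_mono) simp_all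
    then show ?thesis by (simp add: room_def width_def power_add mult.assoc)
  qed
  have "k < room k"
  proof -
    have "0 < Y" using kY k by simp
    then show ?thesis using kY by (simp add: room_def Y_def[symmetric] mult.assoc)
  qed
  then show "k < 2 ^ width k" using rr by simp
  have "(k - part k) * win k \<le> k * win k" by simp
  moreover have "K3 = mid k + (k - part k) * win k" by (rule K3_def)
  moreover have "mid k = 71245 * 10 ^ 14 * (k\<^sup>2 * win k)" unfolding mid_def by (rule mult.assoc)
  moreover have "0 < Y" using kY k by simp
  moreover have room: "room k = 10 ^ 26 * Y" unfolding room_def Y_def by (rule mult.assoc)
  moreover have "71245 * 10 ^ 14 * x + z < 10 ^ 26 * y" if "x \<le> y" "z \<le> y" "0 < y" for x y z :: nat using that by simp
  then have "71245 * 10 ^ 14 * (k\<^sup>2 * win k) + (k - part k) * win k < 10 ^ 26 * Y"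
    using kwY kw \<open>(k - part k) * win k \<le> k * win k\<close> \<open>0 < Y\<close> le_trans by blast
  ultimately have "K3 < room k" by metis
  then show "K3 < 2 ^ width k" using rr by simp
  have "rate k = 10 ^ 20 * (k\<^sup>2 * win k)" unfolding rate_def by (rule mult.assoc)
  moreover have "10 ^ 20 * x \<le> 10 ^ 26 * y" if "x \<le> y" for x y :: nat using that by simp
  ultimately show "rate k \<le> room k" using kwY room by metis
qed

lemma coin_run_average_nonneg:
  assumes "submod E f" "machine k L K2 m"
  shows "0 \<le> perm_avg E (\<lambda>xs. f (pick_best f k (machine.carrier (machine.run k L K2 m M h f bs xs))))"
proof -
  interpret submod E f by fact
  interpret machine k L K2 m M h by fact
  show ?thesis
  proof (rule perm_avg_ge_const[OF fin])
    fix xs assume "xs \<in> permutations_of_set E"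
    then have "set xs = E" by (simp add: permutations_of_set_def)
    then have c: "carrier (run f bs xs) \<subseteq> E" using run_wf[of f bs xs] by simp
    then have "finite (carrier (run f bs xs))" using fin by (rule finite_subset)
    from pick_best(1)[OF this, of f k] c have "pick_best f k (carrier (run f bs xs)) \<subseteq> E" by (rule subset_trans)
    then show "0 \<le> f (pick_best f k (carrier (run f bs xs)))" by (rule f_nonneg)
  qed
qed

section \<open>Typical coins and the collection of all errors\<close>

locale stream = submod E f for E :: "'a set" and f +
  fixes k :: nat
  assumes k0: "0 < k" and large: "rate k \<le> card E"
begin

sublocale machine k "win k" "mid k" "part k" "rate k" "gap k" by (rule machine_params[OF k0])

abbreviation "n \<equiv> card E"
abbreviation "L \<equiv> win k"

definition p :: real where "p = rate k / n"
text \<open>Fixed positions enclosing the random ones: the tick of number 0.071245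
  \<open>rate k\<close> is expected midway between \<open>a2\<close> and \<open>b2\<close>, and the
  second chain ends before \<open>b3\<close>. With \<open>a1\<close> the first chain occupies at
  most 1 / (10^10 k) of the stream.\<close>

definition "a1 = n div (10 ^ 10 * k)"
definition "a2 = 7124 * n div 100000"
definition "b2 = 7125 * n div 100000"
definition "b3 = 7126 * n div 100000"

definition good :: "bool list \<Rightarrow> bool" where
  "good bs \<longleftrightarrow> k * L \<le> ticks bs a1 \<and> ticks bs a2 < mid k \<and> mid k \<le> ticks bs b2 \<and> K3 \<le> ticks bs b3"

lemma rate_real: "real (rate k) = 10 ^ 20 * (real k * (real k * L))" "real (mid k) = 71245 / 1000000 * rate k"
  by (simp_all add: rate_def mid_def power2_eq_square)

lemma kL: "1 \<le> real k" "30 \<le> real L" "30 \<le> real k * L" "10 ^ 20 * (real k * L) \<le> rate k"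
proof -
  show k: "1 \<le> real k" using k0 by simp
  show L: "30 \<le> real L" using win_pos[of k] by simp
  have "1 * 30 \<le> real k * L" using k L by (intro mult_mono) auto
  then show kL: "30 \<le> real k * L" by simp
  have "1 * (real k * L) \<le> real k * (real k * L)" using k kL by (intro mult_right_mono) auto
  then show "10 ^ 20 * (real k * L) \<le> rate k" by (simp add: rate_real)
qed

lemma n_pos: "0 < real n" using large kL by simp

lemma p_bounds: "0 < p" "p \<le> 1" "real n * p = rate k"
  using large kL n_pos by (simp_all add: p_def divide_le_eq)

lemma div_times_p:
  assumes "0 < d" shows "real (x * n div d) * p \<le> x / d * rate k" "x / d * rate k - 1 \<le> real (x * n div d) * p"
proof -
  have "real (x * n div d) \<le> real (x * n) / d" by (rule of_nat_div_le_of_nat)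
  then have "real (x * n div d) * p \<le> real (x * n) / d * p" using p_bounds by (intro mult_right_mono) auto
  also have "\<dots> = x / d * (real n * p)" by simp
  finally show "real (x * n div d) * p \<le> x / d * rate k" by (simp only: p_bounds)
  have "real (x * n) / d - 1 \<le> real (x * n div d)" 
  proof -
    have "x * n < d + x * n div d * d" using assms by (rule dividend_less_div_times)
    then have "real (x * n) < real (d + x * n div d * d)" by (simp only: of_nat_less_iff)
    then have "real (x * n) < (real (x * n div d) + 1) * d" by (simp add: algebra_simps)
    then have "real (x * n) / d < real (x * n div d) + 1" using assms by (simp add: divide_less_eq)
    then show ?thesis by simp
  qed
  then have "(real (x * n) / d - 1) * p \<le> real (x * n div d) * p" using p_bounds by (intro mult_right_mono) auto
  moreover have "(real (x * n) / d - 1) * p = x / d * (real n * p) - p" by (simp add: left_diff_distrib)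
  ultimately show "x / d * rate k - 1 \<le> real (x * n div d) * p" unfolding p_bounds(3) using p_bounds(2) by linarith
qed

lemma ab_le: "a1 \<le> n" "a2 \<le> n" "b2 \<le> n" "b3 \<le> n"
  unfolding a1_def a2_def b2_def b3_def by (auto intro: div_le_dividend)

text \<open>Expected tick counts at the last three positions miss their thresholds by at least about
  5 / 10^6 of the rate, more than the deviation \<open>d\<close>; at \<open>a1\<close> they are
  10^10 times the k * L ticks required. Chebyshev bounds each of the four events by 1 / (10^9
  k).\<close>

lemma good_prob: "coin_avg p n (\<lambda>bs. of_bool (\<not> good bs)) \<le> 2 / (10 ^ 8 * real k)"
proof -
  define c where "c = real (rate k)"
  define X where "X = real k * L"
  define d1 where "d1 = 9000000000 * X"
  define d where "d = 4 / 1000000 * c"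
  have X: "30 \<le> X" "10 ^ 20 * X \<le> c" "c = 10 ^ 20 * (real k * X)" using kL rate_real by (simp_all add: X_def c_def)
  have X2: "100000000000000000000 * X \<le> c" using X(2) by simp
  have d: "0 < d1" "0 < d" using X by (simp_all add: d1_def d_def)
  have m: "real (mid k) = 71245 / 1000000 * c" by (simp add: rate_real(2) c_def)
  have a1: "real a1 * p \<le> 10000000000 * X" "10000000000 * X - 1 \<le> real a1 * p"
  proof -
    have "1 / (10 ^ 10 * real k) * c = 10000000000 * X" using kL(1) by (simp add: X(3))
    then show "real a1 * p \<le> 10000000000 * X" "10000000000 * X - 1 \<le> real a1 * p"
      using div_times_p[of "10 ^ 10 * k" 1] k0 unfolding a1_def c_def by simp_all
  qed
  have a2: "real a2 * p \<le> 7124 / 100000 * c" unfolding a2_def c_def using div_times_p(1)[of 100000 7124] by simp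
  have b2: "real b2 * p \<le> 7125 / 100000 * c" "7125 / 100000 * c - 1 \<le> real b2 * p"
    unfolding b2_def c_def using div_times_p[of 100000 7125] by simp_all
  have b3: "real b3 * p \<le> 7126 / 100000 * c" "7126 / 100000 * c - 1 \<le> real b3 * p"
    unfolding b3_def c_def using div_times_p[of 100000 7126] by simp_all
  have K3: "real K3 \<le> 71245 / 1000000 * c + X"
  proof -
    have "(k - part k) * L \<le> k * L" by simp
    then have "real K3 \<le> real (mid k + k * L)" unfolding K3_def by (simp only: of_nat_le_iff add_le_cancel_left)
    then show ?thesis by (simp add: m X_def)
  qed
  have ev: "coin_avg p n (\<lambda>bs. of_bool (d \<le> \<bar>real (ticks bs a) - a * p\<bar>)) \<le> 1 / (10 ^ 9 * real k)"
    if "a \<le> n" "real a * p \<le> 8 / 100 * c" for a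
  proof -
    have "coin_avg p n (\<lambda>bs. of_bool (d \<le> \<bar>real (ticks bs a) - a * p\<bar>)) \<le> a * p / d\<^sup>2"
      by (rule ticks_chebyshev) (use p_bounds that d in auto)
    also have "\<dots> \<le> 8 / 100 * c / d\<^sup>2" using that by (intro divide_right_mono) auto
    also have "\<dots> = 5 * 10 ^ 9 / c" using X by (simp add: d_def power2_eq_square field_simps)
    also have "\<dots> \<le> 1 / (10 ^ 9 * real k)"
    proof -
      have "real k * 30 \<le> real k * X" using X by (intro mult_left_mono) auto
      then show ?thesis using X kL(1) by (simp add: divide_le_eq le_divide_eq field_simps)
    qed
    finally show ?thesis .
  qed
  have ev1: "coin_avg p n (\<lambda>bs. of_bool (d1 \<le> \<bar>real (ticks bs a1) - a1 * p\<bar>)) \<le> 1 / (10 ^ 9 * real k)"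
  proof -
    have "coin_avg p n (\<lambda>bs. of_bool (d1 \<le> \<bar>real (ticks bs a1) - a1 * p\<bar>)) \<le> a1 * p / d1\<^sup>2"
      by (rule ticks_chebyshev) (use p_bounds ab_le d in auto)
    also have "\<dots> \<le> 10000000000 * X / d1\<^sup>2" using a1 by (intro divide_right_mono) auto
    also have "\<dots> = 1 / (81 * 10 ^ 8 * X)" using X by (simp add: d1_def power2_eq_square field_simps)
    also have "\<dots> \<le> 1 / (10 ^ 9 * real k)"
    proof -
      have "real k * 30 \<le> X" unfolding X_def using kL by (intro mult_left_mono) auto
      then show ?thesis using X kL(1) by (intro divide_left_mono mult_pos_pos) auto
    qed
    finally show ?thesis .
  qed
  have small: "real a2 * p \<le> 8 / 100 * c" "real b2 * p \<le> 8 / 100 * c" "real b3 * p \<le> 8 / 100 * c"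
    using a2 b2(1) b3(1) X(1) X2 by linarith+
  have "coin_avg p n (\<lambda>bs. of_bool (\<not> good bs)) \<le> coin_avg p n (\<lambda>bs.
      (of_bool (d1 \<le> \<bar>real (ticks bs a1) - a1 * p\<bar>) + of_bool (d \<le> \<bar>real (ticks bs a2) - a2 * p\<bar>)) +
      (of_bool (d \<le> \<bar>real (ticks bs b2) - b2 * p\<bar>) + of_bool (d \<le> \<bar>real (ticks bs b3) - b3 * p\<bar>)))"
  proof (rule coin_avg_mono)
    fix bs :: "bool list"
    have 1: "d1 \<le> \<bar>real (ticks bs a1) - a1 * p\<bar>" if "\<not> k * L \<le> ticks bs a1"
    proof -
      have "real (ticks bs a1) \<le> X" using that unfolding X_def by (simp flip: of_nat_mult)
      then show ?thesis using a1 X(1) unfolding d1_def by linarith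
    qed
    have 2: "d \<le> \<bar>real (ticks bs a2) - a2 * p\<bar>" if "\<not> ticks bs a2 < mid k"
    proof -
      have "real (mid k) \<le> real (ticks bs a2)" using that by simp
      then show ?thesis using a2 X(1) X2 m unfolding d_def by linarith
    qed
    have 3: "d \<le> \<bar>real (ticks bs b2) - b2 * p\<bar>" if "\<not> mid k \<le> ticks bs b2"
    proof -
      have "real (ticks bs b2) \<le> real (mid k)" using that by simp
      then show ?thesis using b2 X(1) X2 m unfolding d_def by linarith
    qed
    have 4: "d \<le> \<bar>real (ticks bs b3) - b3 * p\<bar>" if "\<not> K3 \<le> ticks bs b3"
    proof -
      have "real (ticks bs b3) \<le> real K3" using that by simp
      then show ?thesis using b3 X(1) X2 K3 unfolding d_def by linarith
    qed
    show "of_bool (\<not> good bs) \<le>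
      (of_bool (d1 \<le> \<bar>real (ticks bs a1) - a1 * p\<bar>) + of_bool (d \<le> \<bar>real (ticks bs a2) - a2 * p\<bar>)) +
      (of_bool (d \<le> \<bar>real (ticks bs b2) - b2 * p\<bar>) + of_bool (d \<le> \<bar>real (ticks bs b3) - b3 * p\<bar>) :: real)"
    proof (cases "good bs")
      case False
      then have "d1 \<le> \<bar>real (ticks bs a1) - a1 * p\<bar> \<or> d \<le> \<bar>real (ticks bs a2) - a2 * p\<bar> \<or>
          d \<le> \<bar>real (ticks bs b2) - b2 * p\<bar> \<or> d \<le> \<bar>real (ticks bs b3) - b3 * p\<bar>"
        using 1 2 3 4 unfolding good_def by blast
      then show ?thesis by (elim disjE) simp_all
    qed simp
  qed (use p_bounds in auto)
  also have "\<dots> \<le> (1 / (10 ^ 9 * real k) + 1 / (10 ^ 9 * real k)) + (1 / (10 ^ 9 * real k) + 1 / (10 ^ 9 * real k))"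
    unfolding coin_avg_add by (intro add_mono ev1 ev ab_le small)
  also have "\<dots> \<le> 2 / (10 ^ 8 * real k)" using kL(1) by (simp add: field_simps)
  finally show ?thesis .
qed

lemma ticks_le: "a \<le> b \<Longrightarrow> K \<le> ticks bs a \<Longrightarrow> K \<le> ticks bs b"
  using ticks_mono[of a b bs] by simp

lemma good_coin_run:
  assumes "good bs" "length bs = n"
  shows "coin_run k L (mid k) (part k) E f bs"
proof
  show "length bs = n" by fact
  show "0 < L" using win_pos[of k] by simp
  show "machine.K3 k L (mid k) (part k) \<le> ticks bs n"
    using assms(1) ab_le(4) ticks_le unfolding good_def K3_def[symmetric] by blast
qed

text \<open>Since M / n = p, the power of 1 - p bounds the probability over the order that the
  window fails, with the coins fixed. The indicator removes windows that never close, for which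
  \<open>cut\<close> is junk.\<close>

definition discount :: "bool list \<Rightarrow> nat \<Rightarrow> real" where
  "discount bs a = of_bool (a + L \<le> ticks bs n) * (1 - p) ^ (cut bs (a + L) - cut bs a)"

definition fail :: "bool list \<Rightarrow> real" where
  "fail bs = (\<Sum>j<k. discount bs (j * L)) + (\<Sum>j<k - part k. discount bs (mid k + j * L))"

lemma discount_nonneg: "0 \<le> discount bs a"
  using p_bounds by (simp add: discount_def)

lemma fail_nonneg: "0 \<le> fail bs"
  unfolding fail_def by (intro add_nonneg_nonneg sum_nonneg discount_nonneg)

lemma fail_avg: "coin_avg p n fail \<le> 2 / (10 ^ 9 * real k)"
proof -
  have d: "coin_avg p n (\<lambda>bs. discount bs a) \<le> (1 / 2) ^ L" for a
    unfolding discount_def by (rule window_discount) (use p_bounds in auto)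
  have "coin_avg p n fail = (\<Sum>j<k. coin_avg p n (\<lambda>bs. discount bs (j * L))) +
      (\<Sum>j<k - part k. coin_avg p n (\<lambda>bs. discount bs (mid k + j * L)))"
    unfolding fail_def by (simp only: coin_avg_add coin_avg_sum finite_lessThan)
  also have "\<dots> \<le> of_nat (card {..<k}) * (1 / 2) ^ L + of_nat (card {..<k - part k}) * (1 / 2) ^ L"
    by (intro add_mono sum_bounded_above d)
  also have "\<dots> = (real k + real (k - part k)) * (1 / 2) ^ L" by (simp add: distrib_right)
  also have "\<dots> \<le> (2 * real k) * (1 / 2) ^ L" by (intro mult_right_mono) auto
  also have "\<dots> \<le> 2 / (10 ^ 9 * real k)"
  proof -
    have "real (10 ^ 9 * k\<^sup>2) \<le> real (2 ^ L)" using pow_win[OF k0] by (simp only: of_nat_le_iff)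
    then have "10 ^ 9 * (real k * real k) \<le> 2 ^ L" by (simp add: power2_eq_square)
    then show ?thesis using kL(1) by (simp add: power_one_over field_simps)
  qed
  finally show ?thesis .
qed

definition val :: "bool list \<Rightarrow> real" where
  "val bs = perm_avg E (\<lambda>xs. f (pick_best f k (carrier (run f bs xs))))"

lemma val_nonneg: "0 \<le> val bs"
  unfolding val_def by (rule coin_run_average_nonneg) unfold_locales

text \<open>The block ends between 0.07124 n and 0.07125 n, just below 1/14 of the stream; the
  second chain spans at most about 0.00002 n.\<close>

lemma good_facts:
  assumes g: "good bs" "length bs = n"
  defines "n1 \<equiv> cut bs (k * L)" and "n2 \<equiv> cut bs (mid k)" and "n3 \<equiv> cut bs K3"
  shows "10 ^ 10 * k * n1 \<le> n" "71 * (n - n1) \<le> 1000 * (n2 - n1)" "14 * (n2 - n1) \<le> n - n1" "20000 * (n3 - n2) \<le> n - n2"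
proof -
  have "n1 \<le> a1" unfolding n1_def by (rule cut_le) (use g in \<open>simp add: good_def\<close>)
  then have "10 ^ 10 * k * n1 \<le> 10 ^ 10 * k * a1" by (rule mult_le_mono2)
  also have "\<dots> \<le> n" unfolding a1_def by (rule times_div_less_eq_dividend)
  finally show 1: "10 ^ 10 * k * n1 \<le> n" .
  have "10 ^ 10 * n1 \<le> 10 ^ 10 * k * n1" using k0 by (intro mult_le_mono1) simp
  then have "10 ^ 10 * n1 \<le> n" using 1 by (rule order_trans)
  then have n1: "10000000000 * n1 \<le> n" by simp
  have "n2 \<le> b2" unfolding n2_def by (rule cut_le) (use g in \<open>simp add: good_def\<close>)
  then have n2: "100000 * n2 \<le> 7125 * n" unfolding b2_def by linarith
  have "n3 \<le> b3" unfolding n3_def by (rule cut_le) (use g in \<open>simp add: good_def\<close>)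
  then have n3: "100000 * n3 \<le> 7126 * n" unfolding b3_def by linarith
  have "mid k \<le> ticks bs n" using g ab_le(3) ticks_le unfolding good_def by blast
  from less_cut_iff[OF this, of a2] have "a2 < n2" using g by (simp add: good_def n2_def)
  then have a2: "7124 * n \<le> 100000 * n2" unfolding a2_def by linarith
  show "71 * (n - n1) \<le> 1000 * (n2 - n1)" using n1 a2 by linarith
  show "14 * (n2 - n1) \<le> n - n1" using n1 n2 by linarith
  show "20000 * (n3 - n2) \<le> n - n2" using a2 n2 n3 by linarith
qed

lemma good_n1:
  assumes "good bs" "length bs = n"
  shows "1 - 2 * (real (cut bs (k * L)) / n) \<ge> 1 - 2 / (10 ^ 10 * real k)"
proof -
  have "real (10 ^ 10 * k * cut bs (k * L)) \<le> real n" using good_facts(1)[OF assms] by (simp only: of_nat_le_iff)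
  then have "real (cut bs (k * L)) / n \<le> 1 / (10 ^ 10 * real k)"
    using n_pos kL(1) by (simp add: divide_le_eq le_divide_eq field_simps)
  then show ?thesis by simp
qed

lemma good_fail:
  assumes "good bs" "length bs = n"
  shows "(\<Sum>j<k. (1 - rate k / n) ^ (cut bs (0 + Suc j * L) - cut bs (0 + j * L))) +
     (\<Sum>j<k - part k. (1 - rate k / n) ^ (cut bs (mid k + Suc j * L) - cut bs (mid k + j * L))) = fail bs"
proof -
  interpret coin_run k L "mid k" "part k" "rate k" "gap k" E f bs by (rule good_coin_run[OF assms])
  show ?thesis
    unfolding fail_def
  proof (intro arg_cong2[where f = "(+)"] sum.cong refl)
    fix j assume "j \<in> {..<k}"
    then have "Suc j * L \<le> k * L" by (intro mult_le_mono1) simp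
    then have "j * L + L \<le> ticks bs n" using K_le(1) by simp
    then show "(1 - rate k / n) ^ (cut bs (0 + Suc j * L) - cut bs (0 + j * L)) = discount bs (j * L)"
      by (simp add: discount_def p_def add.commute)
  next
    fix j assume "j \<in> {..<k - part k}"
    then have "Suc j * L \<le> (k - part k) * L" by (intro mult_le_mono1) simp
    then have "mid k + j * L + L \<le> ticks bs n" using K_le(6) by simp
    then show "(1 - rate k / n) ^ (cut bs (mid k + Suc j * L) - cut bs (mid k + j * L)) = discount bs (mid k + j * L)"
      by (simp add: discount_def p_def add.commute add.left_commute)
  qed
qed

context
  fixes Opt :: "'a set"
  assumes Opt: "Opt \<subseteq> E" "card Opt \<le> k" and vmax: "\<And>X. X \<subseteq> E \<Longrightarrow> card X \<le> k \<Longrightarrow> f X \<le> f Opt"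
begin

lemma Opt_nonneg: "0 \<le> f Opt" using f_nonneg[OF Opt(1)] .

text \<open>The losses from the prefix, from failing windows and from bad coins are all of order 1 /
  k and have coefficients of order k. Together they stay below 10^-6 f Opt.\<close>

lemma average_value:
  fixes a b c :: real
  assumes abc: "0 < a" "0 \<le> b" "0 \<le> c" "b \<le> 4 * k" "c \<le> 2 * k"
    and good: "\<And>bs. good bs \<Longrightarrow> length bs = n \<Longrightarrow> c * ((1 - 2 / (10 ^ 10 * real k)) * f Opt) \<le> a * val bs + b * f Opt * fail bs"
  shows "(c - 1 / 1000000) * f Opt \<le> a * coin_avg p n val"
proof -
  have e: "(1 - 2 / (10 ^ 10 * real k)) \<le> 1" using kL(1) by simp
  have e0: "0 \<le> 1 - 2 / (10 ^ 10 * real k)" using kL(1) by (simp add: divide_le_eq)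
  have "c * ((1 - 2 / (10 ^ 10 * real k)) * f Opt) = coin_avg p n (\<lambda>_. c * ((1 - 2 / (10 ^ 10 * real k)) * f Opt))" by simp
  also have "\<dots> \<le> coin_avg p n (\<lambda>bs. (a * val bs + b * f Opt * fail bs) + c * f Opt * of_bool (\<not> good bs))"
  proof (rule coin_avg_mono)
    fix bs :: "bool list" assume l: "length bs = n"
    show "c * ((1 - 2 / (10 ^ 10 * real k)) * f Opt) \<le> (a * val bs + b * f Opt * fail bs) + c * f Opt * of_bool (\<not> good bs)"
    proof (cases "good bs")
      case True then show ?thesis using good[OF True l] by simp
    next
      case False
      have "(1 - 2 / (10 ^ 10 * real k)) * f Opt \<le> 1 * f Opt" using e Opt_nonneg by (intro mult_right_mono)
      then have "c * ((1 - 2 / (10 ^ 10 * real k)) * f Opt) \<le> c * f Opt" using abc by (intro mult_left_mono) auto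
      moreover have "0 \<le> a * val bs + b * f Opt * fail bs" using abc val_nonneg fail_nonneg Opt_nonneg by simp
      ultimately show ?thesis using False by simp
    qed
  qed (use p_bounds in auto)
  also have "\<dots> = (a * coin_avg p n val + b * f Opt * coin_avg p n fail) + c * f Opt * coin_avg p n (\<lambda>bs. of_bool (\<not> good bs))"
    by (simp only: coin_avg_add coin_avg_cmult)
  finally have main: "c * ((1 - 2 / (10 ^ 10 * real k)) * f Opt) \<le> (a * coin_avg p n val + b * f Opt * coin_avg p n fail)
      + c * f Opt * coin_avg p n (\<lambda>bs. of_bool (\<not> good bs))" .
  have "b * f Opt * coin_avg p n fail \<le> (4 * k * f Opt) * (2 / (10 ^ 9 * real k))"
  proof (rule mult_mono)
    show "0 \<le> coin_avg p n fail" using coin_avg_mono[of p n "\<lambda>_. 0" fail] p_bounds fail_nonneg by simp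
  qed (use abc Opt_nonneg fail_avg in \<open>auto intro: mult_right_mono\<close>)
  also have "\<dots> = 8 / 1000000000 * f Opt" using kL(1) by simp
  finally have 1: "b * f Opt * coin_avg p n fail \<le> 8 / 1000000000 * f Opt" .
  have "c * f Opt * coin_avg p n (\<lambda>bs. of_bool (\<not> good bs)) \<le> (2 * k * f Opt) * (2 / (10 ^ 8 * real k))"
  proof (rule mult_mono)
    show "0 \<le> coin_avg p n (\<lambda>bs. of_bool (\<not> good bs))"
      using coin_avg_mono[of p n "\<lambda>_. 0" "\<lambda>bs. of_bool (\<not> good bs)"] p_bounds by simp
  qed (use abc Opt_nonneg good_prob in \<open>auto intro: mult_right_mono\<close>)
  also have "\<dots> = 4 / 100000000 * f Opt" using kL(1) by simp
  finally have 2: "c * f Opt * coin_avg p n (\<lambda>bs. of_bool (\<not> good bs)) \<le> 4 / 100000000 * f Opt" .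
  have "c * (2 / (10 ^ 10 * real k)) \<le> (2 * k) * (2 / (10 ^ 10 * real k))" using abc by (intro mult_right_mono) auto
  also have "\<dots> = 4 / 10000000000" using kL(1) by simp
  finally have 3: "c * (2 / (10 ^ 10 * real k)) * f Opt \<le> 4 / 10000000000 * f Opt" using Opt_nonneg by (rule mult_right_mono)
  have e1: "c * ((1 - 2 / (10 ^ 10 * real k)) * f Opt) = c * f Opt - c * (2 / (10 ^ 10 * real k)) * f Opt"
    by (simp only: left_diff_distrib right_diff_distrib mult.assoc mult_1_left)
  have e2: "(c - 1 / 1000000) * f Opt = c * f Opt - 1 / 1000000 * f Opt" by (rule left_diff_distrib)
  have "x - y \<le> (u + z) + w \<Longrightarrow> y \<le> 4 / 10000000000 * v \<Longrightarrow> z \<le> 8 / 1000000000 * v \<Longrightarrow> w \<le> 4 / 100000000 * v \<Longrightarrow>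
      0 \<le> v \<Longrightarrow> x - 1 / 1000000 * v \<le> u" for x y z u v w :: real
    by linarith
  from this[OF main[unfolded e1] 3 1 2 Opt_nonneg] show ?thesis unfolding e2 .
qed

lemma general_value: "(real k - 1 / 1000000) * f Opt \<le> (2 * real k - 1) * coin_avg p n val"
proof (rule average_value[where b = "2 * k"])
  fix bs assume g: "good bs" "length bs = n"
  interpret coin_run k L "mid k" "part k" "rate k" "gap k" E f bs by (rule good_coin_run[OF g])
  have v: "perm_avg E V = val bs" unfolding val_def V_def ..
  have "k * ((1 - 2 / (10 ^ 10 * real k)) * f Opt) \<le> k * ((1 - 2 * (n1 / nE)) * f Opt)"
    using good_n1[OF g] Opt_nonneg unfolding n1_def by (intro mult_left_mono mult_right_mono) auto
  also have "\<dots> \<le> (2 * real k - 1) * val bs + 2 * k * f Opt * perm_avg E (\<lambda>xs. of_bool (\<not> ok xs))"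
    using general_average[OF Opt vmax] unfolding v .
  also have "2 * k * f Opt * perm_avg E (\<lambda>xs. of_bool (\<not> ok xs)) \<le> 2 * k * f Opt * fail bs"
    using not_ok_prob[OF large] Opt_nonneg unfolding good_fail[OF g] by (intro mult_left_mono) auto
  finally show "real k * ((1 - 2 / (10 ^ 10 * real k)) * f Opt) \<le> (2 * real k - 1) * val bs + real (2 * k) * f Opt * fail bs" by simp
qed (use kL(1) in auto)

text \<open>k - 10^-6 is at least (2k - 1) / 2: the missing last pick pays for all errors.\<close>

lemma half_approx: "1 / 2 * f Opt \<le> coin_avg p n val"
proof -
  have "(2 * real k - 1) * (1 / 2 * f Opt) \<le> (real k - 1 / 1000000) * f Opt"
    using Opt_nonneg by (simp add: algebra_simps)
  then have "(2 * real k - 1) * (1 / 2 * f Opt) \<le> (2 * real k - 1) * coin_avg p n val" using general_value by linarith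
  then show ?thesis using kL(1) by (simp add: mult_le_cancel_left_pos)
qed

lemma symmetric_approx:
  assumes sym: "sym_submod E f"
  shows "5029 / 10000 * f Opt \<le> coin_avg p n val"
proof (cases "86 \<le> k")
  case False
  have "(2 * real k - 1) * (5029 / 10000) \<le> real k - 1 / 1000000" using False by simp
  then have "(2 * real k - 1) * (5029 / 10000) * f Opt \<le> (real k - 1 / 1000000) * f Opt"
    using Opt_nonneg by (rule mult_right_mono)
  then have "(2 * real k - 1) * (5029 / 10000 * f Opt) \<le> (2 * real k - 1) * coin_avg p n val"
    using general_value by (simp only: mult.assoc)
  then show ?thesis using kL(1) by (simp add: mult_le_cancel_left_pos)
next
  case True
  define a where "a = 2 * real k - part k"
  have a: "real k \<le> a" "a \<le> 2 * k" using mk(1) by (simp_all add: a_def)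
  have "(50295 / 100000 * a - 1 / 1000000) * f Opt \<le> a * coin_avg p n val"
  proof (rule average_value[where b = "4 * k"])
    fix bs assume g: "good bs" "length bs = n"
    interpret sym_submod E f by (rule sym)
    interpret coin_run k L "mid k" "part k" "rate k" "gap k" E f bs by (rule good_coin_run[OF g])
    interpret sym_coin_run k L "mid k" "part k" "rate k" "gap k" E f bs ..
    have v: "perm_avg E V = val bs" unfolding val_def V_def ..
    have "50295 / 100000 * a * ((1 - 2 / (10 ^ 10 * real k)) * f Opt) \<le> 50295 / 100000 * a * ((1 - 2 * (n1 / nE)) * f Opt)"
      using good_n1[OF g] Opt_nonneg a unfolding n1_def by (intro mult_left_mono mult_right_mono) auto
    also have "\<dots> \<le> a * val bs + 4 * k * f Opt * perm_avg E (\<lambda>xs. of_bool (\<not> ok xs))"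
      using symmetric_average[OF Opt vmax True part_bounds(1) part_bounds(2)[OF True] gap_bounds
          good_facts(2-4)[OF g, folded n1_def n2_def n3_def]] unfolding v a_def by simp
    also have "4 * k * f Opt * perm_avg E (\<lambda>xs. of_bool (\<not> ok xs)) \<le> 4 * k * f Opt * fail bs"
      using not_ok_prob[OF large] Opt_nonneg unfolding good_fail[OF g] by (intro mult_left_mono) auto
    finally show "50295 / 100000 * a * ((1 - 2 / (10 ^ 10 * real k)) * f Opt) \<le> a * val bs + real (4 * k) * f Opt * fail bs" by simp
  qed (use a True in auto)
  \<comment> \<open>0.50295 exceeds 0.5029 by 0.00005; times a \<ge> 86 this is more than the error
    10^-6.\<close>
  moreover have "a * (5029 / 10000) * f Opt \<le> (50295 / 100000 * a - 1 / 1000000) * f Opt"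
    using a True Opt_nonneg by (intro mult_right_mono) auto
  ultimately have "a * (5029 / 10000 * f Opt) \<le> a * coin_avg p n val" by (simp only: mult.assoc)
  then show ?thesis using a True by (simp add: mult_le_cancel_left_pos)
qed

end

end

section \<open>Assembly of the algorithm\<close>

definition memory_size :: "nat \<Rightarrow> nat" where
  "memory_size k = (if k = 0 then 1 else room k + 1 + info k)"

text \<open>The dominant term is \<open>room k\<close>. Of its two logarithmic factors one stems
  from the window length, the other from the number of levels, hence the exponent 2.\<close>

lemma memory_size_soft_bigo: "(\<lambda>k. real (memory_size k)) \<in> soft_bigo (\<lambda>k. real k ^ 2)"
proof -
  have "(\<lambda>k. real (memory_size k)) \<in> O(\<lambda>k. real k ^ 2 * ln (real k ^ 2) ^ 2)"
  proof (rule bigoI)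
    show "\<forall>\<^sub>F k in sequentially. norm (real (memory_size k)) \<le> 10 ^ 28 * 34 ^ 2 * norm (real k ^ 2 * ln (real k ^ 2) ^ 2)"
      using eventually_ge_at_top[of 2]
    proof eventually_elim
      case (elim k)
      define Y where "Y = k\<^sup>2 * (win k)\<^sup>2"
      have w: "win k \<le> (win k)\<^sup>2" "1 \<le> win k" using k_le_sq win_pos[of k] by simp_all
      have "1 * win k \<le> k\<^sup>2 * (win k)\<^sup>2" using w elim by (intro mult_le_mono) auto
      then have wY: "win k \<le> Y" by (simp add: Y_def)
      have kw: "win k * k \<le> Y" unfolding Y_def using k_le_sq[of k] w by (subst mult.commute) (intro mult_le_mono, auto)
      have kY: "k \<le> Y" using mult_le_mono1[OF w(2), of k] kw by linarith
      have room: "room k = 10 ^ 26 * Y" unfolding room_def Y_def by (rule mult.assoc)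
      have wk: "width k * k = 87 * k + 3 * (win k * k)" by (simp add: width_def algebra_simps)
      have "memory_size k = 3 * room k + 1 + 3 * width k + 2 * (width k * k)" using elim by (simp add: memory_size_def info_def)
      also have "\<dots> \<le> 10 ^ 28 * Y"
        using wY kw kY elim unfolding wk room unfolding width_def by simp
      finally have "real (memory_size k) \<le> real (10 ^ 28 * Y)" by (simp only: of_nat_le_iff)
      also have "\<dots> = 10 ^ 28 * (real k ^ 2 * real (win k) ^ 2)" by (simp add: Y_def)
      also have "\<dots> \<le> 10 ^ 28 * (real k ^ 2 * (34 * ln (real k ^ 2)) ^ 2)"
      proof (intro mult_left_mono power_mono)
        have lk: "1 \<le> log 2 k" using elim by (simp add: le_log_iff)
        have "real (floorlog 2 k) \<le> log 2 k + 1" using elim lk by (simp add: floorlog_def)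
        then have "real (win k) \<le> 34 * log 2 k" using lk by (simp add: win_def)
        also have "log 2 k \<le> 2 * ln (real k)"
        proof -
          have "1 / 2 \<le> ln (2 :: real)" using ln2_ge_two_thirds by simp
          moreover have "0 \<le> ln (real k)" using elim by simp
          ultimately have "1 / 2 * ln (real k) \<le> ln 2 * ln (real k)" by (intro mult_right_mono)
          then show ?thesis by (simp add: log_def field_simps)
        qed
        also have "2 * ln (real k) = ln (real k ^ 2)" using elim by (simp add: ln_realpow)
        finally show "real (win k) \<le> 34 * ln (real k ^ 2)" by simp
      qed auto
      finally show ?case by (simp add: power_mult_distrib)
    qed
  qed
  then show ?thesis unfolding soft_bigo_def by blast
qed

text \<open>For n below \<open>rate k\<close> the tick probability would exceed 1, but then the
  whole stream fits into the buffer.\<close>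

definition stream_alg :: "nat \<Rightarrow> nat \<Rightarrow> 'a streaming_alg" where
  "stream_alg k n = (if k = 0 then idle_alg else if n < rate k then store_alg k
     else machine.alg k (win k) (mid k) (part k) (rate k) (gap k) (rate k / n) (info k))"

lemma valid_stream_alg: "valid_alg k (stream_alg k n)"
proof (cases "k = 0")
  case False
  then interpret machine k "win k" "mid k" "part k" "rate k" "gap k" by (intro machine_params) simp
  show ?thesis using False by (simp add: stream_alg_def valid_store_alg valid_alg)
qed (simp add: stream_alg_def valid_idle_alg)

lemma buffer_mono: "buffer_within A f xs b \<Longrightarrow> b \<le> c \<Longrightarrow> buffer_within A f xs c"
  unfolding buffer_within_def by fastforce

lemma buffer_stream_alg:
  assumes "length xs = n"
  shows "buffer_within (stream_alg k n) f xs (memory_size k)"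
proof (cases "k = 0")
  case True then show ?thesis using buffer_idle_alg by (simp add: stream_alg_def memory_size_def)
next
  case False
  then have k: "0 < k" by simp
  interpret machine k "win k" "mid k" "part k" "rate k" "gap k" by (rule machine_params[OF k])
  show ?thesis
  proof (cases "n < rate k")
    case True
    have "length xs \<le> memory_size k" using True assms bounds(5)[OF k] False by (simp add: memory_size_def)
    then show ?thesis using buffer_mono[OF buffer_store_alg] True False by (simp add: stream_alg_def)
  next
    case F: False
    have "buffer_within (alg (rate k / n) (info k)) f xs (room k + 1 + info k)"
      by (rule buffer_alg[OF bounds(1-4)[OF k]]) (simp add: info_def)
    then show ?thesis using F False by (simp add: stream_alg_def memory_size_def)
  qed
qed

lemma optimum_attained:
  fixes f :: "'a set \<Rightarrow> real"
  assumes "finite E"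
  obtains Opt where "Opt \<subseteq> E" "card Opt \<le> k" "f Opt = Max (f ` {Y. Y \<subseteq> E \<and> card Y \<le> k})"
    "\<forall>X. X \<subseteq> E \<longrightarrow> card X \<le> k \<longrightarrow> f X \<le> f Opt"
proof -
  let ?S = "{Y. Y \<subseteq> E \<and> card Y \<le> k}"
  note P = pick_best[OF assms, where f = f and m = k]
  have "Max (f ` ?S) = f (pick_best f k E)"
    by (rule Max_eqI) (use P assms in auto)
  then show ?thesis using that[of "pick_best f k E"] P by auto
qed

lemma expectation_return_perm:
  assumes E: "finite E" and out: "\<And>xs. set xs = E \<Longrightarrow> alg_output A f xs = return_pmf X"
  shows "measure_pmf.expectation (random_order_output A E f) f = f X"
proof -
  have "random_order_output A E f = bind_pmf (pmf_of_set (permutations_of_set E)) (\<lambda>_. return_pmf X)"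
    unfolding random_order_output_def
  proof (rule bind_pmf_cong[OF refl])
    fix xs assume "xs \<in> set_pmf (pmf_of_set (permutations_of_set E))"
    then have "xs \<in> permutations_of_set E" using E by (subst (asm) set_pmf_of_set) auto
    then show "alg_output A f xs = return_pmf X" by (intro out) (simp add: permutations_of_set_def)
  qed
  then show ?thesis by simp
qed

lemma approx_stream_alg:
  assumes E: "finite E" and f: "nonneg_on E f" "submodular_on E f"
  shows "approximates (1 / 2) k (stream_alg k (card E)) E f"
    "symmetric_on E f \<Longrightarrow> approximates 0.5029 k (stream_alg k (card E)) E f"
proof -
  obtain Opt where Opt: "Opt \<subseteq> E" "card Opt \<le> k" "f Opt = Max (f ` {Y. Y \<subseteq> E \<and> card Y \<le> k})"
    and v: "\<forall>X. X \<subseteq> E \<longrightarrow> card X \<le> k \<longrightarrow> f X \<le> f Opt" by (rule optimum_attained[OF E, where f = f and k = k])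
  have vmax: "f X \<le> f Opt" if "X \<subseteq> E" "card X \<le> k" for X using v that by simp
  have sub: "submod E f" using E f by (simp add: submod_def)
  have v0: "0 \<le> f Opt" using f(1) Opt(1) by (simp add: nonneg_on_def)
  define ev where "ev = measure_pmf.expectation (random_order_output (stream_alg k (card E)) E f) f"
  have ap: "approximates \<alpha> k (stream_alg k (card E)) E f \<longleftrightarrow> \<alpha> * f Opt \<le> ev" for \<alpha>
    by (simp add: approximates_def ev_def Opt(3))
  have "1 / 2 * f Opt \<le> ev \<and> (symmetric_on E f \<longrightarrow> 0.5029 * f Opt \<le> ev)"
  proof (cases "k = 0")
    case True
    then have "Opt = {}" using Opt E finite_subset by fastforce
    moreover have "ev = f {}" unfolding ev_def using True
      by (intro expectation_return_perm E) (simp add: stream_alg_def output_idle_alg)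
    ultimately show ?thesis using v0 by simp
  next
    case False
    then have k: "0 < k" by simp
    interpret machine k "win k" "mid k" "part k" "rate k" "gap k" by (rule machine_params[OF k])
    show ?thesis
    proof (cases "card E < rate k")
      case True
      have "ev = f (pick_best f k E)" unfolding ev_def using True False
        by (intro expectation_return_perm E) (simp add: stream_alg_def output_store_alg)
      moreover have "f Opt \<le> f (pick_best f k E)" using pick_best(3)[OF E] Opt by blast
      ultimately show ?thesis using v0 by simp
    next
      case F: False
      interpret submod E f by (rule sub)
      interpret S: stream E f k by unfold_locales (use k F in auto)
      have "ev = measure_pmf.expectation (random_order_output (alg S.p (info k)) E f) f"
        using False F by (simp add: ev_def stream_alg_def S.p_def)
      also have "\<dots> = coin_avg S.p (card E) S.val" unfolding S.val_def
        by (rule expectation_alg[OF bounds(1-4)[OF k]]) (use S.p_bounds E in \<open>auto simp: info_def\<close>)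
      finally have ev: "ev = coin_avg S.p (card E) S.val" .
      have "1 / 2 * f Opt \<le> ev" unfolding ev by (rule S.half_approx[OF Opt(1,2) vmax])
      moreover have "0.5029 * f Opt \<le> ev" if "symmetric_on E f"
      proof -
        have "sym_submod E f" using sub that by (simp add: sym_submod_def sym_submod_axioms_def)
        from S.symmetric_approx[OF Opt(1,2) vmax this] show ?thesis unfolding ev by simp
      qed
      ultimately show ?thesis by blast
    qed
  qed
  then show "approximates (1 / 2) k (stream_alg k (card E)) E f"
    "symmetric_on E f \<Longrightarrow> approximates 0.5029 k (stream_alg k (card E)) E f"
    unfolding ap by auto
qed

theorem mainTheorem2:
  shows "\<exists>(A :: nat \<Rightarrow> nat \<Rightarrow> 'a streaming_alg) (B :: nat \<Rightarrow> nat).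
    (\<lambda>k. real (B k)) \<in> soft_bigo (\<lambda>k. real k ^ 2) \<and>
    (\<forall>k n. valid_alg k (A k n) \<and>
      (\<forall>(E :: 'a set) (f :: 'a set \<Rightarrow> real).
        finite E \<longrightarrow> card E = n \<longrightarrow> nonneg_on E f \<longrightarrow> submodular_on E f \<longrightarrow>
          (\<forall>xs \<in> permutations_of_set E. buffer_within (A k n) f xs (B k)) \<and>
          approximates (1/2) k (A k n) E f \<and>
          (symmetric_on E f \<longrightarrow> approximates 0.5029 k (A k n) E f)))"
proof (intro exI[of _ stream_alg] exI[of _ memory_size] conjI allI impI ballI)
  fix k n :: nat and E :: "'a set" and f :: "'a set \<Rightarrow> real"
  assume E: "finite E" "card E = n" and f: "nonneg_on E f" "submodular_on E f"
  show "buffer_within (stream_alg k n) f xs (memory_size k)" if "xs \<in> permutations_of_set E" for xs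
    using length_finite_permutations_of_set[OF that] E by (intro buffer_stream_alg) simp
  show "approximates (1/2) k (stream_alg k n) E f" using approx_stream_alg(1)[OF E(1) f] E(2) by simp
  show "approximates 0.5029 k (stream_alg k n) E f" if "symmetric_on E f"
    using approx_stream_alg(2)[OF E(1) f that] E(2) by simp
qed (rule memory_size_soft_bigo valid_stream_alg)+

end
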